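(* Let $p\ge0$ be an integer, $Q\in W_\infty^p[0,b]$ and $h\in\mathbb{C}$, and let $\beta_N$, $\gamma_N$ be the Fourier–Legendre coefficients of the associated transmutation kernel $K$ and of its derivative $K_1=\partial_xK$, as defined in the context. There exist constants $C_p$ and $D_p$ (independent of $N$) such that for all $x\in(0,b]$ $$|\beta_N(x)|\le\frac{C_px^{p+2}}{(N-1)^{p+1/2}},\qquad N\ge p+1,$$ and $$|\gamma_N(x)|\le\frac{D_px^{p+1}}{(N-1)^{p-1/2}},\qquad N\ge p.$$
   Context: $b>0$ is finite. $Q\in W_\infty^p[0,b]$ means that the (in general complex-valued) function $Q$ possesses $p$ derivatives, the last one belonging to $L_\infty(0,b)$ ($W^0_\infty=L_\infty$). For $\omega\in\mathbb{C}$ let $c(\omega,x)$, $s(\omega,x)$ be the solutions of $u''-Q(x)u=-\omega^2u$ on $(0,b)$ with $c(\omega,0)=1$, $c'(\omega,0)=h$, $s(\omega,0)=0$, $s'(\omega,0)=\omega$. The transmutation kernel $K(x,t)$, $0\le x\le b$, $|t|\le x$, is the (well-known) function, independent of $\omega$, for which $$c(\omega,x)=\cos\omega x+\int_{-x}^xK(x,t)\cos\omega t\,dt,\qquad s(\omega,x)=\sin\omega x+\int_{-x}^xK(x,t)\sin\omega t\,dt$$ for all $\omega\in\mathbb{C}$. It satisfies $K(x,x)=\frac h2+\frac12\int_0^xQ(s)\,ds$ and $K(x,-x)=\frac h2$, and it possesses $p+1$ derivatives with respect to each variable when $Q\in W^p_\infty[0,b]$, with $\sup_{0<x\le b}\|\partial_t^{p+1}K(x,\cdot)\|_{L_\infty(-x,x)}$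 and $\sup_{0<x\le b}\|\partial_t^{p}K_1(x,\cdot)\|_{L_\infty(-x,x)}$ finite, where $K_1=\partial_xK$. With $P_n$ the classical Legendre polynomials, for $n\ge0$, $$\beta_n(x)=\frac{2n+1}2\int_{-x}^xK(x,t)P_n\left(\frac tx\right)dt,\qquad \gamma_n(x)=\frac{2n+1}2\int_{-x}^xK_1(x,t)P_n\left(\frac tx\right)dt.$$
   Formalization: Both bounds are stated only for N ≥ 2 (besides N ≥ p+1, resp. N ≥ p), since for N = 0 or 1 the power of N-1 in the denominator is zero or undefined; this affects only p = 0 (both bounds) and p = 1 (the second). *)

theory Defs
  imports "HOL-Analysis.Analysis" "HOL-Computational_Algebra.Polynomial"
begin

definition L_infty :: "real \<Rightarrow> (real \<Rightarrow> complex) \<Rightarrow> bool" where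
  "L_infty b f \<longleftrightarrow>
     f \<in> borel_measurable (lebesgue_on {0..b}) \<and>
     (\<exists>M. AE x in lebesgue_on {0..b}. norm (f x) \<le> M)"

text \<open>Derivatives are meant in the usual Sobolev sense: each function is a primitive of the next
  one, and the last one is only determined almost everywhere. Since the last one is essentially
  bounded, this says that \<open>f\<close> has \<open>p - 1\<close> classical derivatives, the highest of which is absolutely
  continuous with almost everywhere derivative in \<open>L\<^sub>\<infinity>\<close>.\<close>

primrec W_infty :: "nat \<Rightarrow> real \<Rightarrow> (real \<Rightarrow> complex) \<Rightarrow> bool" where
  "W_infty 0 b f \<longleftrightarrow> L_infty b f"
| "W_infty (Suc p) b f \<longleftrightarrow>
     (\<exists>g. W_infty p b g \<and> (\<forall>x\<in>{0..b}. (g has_integral (f x - f 0)) {0..x}))"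

text \<open>\<open>u\<close> is the solution of \<open>u'' - Q u = - \<omega>\<^sup>2 u\<close>, \<open>u(0) = u0\<close>, \<open>u'(0) = u1\<close>. As \<open>Q\<close> may be merely
  essentially bounded, this is a Caratheodory solution: \<open>u\<close> is differentiable, \<open>u' = v\<close>
  is absolutely continuous, and the equation holds almost everywhere, i.e. \<open>v\<close> is a primitive of
  \<open>(Q - \<omega>\<^sup>2) u\<close>.\<close>

definition schroedinger_ivp ::
    "real \<Rightarrow> (real \<Rightarrow> complex) \<Rightarrow> complex \<Rightarrow> complex \<Rightarrow> complex \<Rightarrow> (real \<Rightarrow> complex) \<Rightarrow> bool" where
  "schroedinger_ivp b Q \<omega> u0 u1 u \<longleftrightarrow>
     (\<exists>v. u 0 = u0 \<and> v 0 = u1 \<and>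
        (\<forall>x\<in>{0..b}.
           (u has_vector_derivative v x) (at x within {0..b}) \<and>
           ((\<lambda>y. (Q y - \<omega>\<^sup>2) * u y) has_integral (v x - v 0)) {0..x}))"

text \<open>For given solutions \<open>c\<close>, \<open>s\<close> the two representations determine \<open>K(x, \<cdot>)\<close> only up to null sets;
  continuity on the triangle selects the (unique) pointwise kernel, which is needed for
  \<open>\<partial>\<^sub>x K\<close> to make sense. Values of \<open>K\<close> outside of the triangle are irrelevant.\<close>

definition transmutation_kernel ::
    "real \<Rightarrow> (complex \<Rightarrow> real \<Rightarrow> complex) \<Rightarrow> (complex \<Rightarrow> real \<Rightarrow> complex) \<Rightarrow>
     (real \<Rightarrow> real \<Rightarrow> complex) \<Rightarrow> bool" where
  "transmutation_kernel b c s K \<longleftrightarrow>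
     continuous_on {(x, t). 0 \<le> x \<and> x \<le> b \<and> \<bar>t\<bar> \<le> x} (\<lambda>(x, t). K x t) \<and>
     (\<forall>\<omega>. \<forall>x\<in>{0..b}.
        c \<omega> x = cos (\<omega> * of_real x) + integral {-x..x} (\<lambda>t. K x t * cos (\<omega> * of_real t)) \<and>
        s \<omega> x = sin (\<omega> * of_real x) + integral {-x..x} (\<lambda>t. K x t * sin (\<omega> * of_real t)))"

text \<open>\<open>K\<^sub>1 = \<partial>\<^sub>x K\<close>. For fixed \<open>t\<close> the kernel lives on \<open>|t| \<le> x \<le> b\<close>, so the derivative is
  one-sided at the end points and two-sided inside.\<close>

definition dx_kernel :: "real \<Rightarrow> (real \<Rightarrow> real \<Rightarrow> complex) \<Rightarrow> real \<Rightarrow> real \<Rightarrow> complex" where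
  "dx_kernel b K x t = vector_derivative (\<lambda>y. K y t) (at x within {\<bar>t\<bar>..b})"

text \<open>Rodrigues' formula.\<close>

definition legendre_poly :: "nat \<Rightarrow> real poly" where
  "legendre_poly n = smult (1 / (2 ^ n * fact n)) ((pderiv ^^ n) ([:-1, 0, 1:] ^ n))"

definition fourier_legendre_coeff :: "(real \<Rightarrow> real \<Rightarrow> complex) \<Rightarrow> nat \<Rightarrow> real \<Rightarrow> complex" where
  "fourier_legendre_coeff F n x =
     of_real ((2 * real n + 1) / 2) *
     integral {-x..x} (\<lambda>t. F x t * of_real (poly (legendre_poly n) (t / x)))"

definition beta_coeff :: "(real \<Rightarrow> real \<Rightarrow> complex) \<Rightarrow> nat \<Rightarrow> real \<Rightarrow> complex" where
  "beta_coeff K = fourier_legendre_coeff K"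

definition gamma_coeff :: "real \<Rightarrow> (real \<Rightarrow> real \<Rightarrow> complex) \<Rightarrow> nat \<Rightarrow> real \<Rightarrow> complex" where
  "gamma_coeff b K = fourier_legendre_coeff (dx_kernel b K)"

end

theory Submission
  imports Defs
begin

text \<open>In the characteristic coordinates \<open>u = (x + t) / 2\<close>, \<open>v = (x - t) / 2\<close> the kernel satisfies a Goursat
  integral equation. It follows from the two representations: insert them into the
  variation-of-constants formula for \<open>c + \<i> s\<close>, write \<open>sin (\<omega> (x - y)) / \<omega>\<close> as an integral of
  exponentials, exchange integrals, and compare Fourier transforms. So neither existence nor regularity
  of \<open>K\<close> has to be known in advance. Each use of the integral equation gains one derivative as long as
  \<open>Q\<close> permits it, hence all partial derivatives of \<open>K\<close> of order \<open>p\<close> are Lipschitz continuous.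

  The identity \<open>(2 n + 1) P\<^sub>n = P\<^sub>n\<^sub>+\<^sub>1' - P\<^sub>n\<^sub>-\<^sub>1'\<close> turns an integration by parts into a factor
  \<open>x / (2 n + 1)\<close>. It is applied once per available derivative, and once more to the Lipschitz
  continuous derivative of order \<open>p\<close>; the additional \<open>N\<^sup>-\<^sup>1\<^sup>/\<^sup>2\<close> is the size of \<open>P\<^sub>N\<close> in mean. For
  \<open>\<gamma>\<^sub>N\<close> and \<open>p = 0\<close> the boundedness of \<open>\<partial>\<^sub>x K\<close> suffices.\<close>

subsection \<open>Legendre polynomials\<close>

text \<open>The obstacle is that \<open>Q\<close> may be merely bounded and measurable. The equation
  for u then holds almost everywhere only, and the wave equation of the kernel has no classical
  meaning. So the argument runs on integral identities, and the highest regularity is carried by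
  Lipschitz constants instead of essentially bounded derivatives. A Lipschitz constant on the whole
  characteristic triangle serves all cross sections x = const at once; this is why the final
  constants do not depend on x.

  Counting powers: Lipschitz derivatives of order p allow p + 1 integrations by parts, each worth x
  / N up to a constant. The mean size of the Legendre polynomial contributes x / sqrt N, and the
  normalization (2 N + 1) / 2 takes one power of N back. This gives x^(p+2) / N^(p+1/2), and a
  derivative in x costs one order. Except for gamma with p = 0, the bounds come out in powers of N +
  1 and are then weakened to N - 1.\<close>

lemma poly_pderiv_funpow_linear_power:
  fixes g :: "real poly"
  shows "poly ((pderiv ^^ n) ([:- a, 1:] ^ n * g)) a = fact n * poly g a"
proof (induction n arbitrary: g)
  case (Suc n)
  define l where "l = [:- a, 1:]"
  have [simp]: "pderiv l = 1" "poly l a = 0" by (simp_all add: l_def pderiv_pCons)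
  \<comment> \<open>One derivative uses up one factor l and replaces g by (n + 1) g + l g', whose
    value at a is (n + 1) g(a). Hence the factorial, and hence the induction over arbitrary
    g.\<close>
  have "pderiv (l ^ Suc n * g) = l ^ n * (smult (of_nat (Suc n)) g + l * pderiv g)"
    by (subst pderiv_mult, subst pderiv_power_Suc) (simp add: ring_distribs mult_ac del: of_nat_Suc)
  then have "(pderiv ^^ Suc n) (l ^ Suc n * g) =
      (pderiv ^^ n) (l ^ n * (smult (of_nat (Suc n)) g + l * pderiv g))"
    by (simp only: funpow_Suc_right o_apply)
  then show ?case
    using Suc.IH[folded l_def] by (simp only: flip: l_def) (simp add: algebra_simps)
qed simp

lemma legendre_poly_at_1 [simp]: "poly (legendre_poly n) 1 = 1"
proof -
  have "[:-1, 0, 1:] = [:-1, 1:] * [:1, 1::real:]" by simp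
  then have "[:-1, 0, 1::real:] ^ n = [:-1, 1:] ^ n * [:1, 1:] ^ n" by (metis power_mult_distrib)
  then show ?thesis
    by (simp add: legendre_poly_def poly_pderiv_funpow_linear_power[of n 1, simplified])
qed

lemma legendre_poly_at_minus_1 [simp]: "poly (legendre_poly n) (-1) = (-1) ^ n"
proof -
  have "[:-1, 0, 1:] = [:1, 1:] * [:-1, 1::real:]" by simp
  then have "[:-1, 0, 1::real:] ^ n = [:1, 1:] ^ n * [:-1, 1:] ^ n" by (metis power_mult_distrib)
  then have "poly (legendre_poly n) (-1) = (-2) ^ n / 2 ^ n"
    by (simp add: legendre_poly_def poly_pderiv_funpow_linear_power[of n "-1", simplified])
  then show ?thesis by (simp flip: power_divide)
qed

lemma pderiv_funpow_smult: "(pderiv ^^ n) (smult c p) = smult c ((pderiv ^^ n) p)"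
  by (induction n) (auto simp: pderiv_smult)

lemma pderiv_funpow_add: "(pderiv ^^ n) (p + q) = (pderiv ^^ n) p + (pderiv ^^ n) q"
  by (induction n) (auto simp: pderiv_add)

text \<open>Two of the n + 3 derivatives on the left are carried out on w^(n+2), where w = x^2 - 1.
  Writing x^2 = w + 1 leaves a combination of w^(n+1) and w^n. The other n + 1 derivatives turn
  these into the Legendre polynomial of degree n + 1 and the derivative of the one of degree
  n.\<close>

lemma pderiv_legendre_poly_diff:
  "pderiv (legendre_poly (n + 2)) - pderiv (legendre_poly n) =
     smult (2 * real n + 3) (legendre_poly (n + 1))"
proof -
  let ?w = "[:-1, 0, 1::real:]"
  define y :: "real poly" where "y = [:0, 1:]"
  define w where "w = ?w"
  have [simp]: "pderiv y = 1" by (simp add: y_def pderiv_pCons)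
  have dw: "pderiv w = smult 2 y" by (simp add: y_def w_def pderiv_pCons)
  have 1: "pderiv (w ^ Suc k) = smult (2 * (real k + 1)) (y * w ^ k)" for k
    by (simp add: pderiv_power_Suc dw mult_ac del: power_Suc of_nat_Suc) (simp add: algebra_simps)
  have x2: "y * y = w + 1"
    by (simp add: one_pCons w_def y_def)
  have 2: "pderiv (pderiv (w ^ Suc (Suc n))) =
      smult (2 * (real n + 2)) (smult (2 * real n + 3) (w ^ Suc n) + smult (2 * (real n + 1)) (w ^ n))"
    (is "?l = smult _ ?r")
  proof -
    have "?l = smult (2 * (real n + 2)) (w ^ Suc n + smult (2 * (real n + 1)) ((y * y) * w ^ n))"
      by (subst 1, subst pderiv_smult, subst pderiv_mult, subst 1)
         (simp add: mult.assoc mult.left_commute add_ac del: power_Suc)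
    also have "w ^ Suc n + smult (2 * (real n + 1)) ((y * y) * w ^ n) = ?r"
    proof -
      have "2 * real n + 3 = 1 + 2 * (real n + 1)" by simp
      then show ?thesis
        unfolding x2 by (simp only: smult_add_left smult_add_right distrib_right power_Suc) simp
    qed
    finally show ?thesis .
  qed
  have "pderiv (legendre_poly (n + 2)) =
    smult (1 / (2 ^ (n + 2) * fact (n + 2))) ((pderiv ^^ (n + 1)) (pderiv (pderiv (w ^ Suc (Suc n)))))"
    unfolding legendre_poly_def pderiv_smult w_def
    by (simp add: funpow_swap1)
  also have "\<dots> = smult (2 * real n + 3) (legendre_poly (n + 1)) +
      smult (1 / (2 ^ n * fact n)) ((pderiv ^^ (n + 1)) (w ^ n))"
  proof -
    have fact: "fact (n + 2) = (real n + 2) * fact (n + 1)" "fact (n + 1) = (real n + 1) * fact n"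
      by (simp_all add: algebra_simps)
    have "1 / (2 ^ (n + 2) * fact (n + 2)) * (2 * (real n + 2)) = 1 / (2 ^ (n + 1) * fact (n + 1) :: real)"
      unfolding fact(1) by (simp add: divide_simps del: fact_Suc)
    moreover have "1 / (2 ^ (n + 1) * fact (n + 1)) * (2 * (real n + 1)) = 1 / (2 ^ n * fact n :: real)"
      unfolding fact(2) by (simp add: divide_simps del: fact_Suc)
    ultimately show ?thesis
      unfolding 2 legendre_poly_def w_def[symmetric] pderiv_funpow_smult pderiv_funpow_add smult_add_right
        smult_smult
      by (simp only: mult.commute[of "2 * real n + 3"] Suc_eq_plus1 flip: mult.assoc)
  qed
  also have "smult (1 / (2 ^ n * fact n)) ((pderiv ^^ (n + 1)) (w ^ n)) = pderiv (legendre_poly n)"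
    by (simp add: legendre_poly_def pderiv_smult w_def)
  finally show ?thesis by simp
qed

text \<open>Integration by parts against a Lipschitz function, without differentiating it: \<open>f\<close> is replaced by
  its averages over \<open>[t, t + h]\<close>, whose derivatives are difference quotients of \<open>f\<close>.\<close>

lemma norm_integral_derivative_scaleR_lipschitz:
  fixes f :: "real \<Rightarrow> 'a::euclidean_space"
  assumes "a \<le> b"
    and lip: "\<And>s t. s \<in> {a..b} \<Longrightarrow> t \<in> {a..b} \<Longrightarrow> norm (f s - f t) \<le> L * \<bar>s - t\<bar>"
    and g: "\<And>t. t \<in> {a..b} \<Longrightarrow> (g has_real_derivative g' t) (at t within {a..b})"
    and g': "continuous_on {a..b} g'"
    and "g a = 0" "g b = 0"
  shows "norm (integral {a..b} (\<lambda>t. g' t *\<^sub>R f t)) \<le> L * integral {a..b} (\<lambda>t. \<bar>g t\<bar>)"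
proof (cases "a = b")
  case False
  with assms(1) have "a < b" by simp
  have "0 \<le> L * \<bar>a - b\<bar>" using order_trans[OF norm_ge_zero lip[of a b]] \<open>a < b\<close> by simp
  then have "L \<ge> 0" using \<open>a < b\<close> by (simp add: zero_le_mult_iff)
  \<comment> \<open>The averages over [t, t + h] leave the interval at its right end, so f is
    continued by constants, which preserves the Lipschitz constant.\<close>
  define F where "F t = f (max a (min b t))" for t
  have F_eq: "F t = f t" if "t \<in> {a..b}" for t using that by (simp add: F_def)
  have F_lip: "norm (F s - F t) \<le> L * \<bar>s - t\<bar>" for s t
  proof -
    have "norm (F s - F t) \<le> L * \<bar>max a (min b s) - max a (min b t)\<bar>"
      unfolding F_def using \<open>a < b\<close> by (intro lip) auto
    also have "\<dots> \<le> L * \<bar>s - t\<bar>"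
      using \<open>L \<ge> 0\<close> \<open>a < b\<close> by (intro mult_left_mono) auto
    finally show ?thesis .
  qed
  have F_cont: "continuous_on S F" for S
  proof (rule continuous_on_subset[OF _ subset_UNIV], rule lipschitz_on_continuous_on)
    show "L-lipschitz_on UNIV F"
      using \<open>L \<ge> 0\<close> F_lip by (intro lipschitz_onI) (auto simp: dist_norm)
  qed
  \<comment> \<open>The margins give two-sided derivatives on {a..b+1}, which contains t + h for h <
    1.\<close>
  obtain \<Phi> where \<Phi>: "\<And>t. t \<in> {a-1..b+2} \<Longrightarrow> (\<Phi> has_vector_derivative F t) (at t within {a-1..b+2})"
    using antiderivative_continuous[OF F_cont] by blast
  have \<Phi>_at: "(\<Phi> has_vector_derivative F t) (at t)" if "t \<in> {a..b+1}" for t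
    using \<Phi>[of t] that at_within_Icc_at[of "a-1" t "b+2"] by auto
  have g_cont: "continuous_on {a..b} g" by (rule DERIV_continuous_on[OF g])
  have f_cont: "continuous_on {a..b} f" by (rule continuous_on_eq[OF F_cont]) (simp add: F_eq)
  \<comment> \<open>Replacing f by its averages costs at most L h pointwise. This error meets the
    integral of the modulus of g', which is independent of h, so it disappears as h tends to
    0.\<close>
  have key: "norm (integral {a..b} (\<lambda>t. g' t *\<^sub>R f t))
      \<le> L * integral {a..b} (\<lambda>t. \<bar>g t\<bar>) + (L * h) * integral {a..b} (\<lambda>t. \<bar>g' t\<bar>)"
    if h: "0 < h" "h < 1" for h
  proof -
    define fh where "fh t = (1/h) *\<^sub>R (\<Phi> (t + h) - \<Phi> t)" for t
    define fh' where "fh' t = (1/h) *\<^sub>R (F (t + h) - F t)" for t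
    have fh: "(fh has_vector_derivative fh' t) (at t)" if "t \<in> {a..b}" for t
    proof -
      have "(\<Phi> \<circ> (\<lambda>t. t + h) has_vector_derivative 1 *\<^sub>R F (t + h)) (at t)"
        using that h by (intro vector_diff_chain_at \<Phi>_at) (auto intro!: derivative_eq_intros)
      then have "((\<lambda>t. \<Phi> (t + h)) has_vector_derivative F (t + h)) (at t)"
        by (simp add: o_def)
      then show ?thesis
        unfolding fh_def fh'_def using that h
        by (intro bounded_linear.has_vector_derivative[OF bounded_linear_scaleR_right]
            has_vector_derivative_diff \<Phi>_at) auto
    qed
    have fh'_cont: "continuous_on {a..b} fh'"
      unfolding fh'_def by (intro continuous_intros continuous_on_compose2[OF F_cont]) auto
    have fh_cont: "continuous_on {a..b} fh"
      by (rule continuous_on_vector_derivative[OF has_vector_derivative_at_within[OF fh]])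
    have fh'_le: "norm (fh' t) \<le> L" for t
      using F_lip[of "t + h" t] h by (simp add: fh'_def divide_le_eq)
    have diff_le: "norm (f t - fh t) \<le> L * h" if t: "t \<in> {a..b}" for t
    proof -
      have "((\<lambda>s. F s - F t) has_integral (\<Phi> (t + h) - \<Phi> t - h *\<^sub>R F t)) {t..t + h}"
      proof (rule has_integral_diff)
        show "(F has_integral (\<Phi> (t + h) - \<Phi> t)) {t..t + h}"
          using h t by (intro fundamental_theorem_of_calculus has_vector_derivative_at_within[OF \<Phi>_at]) auto
        show "((\<lambda>s. F t) has_integral h *\<^sub>R F t) {t..t + h}"
          using has_integral_const_real[of "F t" t "t + h"] h by simp
      qed
      then have "norm (\<Phi> (t + h) - \<Phi> t - h *\<^sub>R F t) \<le> (L * h) * measure lborel {t..t + h}"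
      proof (rule has_integral_bound_real[rotated 2])
        show "norm (F s - F t) \<le> L * h" if "s \<in> {t..t + h} - {}" for s
          using F_lip[of s t] that mult_left_mono[of "\<bar>s - t\<bar>" h L] \<open>L \<ge> 0\<close> by auto
      qed (use \<open>L \<ge> 0\<close> h in auto)
      then have "norm (h *\<^sub>R (fh t - f t)) \<le> (L * h) * h"
        using h t by (simp add: fh_def F_eq algebra_simps)
      then show ?thesis using h by (simp add: norm_minus_commute)
    qed
    have "((\<lambda>t. g t *\<^sub>R fh' t + g' t *\<^sub>R fh t) has_integral (g b *\<^sub>R fh b - g a *\<^sub>R fh a)) {a..b}"
      using assms(1) g fh
      by (intro fundamental_theorem_of_calculus has_vector_derivative_scaleR)
         (auto intro: has_vector_derivative_at_within)
    then have "integral {a..b} (\<lambda>t. g t *\<^sub>R fh' t + g' t *\<^sub>R fh t) = 0"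
      using assms(5,6) by (simp add: integral_unique)
    moreover have int: "(\<lambda>t. g t *\<^sub>R fh' t) integrable_on {a..b}" "(\<lambda>t. g' t *\<^sub>R fh t) integrable_on {a..b}"
      "(\<lambda>t. g' t *\<^sub>R (f t - fh t)) integrable_on {a..b}"
      "(\<lambda>t. L * \<bar>g t\<bar>) integrable_on {a..b}" "(\<lambda>t. L * h * \<bar>g' t\<bar>) integrable_on {a..b}"
      by (intro integrable_continuous_real continuous_intros g_cont g' fh_cont fh'_cont f_cont)+
    ultimately have *: "integral {a..b} (\<lambda>t. g' t *\<^sub>R fh t) = - integral {a..b} (\<lambda>t. g t *\<^sub>R fh' t)"
      by (simp add: integral_add eq_neg_iff_add_eq_0 add.commute)
    have "integral {a..b} (\<lambda>t. g' t *\<^sub>R f t)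
        = integral {a..b} (\<lambda>t. g' t *\<^sub>R fh t + g' t *\<^sub>R (f t - fh t))"
      by (simp add: algebra_simps)
    also have "\<dots> = - integral {a..b} (\<lambda>t. g t *\<^sub>R fh' t) + integral {a..b} (\<lambda>t. g' t *\<^sub>R (f t - fh t))"
      using int by (simp add: integral_add *)
    also have "norm \<dots> \<le> norm (integral {a..b} (\<lambda>t. g t *\<^sub>R fh' t)) + norm (integral {a..b} (\<lambda>t. g' t *\<^sub>R (f t - fh t)))"
      by (rule order_trans[OF norm_triangle_ineq]) simp
    also have "norm (integral {a..b} (\<lambda>t. g t *\<^sub>R fh' t)) \<le> integral {a..b} (\<lambda>t. L * \<bar>g t\<bar>)"
      using fh'_le
      by (intro integral_norm_bound_integral int) (auto simp: mult.commute[of L] intro: mult_left_mono)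
    also have "norm (integral {a..b} (\<lambda>t. g' t *\<^sub>R (f t - fh t))) \<le> integral {a..b} (\<lambda>t. (L * h) * \<bar>g' t\<bar>)"
      using diff_le
      by (intro integral_norm_bound_integral int) (auto simp: mult.commute[of "L * h"] intro: mult_left_mono)
    finally show ?thesis by simp
  qed
  have "((\<lambda>h. L * integral {a..b} (\<lambda>t. \<bar>g t\<bar>) + (L * h) * integral {a..b} (\<lambda>t. \<bar>g' t\<bar>))
      \<longlongrightarrow> L * integral {a..b} (\<lambda>t. \<bar>g t\<bar>) + (L * 0) * integral {a..b} (\<lambda>t. \<bar>g' t\<bar>)) (at_right 0)"
    by (intro tendsto_intros)
  moreover have "\<forall>\<^sub>F h in at_right (0::real). norm (integral {a..b} (\<lambda>t. g' t *\<^sub>R f t))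
      \<le> L * integral {a..b} (\<lambda>t. \<bar>g t\<bar>) + (L * h) * integral {a..b} (\<lambda>t. \<bar>g' t\<bar>)"
    using key by (auto simp: eventually_at_right_field intro!: exI[of _ 1])
  ultimately show ?thesis by (auto intro: tendsto_lowerbound)
qed (use assms in auto)

text \<open>By the identity above this is the primitive of P_(n+1)(t / x) that vanishes at both ends
  of {-x..x}, because P_(n+2) and P_n agree at 1 and at -1. So integration by parts leaves no
  boundary terms.\<close>

definition legendre_primitive :: "nat \<Rightarrow> real \<Rightarrow> real \<Rightarrow> real" where
  "legendre_primitive n x t =
     x / (2 * real n + 3) * (poly (legendre_poly (n + 2)) (t / x) - poly (legendre_poly n) (t / x))"

lemma legendre_primitive_ends:
  assumes "x > 0"
  shows "legendre_primitive n x x = 0" "legendre_primitive n x (- x) = 0"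
  using assms by (simp_all add: legendre_primitive_def)

lemma legendre_primitive_has_derivative:
  assumes "x > 0"
  shows "(legendre_primitive n x has_real_derivative poly (legendre_poly (n + 1)) (t / x)) (at t within S)"
proof -
  have "poly (pderiv (legendre_poly (n + 2)) - pderiv (legendre_poly n)) (t / x)
      = (2 * real n + 3) * poly (legendre_poly (n + 1)) (t / x)"
    by (subst pderiv_legendre_poly_diff) simp
  then have *: "poly (pderiv (legendre_poly (n + 2))) (t / x) - poly (pderiv (legendre_poly n)) (t / x)
      = (2 * real n + 3) * poly (legendre_poly (n + 1)) (t / x)"
    by simp
  have "((\<lambda>t. poly q (t / x)) has_real_derivative (poly (pderiv q) (t / x) * (1 / x))) (at t within S)" for q
    using assms by (intro DERIV_chain2[OF poly_DERIV]) (auto intro!: derivative_eq_intros)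
  then have "(legendre_primitive n x has_real_derivative
      x / (2 * real n + 3) * (poly (pderiv (legendre_poly (n + 2))) (t / x) * (1 / x)
         - poly (pderiv (legendre_poly n)) (t / x) * (1 / x))) (at t within S)"
    unfolding legendre_primitive_def by (intro DERIV_cmult DERIV_diff)
  also have "x / (2 * real n + 3) * (poly (pderiv (legendre_poly (n + 2))) (t / x) * (1 / x)
         - poly (pderiv (legendre_poly n)) (t / x) * (1 / x)) = poly (legendre_poly (n + 1)) (t / x)"
    using assms * by (simp flip: diff_divide_distrib)
  finally show ?thesis .
qed

lemma continuous_on_poly_divide [continuous_intros]:
  "continuous_on S (\<lambda>t. poly q (t / x :: real))"
  unfolding divide_inverse by (intro continuous_intros)

text \<open>The coefficient without its normalization, so that an integration by parts produces just
  the factor x / (2 n + 3). The codomain is general because real polynomials (for orthogonality) and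
  complex kernels are both inserted.\<close>

definition legendre_moment :: "real \<Rightarrow> nat \<Rightarrow> (real \<Rightarrow> 'a::euclidean_space) \<Rightarrow> 'a" where
  "legendre_moment x n f = integral {-x..x} (\<lambda>t. poly (legendre_poly n) (t / x) *\<^sub>R f t)"

lemma legendre_moment_Suc:
  assumes x: "x > 0"
    and f: "\<And>t. t \<in> {-x..x} \<Longrightarrow> (f has_vector_derivative f' t) (at t within {-x..x})"
    and f': "continuous_on {-x..x} f'"
  shows "legendre_moment x (n + 1) f =
    (x / (2 * real n + 3)) *\<^sub>R (legendre_moment x n f' - legendre_moment x (n + 2) f')"
proof -
  have fc: "continuous_on {-x..x} f" by (rule continuous_on_vector_derivative[OF f])
  let ?g = "legendre_primitive n x"
  have gc: "continuous_on {-x..x} ?g"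
    by (rule DERIV_continuous_on[OF legendre_primitive_has_derivative[OF x]])
  have "((\<lambda>t. ?g t *\<^sub>R f' t + poly (legendre_poly (n + 1)) (t / x) *\<^sub>R f t)
      has_integral (?g x *\<^sub>R f x - ?g (-x) *\<^sub>R f (-x))) {-x..x}"
    using x f legendre_primitive_has_derivative[OF x]
    by (intro fundamental_theorem_of_calculus has_vector_derivative_scaleR) auto
  then have "integral {-x..x} (\<lambda>t. ?g t *\<^sub>R f' t + poly (legendre_poly (n + 1)) (t / x) *\<^sub>R f t) = 0"
    using x by (simp add: integral_unique legendre_primitive_ends)
  moreover have "(\<lambda>t. ?g t *\<^sub>R f' t) integrable_on {-x..x}"
    "(\<lambda>t. poly (legendre_poly m) (t / x) *\<^sub>R f t) integrable_on {-x..x}" 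
    "(\<lambda>t. poly (legendre_poly m) (t / x) *\<^sub>R f' t) integrable_on {-x..x}" for m
    by (intro integrable_continuous_real continuous_intros gc f' fc)+
  note int = this
  ultimately have "legendre_moment x (n + 1) f = - integral {-x..x} (\<lambda>t. ?g t *\<^sub>R f' t)"
    unfolding legendre_moment_def by (simp add: integral_add eq_neg_iff_add_eq_0 add.commute)
  also have "(\<lambda>t. ?g t *\<^sub>R f' t) = (\<lambda>t. (x / (2 * real n + 3)) *\<^sub>R
      (poly (legendre_poly (n + 2)) (t / x) *\<^sub>R f' t - poly (legendre_poly n) (t / x) *\<^sub>R f' t))"
    by (simp add: legendre_primitive_def scaleR_left_diff_distrib right_diff_distrib scaleR_right_diff_distrib)
  also have "- integral {-x..x} \<dots> = (x / (2 * real n + 3)) *\<^sub>R (legendre_moment x n f' - legendre_moment x (n + 2) f')"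
    unfolding legendre_moment_def integral_cmul
    by (simp only: integral_diff int flip: scaleR_minus_right) simp
  finally show ?thesis .
qed

text \<open>An integration by parts lowers the degree of \<open>q\<close> by one and the index by at
  most one, so the strict inequality between them survives until the derivative is 0.\<close>

lemma legendre_moment_poly_eq_0:
  "degree q < n \<Longrightarrow> legendre_moment 1 n (poly q) = 0"
proof (induction "degree q" arbitrary: q n rule: less_induct)
  case less
  then obtain m where m: "n = m + 1" by (cases n) auto
  have eq: "legendre_moment 1 n (poly q) = (1 / (2 * real m + 3)) *\<^sub>R
      (legendre_moment 1 m (poly (pderiv q)) - legendre_moment 1 (m + 2) (poly (pderiv q)))"
    unfolding m
    by (rule legendre_moment_Suc) (auto intro!: continuous_intros
        has_field_derivative_at_within poly_DERIV simp flip: has_real_derivative_iff_has_vector_derivative)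
  show ?case
  proof (cases "degree q = 0")
    case True
    then have "pderiv q = 0" by (simp add: pderiv_eq_0_iff)
    then show ?thesis unfolding eq by (simp add: legendre_moment_def)
  next
    case False
    have "legendre_moment 1 k (poly (pderiv q)) = 0" if "degree q \<le> k" for k
      using False that by (intro less.hyps) (auto simp: degree_pderiv)
    then show ?thesis unfolding eq using less.prems m by simp
  qed
qed

lemma degree_pderiv_funpow: "degree ((pderiv ^^ k) (q :: real poly)) = degree q - k"
  by (induction k) (auto simp: degree_pderiv)

lemma degree_legendre_poly: "degree (legendre_poly n) = n"
  by (simp add: legendre_poly_def degree_pderiv_funpow degree_power_eq)

text \<open>Multiply (2 n + 1) P_n = P_(n+1)' - P_(n-1)' by P_n and integrate. The second term
  vanishes by orthogonality. In the first an integration by parts leaves the boundary term 1 -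
  (-1)^(2n+1) = 2, the remaining integral being zero by orthogonality again.\<close>

lemma integral_legendre_poly_square:
  "integral {-1..1} (\<lambda>t. (poly (legendre_poly n) t)\<^sup>2) = 2 / (2 * real n + 1)"
proof (cases n)
  case 0
  then show ?thesis by (simp add: legendre_poly_def)
next
  case (Suc m)
  let ?P = "\<lambda>k. poly (legendre_poly k)" and ?P' = "\<lambda>k. poly (pderiv (legendre_poly k))"
  have cont: "(\<lambda>t. ?P j t * ?P k t) integrable_on {-1..1}" "(\<lambda>t. ?P j t * ?P' k t) integrable_on {-1..1}" for j k
    by (intro integrable_continuous_real continuous_intros)+
  have orth: "integral {-1..1} (\<lambda>t. ?P j t * ?P' k t) = 0" if "k \<le> j" for j k
  proof (cases "k = 0")
    case True
    then have "pderiv (legendre_poly k) = 0" by (simp add: pderiv_eq_0_iff degree_legendre_poly)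
    then show ?thesis by simp
  next
    case False
    then show ?thesis
      using legendre_moment_poly_eq_0[of "pderiv (legendre_poly k)" j] that
      by (simp add: legendre_moment_def degree_pderiv degree_legendre_poly)
  qed
  have "((\<lambda>t. ?P n t * ?P' (n + 1) t + ?P' n t * ?P (n + 1) t) has_integral
      (?P n 1 * ?P (n + 1) 1 - ?P n (-1) * ?P (n + 1) (-1))) {-1..1}"
    by (intro fundamental_theorem_of_calculus)
       (auto intro!: derivative_eq_intros has_field_derivative_at_within[OF poly_DERIV]
          simp: mult.commute simp flip: has_real_derivative_iff_has_vector_derivative)
  then have "integral {-1..1} (\<lambda>t. ?P n t * ?P' (n + 1) t + ?P (n + 1) t * ?P' n t) = 2"
    by (subst (asm) mult.commute[of "?P' n _"]) (simp add: integral_unique flip: power_add mult_2)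
  then have 2: "integral {-1..1} (\<lambda>t. ?P n t * ?P' (n + 1) t) = 2"
    using cont orth[of n "n + 1"] by (simp add: integral_add)
  have "(2 * real n + 1) * (?P n t)\<^sup>2 = ?P n t * ?P' (n + 1) t - ?P n t * ?P' m t" for t
    using arg_cong[OF pderiv_legendre_poly_diff[of m], of "\<lambda>q. poly q t * ?P n t"] Suc
    by (simp add: power2_eq_square algebra_simps)
  then have "integral {-1..1} (\<lambda>t. (2 * real n + 1) * (?P n t)\<^sup>2) =
      integral {-1..1} (\<lambda>t. ?P n t * ?P' (n + 1) t - ?P n t * ?P' m t)"
    by presburger
  also have "\<dots> = 2"
    using cont orth[of m n] 2 Suc by (simp add: integral_diff)
  finally show ?thesis by (simp only: integral_mult_right) (simp add: field_simps)
qed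

text \<open>This is Cauchy-Schwarz, carried out through the pointwise inequality of arithmetic and
  geometric means. The weight l = sqrt (2 n + 1) balances the two resulting integrals: each equals x
  / l.\<close>

lemma integral_abs_legendre_poly_le:
  assumes "x > 0"
  shows "integral {-x..x} (\<lambda>t. \<bar>poly (legendre_poly n) (t / x)\<bar>) \<le> 2 * x / sqrt (2 * real n + 1)"
proof -
  define l where "l = sqrt (2 * real n + 1)"
  have l: "l > 0" "l\<^sup>2 = 2 * real n + 1" by (simp_all add: l_def)
  have sq: "((\<lambda>t. (poly (legendre_poly n) t)\<^sup>2) has_integral 2 / l\<^sup>2) {-1..1}"
    unfolding l(2) integral_legendre_poly_square[symmetric]
    by (intro integrable_integral integrable_continuous_real continuous_intros)
  have sq': "((\<lambda>t. (poly (legendre_poly n) (t / x))\<^sup>2) has_integral 2 * x / l\<^sup>2) {-x..x}"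
    using has_integral_affinity'[of _ _ "-1::real" 1 "1 / x" 0, unfolded cbox_interval, OF sq] assms
    by (simp add: field_simps)
  have "integral {-x..x} (\<lambda>t. \<bar>poly (legendre_poly n) (t / x)\<bar>)
      \<le> integral {-x..x} (\<lambda>t. l / 2 * (poly (legendre_poly n) (t / x))\<^sup>2 + 1 / (2 * l))"
  proof (rule integral_le)
    show "\<bar>y\<bar> \<le> l / 2 * y\<^sup>2 + 1 / (2 * l)" for y
      using l zero_le_power2[of "l * \<bar>y\<bar> - 1"]
      by (simp add: field_simps power2_eq_square)
  qed (auto intro!: integrable_continuous_real continuous_intros)
  also have "integral {-x..x} (\<lambda>t. l / 2 * (poly (legendre_poly n) (t / x))\<^sup>2 + 1 / (2 * l)) = 2 * x / l"
  proof -
    have "((\<lambda>t. l / 2 * (poly (legendre_poly n) (t / x))\<^sup>2 + 1 / (2 * l)) has_integral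
     l / 2 * (2 * x / l\<^sup>2) + (2 * x) * (1 / (2 * l))) {-x..x}"
      using has_integral_const_real[of "1 / (2 * l)" "-x" x] assms
      by (intro has_integral_add has_integral_mult_right sq') auto
    then show ?thesis
      using l by (subst integral_unique) (auto simp: power2_eq_square field_simps)
  qed
  finally show ?thesis by (simp add: l_def)
qed

subsection \<open>Fourier uniqueness and variation of constants\<close>

text \<open>By Stone--Weierstrass: the real functions that are finite combinations of the \<open>cis (\<omega> * t)\<close> form
  an algebra that separates points.\<close>

lemma trig_moments_determine:
  fixes f :: "real \<Rightarrow> complex"
  assumes f: "continuous_on {a..b} f" and "a < b"
    and zero: "\<And>\<omega>. integral {a..b} (\<lambda>t. f t * cis (\<omega> * t)) = 0"
    and t: "t \<in> {a..b}"
  shows "f t = 0"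
proof -
  \<comment> \<open>Trigonometric sums are coded as lists of coefficients and frequencies, so that
    sums and products of them are lists again. \<open>P\<close> selects the real-valued ones, to
    which the real Stone-Weierstrass theorem applies.\<close>
  define E where "E xs t = (\<Sum>(c, \<omega>)\<leftarrow>xs. c * cis (\<omega> * t))" for xs :: "(complex \<times> real) list" and t :: real
  define P where "P g \<longleftrightarrow> (\<exists>xs. \<forall>t. complex_of_real (g t) = E xs t)" for g :: "real \<Rightarrow> real"
  have E_Cons: "E ((c, \<omega>) # xs) t = c * cis (\<omega> * t) + E xs t" for c \<omega> xs t by (simp add: E_def)
  have E_Nil: "E [] t = 0" for t by (simp add: E_def)
  have E_append: "E (xs @ ys) t = E xs t + E ys t" for xs ys t by (simp add: E_def)
  have E_times1: "c * cis (\<omega> * t) * E ys t = E (map (\<lambda>(d, \<eta>). (c * d, \<omega> + \<eta>)) ys) t" for c \<omega> ys t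
    by (induction ys) (auto simp: E_Nil E_Cons distrib_left distrib_right simp flip: cis_mult)
  have E_times: "\<exists>zs. \<forall>t. E xs t * E ys t = E zs t" for xs ys
  proof (induction xs)
    case (Cons x xs)
    then obtain zs where "\<And>t. E xs t * E ys t = E zs t" by blast
    then have "E (x # xs) t * E ys t = E (map (\<lambda>(d, \<eta>). (fst x * d, snd x + \<eta>)) ys @ zs) t" for t
      by (cases x) (simp add: E_Cons E_append distrib_right E_times1)
    then show ?case by blast
  qed (auto intro: exI[of _ "[]"] simp: E_Nil)
  have E_int: "integral {a..b} (\<lambda>t. f t * E xs t) = 0 \<and> (\<lambda>t. f t * E xs t) integrable_on {a..b}" for xs
  proof (induction xs)
    case (Cons x xs)
    obtain c \<omega> where x: "x = (c, \<omega>)" by (cases x)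
    have "(\<lambda>t. c * (f t * cis (\<omega> * t))) integrable_on {a..b}"
      by (intro integrable_continuous_real continuous_intros f)
    with Cons show ?case
      by (simp add: x E_Cons distrib_left mult.left_commute[of _ c] integral_add integrable_add zero)
  qed (simp add: E_Nil integrable_0)
  have dense: "\<exists>g. P g \<and> (\<forall>t\<in>{a..b}. \<bar>\<phi> t - g t\<bar> < e)" if "continuous_on {a..b} \<phi>" "e > 0" for \<phi> e
  proof (rule Stone_Weierstrass_HOL[OF _ _ _ _ _ _ that])
    show "P (\<lambda>x. c)" for c
      by (auto simp: P_def E_Cons E_Nil intro!: exI[of _ "[(of_real c, 0)]"])
    show "continuous_on {a..b} g" if "P g" for g
    proof -
      obtain xs where "\<And>t. complex_of_real (g t) = E xs t" using \<open>P g\<close> by (auto simp: P_def)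
      then have "g = (\<lambda>t. Re (E xs t))" by (metis Re_complex_of_real)
      moreover have "continuous_on {a..b} (E xs)"
        by (induction xs) (auto simp: E_def intro!: continuous_intros)
      ultimately show ?thesis by (auto intro!: continuous_intros)
    qed
    show "P (\<lambda>x. f x + g x)" if "P f \<and> P g" for f g
      using that unfolding P_def by (metis E_append of_real_add)
    show "P (\<lambda>x. f x * g x)" if "P f \<and> P g" for f g
      using that E_times unfolding P_def by (metis of_real_mult)
    show "\<exists>f. P f \<and> f s \<noteq> f t" if "s \<in> {a..b} \<and> t \<in> {a..b} \<and> s \<noteq> t" for s t
    proof -
      \<comment> \<open>The frequency is so small that both arguments stay in [-1, 1], where the
        sine is injective.\<close>
      define \<omega> where "\<omega> = 1 / (1 + \<bar>s\<bar> + \<bar>t\<bar>)"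
      have "\<omega> > 0" by (auto simp: \<omega>_def)
      have "P (\<lambda>t. sin (\<omega> * t))"
        unfolding P_def
        by (rule exI[of _ "[(- \<i> / 2, \<omega>), (\<i> / 2, - \<omega>)]"])
           (auto simp: E_Cons E_Nil complex_eq_iff)
      moreover have "sin (\<omega> * s) \<noteq> sin (\<omega> * t)"
      proof
        have le: "\<bar>\<omega> * r\<bar> \<le> pi / 2" if "r = s \<or> r = t" for r
        proof -
          have "\<bar>\<omega> * r\<bar> \<le> 1" using that by (auto simp: \<omega>_def abs_mult field_simps)
          also have "1 \<le> pi / 2" using pi_ge_two by simp
          finally show ?thesis .
        qed
        assume "sin (\<omega> * s) = sin (\<omega> * t)"
        then have "\<omega> * s = \<omega> * t"
          using sin_inj_pi[of "\<omega> * s" "\<omega> * t"] le[of s] le[of t] by (auto simp: abs_le_iff)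
        then show False using that \<open>\<omega> > 0\<close> by simp
      qed
      ultimately show ?thesis by blast
    qed
  qed simp
  have ortho: "integral {a..b} (\<lambda>t. \<phi> t *\<^sub>R f t) = 0" if \<phi>: "continuous_on {a..b} \<phi>" for \<phi>
  proof (rule ccontr)
    let ?I = "integral {a..b} (\<lambda>t. \<phi> t *\<^sub>R f t)" and ?N = "integral {a..b} (\<lambda>t. norm (f t))"
    assume "?I \<noteq> 0"
    have N: "?N \<ge> 0" by (intro integral_nonneg integrable_continuous_real continuous_intros f) simp
    define e where "e = norm ?I / (?N + 1)"
    have "e > 0" using N \<open>?I \<noteq> 0\<close> by (simp add: e_def)
    then obtain g xs where g: "\<And>t. t \<in> {a..b} \<Longrightarrow> \<bar>\<phi> t - g t\<bar> < e" "\<And>t. complex_of_real (g t) = E xs t"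
      using dense[OF \<phi>] unfolding P_def by blast
    have gE: "(\<lambda>t. f t * E xs t) = (\<lambda>t. g t *\<^sub>R f t)" by (simp add: scaleR_conv_of_real g(2) mult.commute)
    have "?I = integral {a..b} (\<lambda>t. \<phi> t *\<^sub>R f t) - integral {a..b} (\<lambda>t. f t * E xs t)"
      using E_int by simp
    also have "\<dots> = integral {a..b} (\<lambda>t. (\<phi> t - g t) *\<^sub>R f t)"
      unfolding gE scaleR_left_diff_distrib using E_int[of xs, unfolded gE]
      by (intro integral_diff[symmetric]) (auto intro!: integrable_continuous_real continuous_intros \<phi> f)
    also have "norm \<dots> \<le> integral {a..b} (\<lambda>t. e * norm (f t))"
    proof (rule integral_norm_bound_integral)
      show "(\<lambda>t. (\<phi> t - g t) *\<^sub>R f t) integrable_on {a..b}"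
        unfolding scaleR_left_diff_distrib using E_int[of xs, unfolded gE]
        by (intro integrable_diff) (auto intro!: integrable_continuous_real continuous_intros \<phi> f)
      show "norm ((\<phi> t - g t) *\<^sub>R f t) \<le> e * norm (f t)" if "t \<in> {a..b}" for t
        using g(1)[OF that] by (auto intro: mult_right_mono)
    qed (intro integrable_continuous_real continuous_intros f)
    also have "\<dots> = e * ?N" by simp
    also have "\<dots> < e * (?N + 1)" using \<open>e > 0\<close> by simp
    also have "\<dots> = norm ?I" using N by (simp add: e_def)
    finally show False by simp
  qed
  have int: "(\<lambda>t. \<phi> t *\<^sub>R f t) integrable_on {a..b}" if "continuous_on {a..b} \<phi>" for \<phi>
    by (intro integrable_continuous_real continuous_intros f that)
  \<comment> \<open>Orthogonality is used with phi = L o f. Applying \<open>L\<close> to the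
    vanishing integral gives the integral of a square. \<open>L\<close> will be the real part and
    the imaginary part.\<close>
  have part: "L (f t) = 0" if L: "bounded_linear L" and sc: "\<And>r z. L (r *\<^sub>R z) = r * L z" for L :: "complex \<Rightarrow> real"
  proof -
    have cont: "continuous_on {a..b} (\<lambda>t. L (f t))"
      using bounded_linear.continuous_on[OF L f] .
    have "integral {a..b} (\<lambda>t. L (f t) * L (f t)) = L (integral {a..b} (\<lambda>t. L (f t) *\<^sub>R f t))"
      using integral_linear[OF int[OF cont] L] by (simp add: o_def sc)
    also have "\<dots> = 0" using ortho[OF cont] L by (simp add: linear_simps)
    finally show ?thesis
      using integral_eq_0_iff[of a b "\<lambda>t. L (f t) * L (f t)", OF continuous_on_mult[OF cont cont]]
        \<open>a < b\<close> t
      by simp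
  qed
  show ?thesis
    using part[of Re] part[of Im] by (simp add: bounded_linear_Re bounded_linear_Im complex_eq_iff)
qed

text \<open>The Green function \<open>sin (\<omega> r) / \<omega>\<close>, continued to \<open>\<omega> = 0\<close>; this is also half the integral of
  \<open>cos (\<omega> t)\<close> over \<open>[- r, r]\<close>.\<close>

definition sine_kernel :: "real \<Rightarrow> real \<Rightarrow> real" where
  "sine_kernel \<omega> r = (if \<omega> = 0 then r else sin (\<omega> * r) / \<omega>)"

lemma sine_kernel_0 [simp]: "sine_kernel \<omega> 0 = 0"
  by (simp add: sine_kernel_def)

lemma has_real_derivative_sine_kernel [derivative_intros]:
  "(g has_real_derivative g') (at x within S) \<Longrightarrow>
   ((\<lambda>x. sine_kernel \<omega> (g x)) has_real_derivative cos (\<omega> * g x) * g') (at x within S)"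
  unfolding sine_kernel_def
  by (cases "\<omega> = 0") (auto intro!: derivative_eq_intros)

lemma continuous_on_sine_kernel [continuous_intros]:
  fixes g :: "'a::t2_space \<Rightarrow> real"
  shows "continuous_on S g \<Longrightarrow> continuous_on S (\<lambda>x. sine_kernel \<omega> (g x))"
  by (cases "\<omega> = 0") (auto simp: sine_kernel_def intro!: continuous_intros)

lemma sine_kernel_meas [measurable]: "sine_kernel \<omega> \<in> borel_measurable borel"
  by (intro borel_measurable_continuous_onI continuous_intros)

lemma abs_sine_kernel_le: "\<bar>sine_kernel \<omega> r\<bar> \<le> \<bar>r\<bar>"
  using abs_sin_x_le_abs_x[of "\<omega> * r"] by (simp add: sine_kernel_def abs_mult divide_le_eq mult.commute)

text \<open>This turns multiplication by the Green function into integration of exponentials over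
  the interval of radius r around a. In this way the cone of dependence in the (x, t) plane appears
  on the transform side.\<close>

lemma has_integral_cis_sine_kernel:
  assumes "r \<ge> 0"
  shows "((\<lambda>t. cis (\<omega> * t)) has_integral (2 * sine_kernel \<omega> r) *\<^sub>R cis (\<omega> * a)) {a - r..a + r}"
proof (cases "\<omega> = 0")
  case True
  then show ?thesis
    using has_integral_const_real[of "1::complex" "a - r" "a + r"] assms
    by (simp add: sine_kernel_def scaleR_conv_of_real)
next
  case False
  have "((\<lambda>t. cis (\<omega> * t)) has_integral (cis (\<omega> * (a + r)) / (\<i> * \<omega>) - cis (\<omega> * (a - r)) / (\<i> * \<omega>))) {a - r..a + r}"
    using False assms
    by (intro fundamental_theorem_of_calculus)
       (auto intro!: derivative_eq_intros simp: has_vector_derivative_def scaleR_conv_of_real fun_eq_iff mult_ac)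
  also have "cis (\<omega> * (a + r)) / (\<i> * \<omega>) - cis (\<omega> * (a - r)) / (\<i> * \<omega>) = (2 * sine_kernel \<omega> r) *\<^sub>R cis (\<omega> * a)"
    using False
    by (simp add: sine_kernel_def complex_eq_iff Re_divide Im_divide power2_eq_square distrib_left right_diff_distrib
       sin_add cos_add sin_diff cos_diff field_simps)
  finally show ?thesis .
qed

lemma cos_plus_sine_kernel: "complex_of_real (cos (\<omega> * x)) + \<i> * \<omega> * sine_kernel \<omega> x = cis (\<omega> * x)"
  by (simp add: sine_kernel_def complex_eq_iff)

section \<open>Fubini's theorem for bounded functions of bounded support\<close>

lemma integrable_bounded_support:
  fixes f :: "'a::euclidean_space \<Rightarrow> 'b::{banach, second_countable_topology}"
  assumes [measurable]: "f \<in> borel_measurable borel"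
    and "bounded S" "\<And>x. norm (f x) \<le> B" "\<And>x. x \<notin> S \<Longrightarrow> f x = 0"
  shows "integrable lborel f"
proof -
  obtain a b where "S \<subseteq> cbox a b" using \<open>bounded S\<close> bounded_subset_cbox_symmetric by blast
  then show ?thesis
    using assms emeasure_lborel_cbox_finite
    by (intro integrableI_bounded_set[where A = "cbox a b" and B = B]) auto
qed

lemma Fubini_bounded_support:
  fixes f :: "real \<Rightarrow> real \<Rightarrow> 'b::{banach, second_countable_topology}"
  assumes "(\<lambda>(x, y). f x y) \<in> borel_measurable borel"
    and "\<And>x y. norm (f x y) \<le> B" "\<And>x y. \<bar>x\<bar> > R \<or> \<bar>y\<bar> > R \<Longrightarrow> f x y = 0"
  shows "(LINT x|lborel. LINT y|lborel. f x y) = (LINT y|lborel. LINT x|lborel. f x y)"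
proof -
  have "integrable (lborel \<Otimes>\<^sub>M lborel) (\<lambda>(x, y). f x y)"
    unfolding lborel_prod
  proof (rule integrable_bounded_support)
    show "bounded ({-R..R} \<times> {-R..R})" by (intro bounded_Times) auto
    show "(case z of (x, y) \<Rightarrow> f x y) = 0" if "z \<notin> {-R..R} \<times> {-R..R}" for z
      using that assms(3) by (cases z) (auto simp: abs_if)
  qed (use assms in auto)
  then show ?thesis by (rule lborel_pair.Fubini_integral[symmetric])
qed

text \<open>The bridge between the Lebesgue integral over the line, in which Fubini's theorem is
  applied, and the gauge integral of the definitions.\<close>

lemma LINT_indicator_eq_integral:
  fixes f :: "real \<Rightarrow> 'b::euclidean_space"
  assumes "integrable lborel (\<lambda>x. indicator S x *\<^sub>R f x)"
  shows "(LINT x|lborel. indicator S x *\<^sub>R f x) = integral S f" "f integrable_on S"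
  using set_borel_integral_eq_integral[of S f] assms
  by (simp_all add: set_integrable_def set_lebesgue_integral_def)

lemma borel_measurable_indicator_continuous:
  fixes f :: "real \<Rightarrow> 'b::real_normed_vector"
  assumes "continuous_on {a..b} f"
  shows "(\<lambda>x. indicator {a..b} x *\<^sub>R f x) \<in> borel_measurable borel"
  using assms by (intro borel_measurable_continuous_on_indicator) auto

text \<open>As \<open>q\<close> is only measurable, \<open>v\<close> need not be differentiable; the integration by parts that moves the
  integral from \<open>(q - \<omega>\<^sup>2) u\<close> to \<open>v\<close> is therefore done by Fubini's theorem.\<close>

lemma variation_of_constants:
  fixes u v q :: "real \<Rightarrow> complex"
  assumes "0 \<le> x"
    and u: "\<And>y. y \<in> {0..x} \<Longrightarrow> (u has_vector_derivative v y) (at y within {0..x})"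
    and v: "\<And>y. y \<in> {0..x} \<Longrightarrow> ((\<lambda>z. (q z - (of_real \<omega>)\<^sup>2) * u z) has_integral (v y - v 0)) {0..y}"
    and q [measurable]: "q \<in> borel_measurable borel" and q_bound: "\<And>y. norm (q y) \<le> M"
  shows "integral {0..x} (\<lambda>y. sine_kernel \<omega> (x - y) *\<^sub>R (q y * u y)) =
    u x - cos (\<omega> * x) *\<^sub>R u 0 - sine_kernel \<omega> x *\<^sub>R v 0"
proof -
  let ?I = "indicator {0..x} :: real \<Rightarrow> real"
  have uc: "continuous_on {0..x} u" by (rule continuous_on_vector_derivative[OF u])
  obtain U where "\<forall>z\<in>u ` {0..x}. norm z \<le> U"
    using compact_imp_bounded[OF compact_continuous_image[OF uc compact_Icc]] unfolding bounded_iff ..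
  then have U: "norm (u y) \<le> U" if "y \<in> {0..x}" for y using that by blast
  define u0 where "u0 y = ?I y *\<^sub>R u y" for y
  have u0_meas [measurable]: "u0 \<in> borel_measurable borel"
    unfolding u0_def by (rule borel_measurable_indicator_continuous[OF uc])
  have U0: "U \<ge> 0" using order_trans[OF norm_ge_zero U[of 0]] \<open>0 \<le> x\<close> by simp
  have M0: "M \<ge> 0" by (rule order_trans[OF norm_ge_zero q_bound])
  have u0_bound: "norm (u0 y) \<le> U" for y using U U0 by (auto simp: u0_def indicator_def)
  define w where "w y = (q y - (of_real \<omega>)\<^sup>2) * u0 y" for y
  have [measurable]: "w \<in> borel_measurable borel" unfolding w_def by measurable
  define W where "W = (M + \<omega>\<^sup>2) * U"
  have w_bound: "norm (w y) \<le> W" for y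
  proof -
    have "norm (q y - (of_real \<omega>)\<^sup>2) \<le> M + \<omega>\<^sup>2"
      using norm_triangle_ineq4[of "q y" "(of_real \<omega>)\<^sup>2"] q_bound[of y] by (simp add: norm_power)
    then show ?thesis
      unfolding w_def W_def norm_mult using u0_bound[of y] M0 by (intro mult_mono) auto
  qed
  have w_int: "(w has_integral (v y - v 0)) {0..y}" if "y \<in> {0..x}" for y
    using v[OF that] by (rule has_integral_eq[rotated]) (use that in \<open>auto simp: w_def u0_def\<close>)
  have sin_bound: "\<bar>sine_kernel \<omega> (x - y)\<bar> \<le> x" if "y \<in> {0..x}" for y
    using abs_sine_kernel_le[of \<omega> "x - y"] that by simp
  \<comment> \<open>The integrand on the triangle 0 <= y <= z <= x. Integrated over z it gives the
    sine kernel times \<open>w\<close>; integrated over y it gives the cosine times v z - v 0. Their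
    equality is the integration by parts.\<close>
  define A where "A y z = (if 0 \<le> y \<and> y \<le> z \<and> z \<le> x then cos (\<omega> * (x - z)) *\<^sub>R w y else 0)" for y z
  have A_meas: "(\<lambda>(y, z). A y z) \<in> borel_measurable borel"
    unfolding A_def borel_prod[symmetric] by measurable
  have A_bound: "norm (A y z) \<le> W" for y z
  proof -
    have "\<bar>cos (\<omega> * (x - z))\<bar> * norm (w y) \<le> 1 * W"
      using w_bound by (intro mult_mono) auto
    then show ?thesis using w_bound[of y] order_trans[OF norm_ge_zero w_bound] by (simp add: A_def)
  qed
  have A_z: "(LINT z|lborel. A y z) = ?I y *\<^sub>R (sine_kernel \<omega> (x - y) *\<^sub>R w y)" for y
  proof (cases "y \<in> {0..x}")
    case True
    have "((\<lambda>z. cos (\<omega> * (x - z))) has_integral (- sine_kernel \<omega> (x - x) - (- sine_kernel \<omega> (x - y)))) {y..x}"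
      using True
      by (intro fundamental_theorem_of_calculus)
         (auto intro!: derivative_eq_intros simp flip: has_real_derivative_iff_has_vector_derivative)
    then have i: "((\<lambda>z. cos (\<omega> * (x - z)) *\<^sub>R w y) has_integral sine_kernel \<omega> (x - y) *\<^sub>R w y) {y..x}"
      by (intro has_integral_scaleR_left) simp
    have eq: "A y z = indicator {y..x} z *\<^sub>R (cos (\<omega> * (x - z)) *\<^sub>R w y)" for z
      using True by (auto simp: A_def indicator_def)
    have "integrable lborel (\<lambda>z. indicator {y..x} z *\<^sub>R (cos (\<omega> * (x - z)) *\<^sub>R w y))"
    proof (rule integrable_bounded_support)
      show "norm (indicator {y..x} z *\<^sub>R (cos (\<omega> * (x - z)) *\<^sub>R w y)) \<le> W" for z
        using A_bound[of y z] eq[of z] by simp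
      show "bounded {y..x}" by simp
    qed (auto simp: indicator_def)
    from LINT_indicator_eq_integral(1)[OF this] show ?thesis
      unfolding eq integral_unique[OF i] using True by simp
  next
    case False
    then have "A y z = 0" for z by (auto simp: A_def)
    then show ?thesis using False by simp
  qed
  have A_y: "(LINT y|lborel. A y z) = ?I z *\<^sub>R (cos (\<omega> * (x - z)) *\<^sub>R (v z - v 0))" for z
  proof (cases "z \<in> {0..x}")
    case True
    have eq: "A y z = indicator {0..z} y *\<^sub>R (cos (\<omega> * (x - z)) *\<^sub>R w y)" for y
      using True by (auto simp: A_def indicator_def)
    have "integrable lborel (\<lambda>y. indicator {0..z} y *\<^sub>R (cos (\<omega> * (x - z)) *\<^sub>R w y))"
    proof (rule integrable_bounded_support)
      show "norm (indicator {0..z} y *\<^sub>R (cos (\<omega> * (x - z)) *\<^sub>R w y)) \<le> W" for y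
        using A_bound[of y z] eq[of y] by simp
      show "bounded {0..z}" by simp
    qed (auto simp: indicator_def)
    from LINT_indicator_eq_integral(1)[OF this] show ?thesis
      unfolding eq integral_unique[OF has_integral_cmul[OF w_int[OF True]]] using True by simp
  next
    case False
    then have "A y z = 0" for y by (auto simp: A_def)
    then show ?thesis using False by simp
  qed
  have Fub: "(LINT y|lborel. ?I y *\<^sub>R (sine_kernel \<omega> (x - y) *\<^sub>R w y))
      = (LINT z|lborel. ?I z *\<^sub>R (cos (\<omega> * (x - z)) *\<^sub>R (v z - v 0)))"
    unfolding A_z[symmetric] A_y[symmetric]
    by (rule Fubini_bounded_support[where B = W and R = x, OF A_meas A_bound]) (auto simp: A_def)
  have vc: "continuous_on {0..x} v"
  proof -
    have "continuous_on {0..x} (\<lambda>y. integral {0..y} w)"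
      using w_int[of x] \<open>0 \<le> x\<close> by (intro indefinite_integral_continuous_1) (auto intro: has_integral_integrable)
    then have "continuous_on {0..x} (\<lambda>y. integral {0..y} w + v 0)" by (intro continuous_intros)
    then show ?thesis
      by (rule continuous_on_eq) (simp add: integral_unique[OF w_int])
  qed
  have cont_int: "integrable lborel (\<lambda>y. ?I y *\<^sub>R g y)" if g: "continuous_on {0..x} g" for g :: "real \<Rightarrow> complex"
    using borel_integrable_compact[OF _ g] by (simp add: indicator_scaleR_eq_if)
  have sw: "integrable lborel (\<lambda>y. ?I y *\<^sub>R (sine_kernel \<omega> (x - y) *\<^sub>R w y))"
    "integrable lborel (\<lambda>y. ?I y *\<^sub>R (sine_kernel \<omega> (x - y) *\<^sub>R (q y * u0 y)))"
  proof -
    have *: "integrable lborel (\<lambda>y. ?I y *\<^sub>R (sine_kernel \<omega> (x - y) *\<^sub>R f y))"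
      if [measurable]: "f \<in> borel_measurable borel" and f: "\<And>y. norm (f y) \<le> B" for f :: "real \<Rightarrow> complex" and B
    proof (rule integrable_bounded_support)
      show "norm (?I y *\<^sub>R (sine_kernel \<omega> (x - y) *\<^sub>R f y)) \<le> x * B" for y
        using sin_bound[of y] f[of y] order_trans[OF norm_ge_zero f] \<open>0 \<le> x\<close>
        by (cases "y \<in> {0..x}") (auto intro!: mult_mono)
      show "bounded {0..x}" by simp
    qed auto
    show "integrable lborel (\<lambda>y. ?I y *\<^sub>R (sine_kernel \<omega> (x - y) *\<^sub>R w y))"
      by (rule *[OF _ w_bound]) simp
    show "integrable lborel (\<lambda>y. ?I y *\<^sub>R (sine_kernel \<omega> (x - y) *\<^sub>R (q y * u0 y)))"
    proof (rule *)
      show "norm (q y * u0 y) \<le> M * U" for y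
        unfolding norm_mult using q_bound u0_bound M0 by (intro mult_mono) auto
    qed simp
  qed
  let ?S = "\<lambda>y. sine_kernel \<omega> (x - y)"
  have qu0: "?S y *\<^sub>R (q y * u0 y) = ?S y *\<^sub>R (q y * u y)" if "y \<in> {0..x}" for y
    using that by (simp add: u0_def)
  have i1: "((\<lambda>y. ?S y *\<^sub>R (q y * u y)) has_integral integral {0..x} (\<lambda>y. ?S y *\<^sub>R (q y * u y))) {0..x}"
    by (intro integrable_integral integrable_eq[OF LINT_indicator_eq_integral(2)[OF sw(2)] qu0])
  have i2: "((\<lambda>y. ?S y *\<^sub>R u y) has_integral integral {0..x} (\<lambda>y. ?S y *\<^sub>R u y)) {0..x}"
    by (intro integrable_integral integrable_continuous_real continuous_intros uc)
  have "((\<lambda>y. ?S y *\<^sub>R (q y * u y) - \<omega>\<^sup>2 *\<^sub>R (?S y *\<^sub>R u y)) has_integral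
      integral {0..x} (\<lambda>y. ?S y *\<^sub>R (q y * u y)) - \<omega>\<^sup>2 *\<^sub>R integral {0..x} (\<lambda>y. ?S y *\<^sub>R u y)) {0..x}"
    by (intro has_integral_diff i1 has_integral_cmul i2)
  then have "((\<lambda>y. ?S y *\<^sub>R w y) has_integral
      integral {0..x} (\<lambda>y. ?S y *\<^sub>R (q y * u y)) - \<omega>\<^sup>2 *\<^sub>R integral {0..x} (\<lambda>y. ?S y *\<^sub>R u y)) {0..x}"
    by (rule has_integral_eq[rotated]) (simp add: w_def u0_def scaleR_conv_of_real algebra_simps power2_eq_square)
  then have 1: "integral {0..x} (\<lambda>y. ?S y *\<^sub>R w y) =
      integral {0..x} (\<lambda>y. ?S y *\<^sub>R (q y * u y)) - \<omega>\<^sup>2 *\<^sub>R integral {0..x} (\<lambda>y. ?S y *\<^sub>R u y)"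
    by (rule integral_unique)
  have 2: "integral {0..x} (\<lambda>y. ?S y *\<^sub>R w y) = integral {0..x} (\<lambda>z. cos (\<omega> * (x - z)) *\<^sub>R (v z - v 0))"
    using Fub LINT_indicator_eq_integral(1)[OF sw(1)]
      LINT_indicator_eq_integral(1)[OF cont_int, of "\<lambda>z. cos (\<omega> * (x - z)) *\<^sub>R (v z - v 0)"]
    by (simp add: continuous_intros vc)
  \<comment> \<open>The summand ?S z v(0) is included because its derivative turns v z into v z - v
    0, the only form in which \<open>v\<close> occurs in 2.\<close>
  have "((\<lambda>z. cos (\<omega> * (x - z)) *\<^sub>R (v z - v 0) + (\<omega>\<^sup>2 * ?S z) *\<^sub>R u z) has_integral
      (cos (\<omega> * (x - x)) *\<^sub>R u x + ?S x *\<^sub>R v 0) - (cos (\<omega> * (x - 0)) *\<^sub>R u 0 + ?S 0 *\<^sub>R v 0)) {0..x}"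
  proof (rule fundamental_theorem_of_calculus[OF \<open>0 \<le> x\<close>])
    fix y assume y: "y \<in> {0..x}"
    have c: "((\<lambda>z. cos (\<omega> * (x - z))) has_real_derivative \<omega>\<^sup>2 * ?S y) (at y within {0..x})"
      by (cases "\<omega> = 0") (auto simp: sine_kernel_def power2_eq_square intro!: derivative_eq_intros)
    have s: "(?S has_real_derivative - cos (\<omega> * (x - y))) (at y within {0..x})"
      by (auto intro!: derivative_eq_intros)
    have "((\<lambda>y. cos (\<omega> * (x - y)) *\<^sub>R u y + ?S y *\<^sub>R v 0) has_vector_derivative
       (cos (\<omega> * (x - y)) *\<^sub>R v y + (\<omega>\<^sup>2 * ?S y) *\<^sub>R u y) + (?S y *\<^sub>R 0 + (- cos (\<omega> * (x - y))) *\<^sub>R v 0))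
       (at y within {0..x})"
      by (intro has_vector_derivative_add has_vector_derivative_scaleR c s u y has_vector_derivative_const)
    then show "((\<lambda>y. cos (\<omega> * (x - y)) *\<^sub>R u y + ?S y *\<^sub>R v 0) has_vector_derivative
       cos (\<omega> * (x - y)) *\<^sub>R (v y - v 0) + (\<omega>\<^sup>2 * ?S y) *\<^sub>R u y) (at y within {0..x})"
      by (simp add: algebra_simps)
  qed
  then have "((\<lambda>z. cos (\<omega> * (x - z)) *\<^sub>R (v z - v 0) + (\<omega>\<^sup>2 * ?S z) *\<^sub>R u z - \<omega>\<^sup>2 *\<^sub>R (?S z *\<^sub>R u z)) has_integral
      (u x - (cos (\<omega> * x) *\<^sub>R u 0 + sine_kernel \<omega> x *\<^sub>R v 0))
      - \<omega>\<^sup>2 *\<^sub>R integral {0..x} (\<lambda>y. ?S y *\<^sub>R u y)) {0..x}"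
    by (intro has_integral_diff has_integral_cmul i2) simp
  then have 3: "integral {0..x} (\<lambda>z. cos (\<omega> * (x - z)) *\<^sub>R (v z - v 0)) =
      u x - (cos (\<omega> * x) *\<^sub>R u 0 + sine_kernel \<omega> x *\<^sub>R v 0) - \<omega>\<^sup>2 *\<^sub>R integral {0..x} (\<lambda>y. ?S y *\<^sub>R u y)"
    by (simp add: integral_unique)
  \<comment> \<open>The terms with omega^2 times the integral of ?S u cancel between 1 and
    3.\<close>
  show "integral {0..x} (\<lambda>y. ?S y *\<^sub>R (q y * u y)) = u x - cos (\<omega> * x) *\<^sub>R u 0 - sine_kernel \<omega> x *\<^sub>R v 0"
    using 1 2 3 by (simp add: algebra_simps)
qed

subsection \<open>The integral equation of the kernel\<close>

lemma norm_LINT_le_interval: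
  fixes f :: "real \<Rightarrow> 'b::{banach, second_countable_topology}"
  assumes [measurable]: "f \<in> borel_measurable borel" "l \<le> r"
    and "\<And>y. norm (f y) \<le> B" "\<And>y. y \<notin> {l..r} \<Longrightarrow> f y = 0"
  shows "norm (LINT y|lborel. f y) \<le> B * (r - l)"
proof -
  have "norm (LINT y|lborel. f y) \<le> (LINT y|lborel. indicator {l..r} y * B)"
  proof (rule Bochner_Integration.integral_norm_bound_integral)
    show "integrable lborel f"
      by (rule integrable_bounded_support[where S = "{l..r}"]) (use assms in auto)
    show "integrable lborel (\<lambda>y. indicator {l..r} y * B)"
      by (intro integrable_mult_left) (simp add: integrable_indicator_iff emeasure_lborel_Icc_eq)
    show "norm (f y) \<le> indicator {l..r} y * B" for y
      using assms(3)[of y] assms(4)[of y] by (auto simp: indicator_def)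
  qed
  also have "\<dots> = B * (r - l)" using \<open>l \<le> r\<close> by simp
  finally show ?thesis .
qed

text \<open>The two integrands differ only between u and u'. With primitives written as truncated
  integrals over the whole line, \<open>Q1\<close> and \<open>J\<close> below are defined and
  Lipschitz for all real arguments, without conditions on their position in the domain.\<close>

lemma LINT_truncated_lipschitz:
  fixes g :: "real \<Rightarrow> 'b::{banach, second_countable_topology}"
  assumes [measurable]: "g \<in> borel_measurable borel"
    and g: "\<And>y. norm (g y) \<le> B" and supp: "\<And>y. y \<notin> {0..R} \<Longrightarrow> g y = 0"
  shows "norm ((LINT y|lborel. (if y \<le> u then g y else 0)) - (LINT y|lborel. (if y \<le> u' then g y else 0)))
    \<le> B * \<bar>u - u'\<bar>"
proof -
  have int: "integrable lborel (\<lambda>y. if y \<le> u then g y else 0)" for u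
    by (rule integrable_bounded_support[where S = "{0..R}" and B = B])
       (use g order_trans[OF norm_ge_zero g] supp in auto)
  have le: "norm ((LINT y|lborel. (if y \<le> u' then g y else 0)) - (LINT y|lborel. (if y \<le> u then g y else 0)))
      \<le> B * (u' - u)" if "u \<le> u'" for u u'
  proof -
    have "(LINT y|lborel. (if y \<le> u' then g y else 0)) - (LINT y|lborel. (if y \<le> u then g y else 0))
        = (LINT y|lborel. (if y \<le> u' then g y else 0) - (if y \<le> u then g y else 0))"
      by (rule Bochner_Integration.integral_diff[symmetric, OF int int])
    also have "norm \<dots> \<le> B * (u' - u)"
      using that g order_trans[OF norm_ge_zero g] by (intro norm_LINT_le_interval) auto
    finally show ?thesis .
  qed
  show ?thesis
    using le[of u u'] le[of u' u] by (cases "u \<le> u'") (auto simp: norm_minus_commute)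
qed

lemma lipschitz_real_continuous_on:
  fixes f :: "real \<Rightarrow> 'b::real_normed_vector"
  assumes "\<And>s t. norm (f s - f t) \<le> B * \<bar>s - t\<bar>"
  shows "continuous_on S f"
proof (rule lipschitz_on_continuous_on)
  have "0 \<le> B" using order_trans[OF norm_ge_zero assms[of 0 1]] by simp
  then show "B-lipschitz_on S f"
    using assms by (intro lipschitz_onI) (auto simp: dist_norm)
qed

text \<open>The potential enters as a Borel representative that is bounded everywhere and zero
  outside {0..b}. All integrands below are then total, Borel and bounded, so Fubini's theorem
  applies without bookkeeping of null sets.\<close>

locale schroedinger_transmutation =
  fixes b :: real and h :: complex and q :: "real \<Rightarrow> complex" and M :: real
    and c s :: "complex \<Rightarrow> real \<Rightarrow> complex" and K :: "real \<Rightarrow> real \<Rightarrow> complex"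
  assumes b_pos: "b > 0"
    and q_meas [measurable]: "q \<in> borel_measurable borel"
    and q_bound: "\<And>y. norm (q y) \<le> M"
    and q_supp: "\<And>y. y \<notin> {0..b} \<Longrightarrow> q y = 0"
    and c: "\<And>\<omega>. schroedinger_ivp b q \<omega> 1 h (c \<omega>)"
    and s: "\<And>\<omega>. schroedinger_ivp b q \<omega> 0 \<omega> (s \<omega>)"
    and K: "transmutation_kernel b c s K"
begin

abbreviation "Tri \<equiv> {(x, t). 0 \<le> x \<and> x \<le> b \<and> \<bar>t\<bar> \<le> x}"

lemma closed_Tri: "closed Tri"
proof -
  have "Tri = {z. 0 \<le> fst z} \<inter> {z. fst z \<le> b} \<inter> {z. \<bar>snd z\<bar> \<le> fst z}" by auto
  then show ?thesis by (simp only:) (intro closed_Int closed_Collect_le continuous_intros)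
qed

lemma compact_Tri: "compact Tri"
proof -
  have "Tri \<subseteq> {0..b} \<times> {-b..b}" by auto
  then have "bounded Tri" by (rule bounded_subset[rotated]) (intro bounded_Times, auto)
  then show ?thesis using closed_Tri by (simp add: compact_eq_bounded_closed)
qed

lemma K_cont: "continuous_on Tri (\<lambda>(x, t). K x t)"
  using K by (simp add: transmutation_kernel_def)

lemma K_cont_t:
  assumes "x \<in> {0..b}"
  shows "continuous_on {-x..x} (K x)"
proof -
  have "continuous_on {-x..x} (\<lambda>t. case (x, t) of (x, t) \<Rightarrow> K x t)"
    by (rule continuous_on_compose2[OF K_cont]) (use assms in \<open>auto intro!: continuous_intros\<close>)
  then show ?thesis by simp
qed

definition K0 :: "real \<times> real \<Rightarrow> complex" where
  "K0 z = indicator Tri z *\<^sub>R (case z of (x, t) \<Rightarrow> K x t)"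

lemma K0_meas [measurable]: "K0 \<in> borel_measurable borel"
  unfolding K0_def by (intro borel_measurable_continuous_on_indicator borel_closed closed_Tri K_cont)

lemma K0_bounded: "\<exists>B. \<forall>z. norm (K0 z) \<le> B"
proof -
  have "bounded ((\<lambda>(x, t). K x t) ` Tri)"
    by (intro compact_imp_bounded compact_continuous_image K_cont compact_Tri)
  then obtain B where B: "\<forall>w\<in>(\<lambda>(x, t). K x t) ` Tri. norm w \<le> B" unfolding bounded_iff ..
  have "norm (K0 z) \<le> max B 0" for z
  proof (cases "z \<in> Tri")
    case True
    then have "norm (case z of (x, t) \<Rightarrow> K x t) \<le> B" using B by blast
    then show ?thesis using True by (simp add: K0_def)
  qed (simp add: K0_def)
  then show ?thesis by blast
qed

definition BK where "BK = (SOME B. \<forall>z. norm (K0 z) \<le> B)"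

lemma K0_bound: "norm (K0 z) \<le> BK"
  using someI_ex[OF K0_bounded] unfolding BK_def by blast

lemma BK_nonneg: "0 \<le> BK" by (rule order_trans[OF norm_ge_zero K0_bound])

lemma M_nonneg: "0 \<le> M" by (rule order_trans[OF norm_ge_zero q_bound])

text \<open>\<open>G\<close> is \<open>Q K\<close> in the characteristic coordinates \<open>x = \<alpha> + \<beta>\<close>, \<open>t = \<alpha> - \<beta>\<close>, extended by zero. The
  function \<open>H\<close> below is the right-hand side of the Goursat integral equation, and \<open>K_eq_H\<close> is the
  equation itself.\<close>

definition G where "G \<alpha> \<beta> = q (\<alpha> + \<beta>) * K0 (\<alpha> + \<beta>, \<alpha> - \<beta>)"

lemma G_meas [measurable]: "(\<lambda>(\<alpha>, \<beta>). G \<alpha> \<beta>) \<in> borel_measurable borel"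
  unfolding G_def borel_prod[symmetric] by measurable

lemma G_meas' [measurable]: "(\<lambda>(\<alpha>, \<beta>). G \<alpha> \<beta>) \<in> borel_measurable (borel \<Otimes>\<^sub>M borel)"
  using G_meas by (simp add: borel_prod)

lemma G_bound: "norm (G \<alpha> \<beta>) \<le> M * BK"
  unfolding G_def norm_mult using q_bound K0_bound M_nonneg by (intro mult_mono) auto

lemma G_supp: "\<not> (0 \<le> \<alpha> \<and> 0 \<le> \<beta> \<and> \<alpha> + \<beta> \<le> b) \<Longrightarrow> G \<alpha> \<beta> = 0"
  by (auto simp: G_def K0_def indicator_def)

lemma G_eq: "0 \<le> \<alpha> \<Longrightarrow> 0 \<le> \<beta> \<Longrightarrow> \<alpha> + \<beta> \<le> b \<Longrightarrow> G \<alpha> \<beta> = q (\<alpha> + \<beta>) * K (\<alpha> + \<beta>) (\<alpha> - \<beta>)"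
  by (auto simp: G_def K0_def indicator_def)

definition Q1 where "Q1 u = (LINT y|lborel. (if y \<le> u then q y else 0))"

lemma Q1_lipschitz: "norm (Q1 u - Q1 u') \<le> M * \<bar>u - u'\<bar>"
  unfolding Q1_def using q_bound q_supp b_pos
  by (intro LINT_truncated_lipschitz[where R = b]) auto

definition J1 where "J1 v \<alpha> = (LINT \<beta>|lborel. (if \<beta> \<le> v then G \<alpha> \<beta> else 0))"

text \<open>As \<open>G\<close> vanishes for negative arguments, this is the integral of Q K over
  the characteristic rectangle between (0, 0) and (u, v).\<close>

definition J where "J u v = (LINT \<alpha>|lborel. (if \<alpha> \<le> u then J1 v \<alpha> else 0))"

lemma J1_meas [measurable]: "J1 v \<in> borel_measurable borel"
  unfolding J1_def by measurable

lemma J1_bound: "norm (J1 v \<alpha>) \<le> M * BK * b"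
  unfolding J1_def
  by (rule order_trans[OF norm_LINT_le_interval[where l = 0 and r = b and B = "M * BK"]])
     (use b_pos in \<open>auto intro!: G_supp simp: G_bound order_trans[OF norm_ge_zero G_bound]\<close>)

lemma J1_supp: "\<alpha> \<notin> {0..b} \<Longrightarrow> J1 v \<alpha> = 0"
  unfolding J1_def by (subst G_supp) (auto intro!: integral_eq_zero_AE G_supp)

lemma J_lipschitz1: "norm (J u v - J u' v) \<le> M * BK * b * \<bar>u - u'\<bar>"
  unfolding J_def using J1_bound J1_supp b_pos
  by (intro LINT_truncated_lipschitz[where R = b]) auto

text \<open>After the exchange the outer truncation is the one in v, so the Lipschitz estimate in v
  is obtained in the same way as the one in u.\<close>

lemma J_swap: "J u v = (LINT \<beta>|lborel. (if \<beta> \<le> v then (LINT \<alpha>|lborel. (if \<alpha> \<le> u then G \<alpha> \<beta> else 0)) else 0))"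
proof -
  have "J u v = (LINT \<alpha>|lborel. LINT \<beta>|lborel. (if \<alpha> \<le> u \<and> \<beta> \<le> v then G \<alpha> \<beta> else 0))"
    unfolding J_def J1_def by (intro Bochner_Integration.integral_cong) auto
  also have "\<dots> = (LINT \<beta>|lborel. LINT \<alpha>|lborel. (if \<alpha> \<le> u \<and> \<beta> \<le> v then G \<alpha> \<beta> else 0))"
  proof (rule Fubini_bounded_support[where B = "M * BK" and R = b])
    show "(\<lambda>(\<alpha>, \<beta>). if \<alpha> \<le> u \<and> \<beta> \<le> v then G \<alpha> \<beta> else 0) \<in> borel_measurable borel"
      unfolding borel_prod[symmetric] by measurable
  qed (auto intro!: G_supp simp: G_bound order_trans[OF norm_ge_zero G_bound])
  also have "\<dots> = (LINT \<beta>|lborel. (if \<beta> \<le> v then (LINT \<alpha>|lborel. (if \<alpha> \<le> u then G \<alpha> \<beta> else 0)) else 0))"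
    by (intro Bochner_Integration.integral_cong) auto
  finally show ?thesis .
qed

lemma J_lipschitz2: "norm (J u v - J u v') \<le> M * BK * b * \<bar>v - v'\<bar>"
proof -
  have [measurable]: "(\<lambda>\<beta>. LINT \<alpha>|lborel. (if \<alpha> \<le> u then G \<alpha> \<beta> else 0)) \<in> borel_measurable borel"
    by measurable
  have supp: "(LINT \<alpha>|lborel. (if \<alpha> \<le> u then G \<alpha> \<beta> else 0)) = 0" if "\<beta> \<notin> {0..b}" for \<beta>
    using that by (intro integral_eq_zero_AE) (auto intro!: G_supp)
  have bound: "norm (LINT \<alpha>|lborel. (if \<alpha> \<le> u then G \<alpha> \<beta> else 0)) \<le> M * BK * b" for \<beta>
    by (rule order_trans[OF norm_LINT_le_interval[where l = 0 and r = b and B = "M * BK"]])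
       (use b_pos in \<open>auto intro!: G_supp simp: G_bound order_trans[OF norm_ge_zero G_bound]\<close>)
  show ?thesis
    unfolding J_swap using bound supp b_pos
    by (intro LINT_truncated_lipschitz[where R = b]) auto
qed

lemma J_lipschitz: "norm (J u v - J u' v') \<le> M * BK * b * (\<bar>u - u'\<bar> + \<bar>v - v'\<bar>)"
  using norm_triangle_ineq[of "J u v - J u' v" "J u' v - J u' v'"] J_lipschitz1[of u v u'] J_lipschitz2[of u' v v']
  by (simp add: algebra_simps)

definition H where "H u v = h / 2 + Q1 u / 2 + J u v"

lemma H_lipschitz: "norm (H u v - H u' v') \<le> (M / 2 + M * BK * b) * (\<bar>u - u'\<bar> + \<bar>v - v'\<bar>)"
proof -
  have "H u v - H u' v' = (Q1 u - Q1 u') / 2 + (J u v - J u' v')"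
    by (simp add: H_def diff_divide_distrib)
  also have "norm \<dots> \<le> norm ((Q1 u - Q1 u') / 2) + norm (J u v - J u' v')" by (rule norm_triangle_ineq)
  also have "\<dots> \<le> M * (\<bar>u - u'\<bar> + \<bar>v - v'\<bar>) / 2 + M * BK * b * (\<bar>u - u'\<bar> + \<bar>v - v'\<bar>)"
  proof (rule add_mono[OF _ J_lipschitz])
    have "norm (Q1 u - Q1 u') \<le> M * (\<bar>u - u'\<bar> + \<bar>v - v'\<bar>)"
      by (rule order_trans[OF Q1_lipschitz mult_left_mono]) (auto simp: M_nonneg)
    then show "norm ((Q1 u - Q1 u') / 2) \<le> M * (\<bar>u - u'\<bar> + \<bar>v - v'\<bar>) / 2"
      by (simp add: norm_divide)
  qed
  finally show ?thesis by (simp add: field_simps)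
qed

section \<open>The two representations as a Fourier identity\<close>

lemma integral_K_cis:
  assumes x: "x \<in> {0..b}"
  shows "c \<omega> x + \<i> * s \<omega> x = cis (\<omega> * x) + integral {-x..x} (\<lambda>t. K x t * cis (\<omega> * t))"
proof -
  have int: "(\<lambda>t. K x t * f t) integrable_on {-x..x}" if "continuous_on {-x..x} f" for f
    by (intro integrable_continuous_real continuous_intros K_cont_t[OF x] that)
  have "cis (\<omega> * t) = cos (\<omega> * complex_of_real t) + \<i> * sin (\<omega> * complex_of_real t)" for t
    by (simp add: complex_eq_iff cos_of_real sin_of_real flip: of_real_mult)
  then have "integral {-x..x} (\<lambda>t. K x t * cis (\<omega> * t)) =
      integral {-x..x} (\<lambda>t. K x t * cos (\<omega> * complex_of_real t) + \<i> * (K x t * sin (\<omega> * complex_of_real t)))"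
    by (simp add: algebra_simps)
  also have "\<dots> = integral {-x..x} (\<lambda>t. K x t * cos (\<omega> * complex_of_real t))
      + \<i> * integral {-x..x} (\<lambda>t. K x t * sin (\<omega> * complex_of_real t))"
    by (subst integral_add) (auto intro!: int integrable_on_mult_right continuous_intros)
  finally show ?thesis
    using K x by (simp add: transmutation_kernel_def complex_eq_iff[of "cis _"] cos_of_real sin_of_real
        algebra_simps flip: of_real_mult) (simp add: complex_eq_iff)
qed

text \<open>The initial values of c + i s are 1 and h + i omega, so its free part is cis (omega x)
  plus h times the sine kernel. The exponential cancels against the leading term of the
  representation, and the transform of K alone remains on the left.\<close>

lemma sine_transform_identity:
  fixes \<omega> x :: real
  assumes x: "x \<in> {0..b}"
  shows "integral {-x..x} (\<lambda>t. K x t * cis (\<omega> * t)) = h * sine_kernel \<omega> x +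
     integral {0..x} (\<lambda>y. sine_kernel \<omega> (x - y) *\<^sub>R
        (q y * (cis (\<omega> * y) + integral {-y..y} (\<lambda>t. K y t * cis (\<omega> * t)))))"
proof -
  define e where "e y = c \<omega> y + \<i> * s \<omega> y" for y
  obtain vc where vc: "c \<omega> 0 = 1" "vc 0 = h"
      "\<forall>y\<in>{0..b}. (c \<omega> has_vector_derivative vc y) (at y within {0..b}) \<and>
        ((\<lambda>z. (q z - (of_real \<omega>)\<^sup>2) * c \<omega> z) has_integral (vc y - vc 0)) {0..y}"
    using c[of "of_real \<omega>"] unfolding schroedinger_ivp_def by blast
  obtain vs where vs: "s \<omega> 0 = 0" "vs 0 = complex_of_real \<omega>"
      "\<forall>y\<in>{0..b}. (s \<omega> has_vector_derivative vs y) (at y within {0..b}) \<and>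
        ((\<lambda>z. (q z - (of_real \<omega>)\<^sup>2) * s \<omega> z) has_integral (vs y - vs 0)) {0..y}"
    using s[of "of_real \<omega>"] unfolding schroedinger_ivp_def by blast
  note vc' = bspec[OF vc(3), THEN conjunct1] bspec[OF vc(3), THEN conjunct2]
    and vs' = bspec[OF vs(3), THEN conjunct1] bspec[OF vs(3), THEN conjunct2]
  define v where "v y = vc y + \<i> * vs y" for y
  have e: "(e has_vector_derivative v y) (at y within {0..x})" if "y \<in> {0..x}" for y
    unfolding e_def v_def using x that
    by (intro has_vector_derivative_add has_vector_derivative_mult_right
        has_vector_derivative_within_subset[OF vc'(1)] has_vector_derivative_within_subset[OF vs'(1)]) auto
  have v: "((\<lambda>z. (q z - (of_real \<omega>)\<^sup>2) * e z) has_integral (v y - v 0)) {0..y}" if "y \<in> {0..x}" for y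
    using has_integral_add[OF vc'(2)[of y] has_integral_mult_right[OF vs'(2)[of y], of \<i>]] that x
    by (simp add: e_def v_def algebra_simps)
  have "integral {0..x} (\<lambda>y. sine_kernel \<omega> (x - y) *\<^sub>R (q y * e y)) =
      e x - cos (\<omega> * x) *\<^sub>R e 0 - sine_kernel \<omega> x *\<^sub>R v 0"
    using x by (intro variation_of_constants[OF _ e v q_meas q_bound]) auto
  also have "\<dots> = e x - (complex_of_real (cos (\<omega> * x)) + \<i> * \<omega> * sine_kernel \<omega> x) - h * sine_kernel \<omega> x"
    by (simp add: e_def v_def vc(1,2) vs(1,2) scaleR_conv_of_real algebra_simps)
  finally have "integral {0..x} (\<lambda>y. sine_kernel \<omega> (x - y) *\<^sub>R (q y * e y)) =
      e x - cis (\<omega> * x) - h * sine_kernel \<omega> x"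
    unfolding cos_plus_sine_kernel .
  moreover have "integral {0..x} (\<lambda>y. sine_kernel \<omega> (x - y) *\<^sub>R (q y * e y)) =
     integral {0..x} (\<lambda>y. sine_kernel \<omega> (x - y) *\<^sub>R
        (q y * (cis (\<omega> * y) + integral {-y..y} (\<lambda>t. K y t * cis (\<omega> * t)))))"
    using x by (intro Henstock_Kurzweil_Integration.integral_cong) (auto simp: e_def integral_K_cis)
  ultimately show ?thesis
    using integral_K_cis[OF x, of \<omega>] by (simp add: e_def algebra_simps)
qed

section \<open>The terms of the integral equation as Fourier transforms\<close>

lemma cis_meas [measurable]: "(\<lambda>t. cis (\<omega> * t)) \<in> borel_measurable borel"
  by (intro borel_measurable_continuous_onI continuous_intros)

lemma integrable_indicator_cis_shift:
  "integrable lborel (\<lambda>t. indicator {l..r} t *\<^sub>R (g * cis (\<omega> * t)))"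
  by (rule integrable_bounded_support[where S = "{l..r}" and B = "norm g"])
     (auto simp: indicator_def norm_mult)

lemma LINT_indicator_cis:
  assumes "r \<ge> 0"
  shows "(LINT t|lborel. indicator {a - r..a + r} t *\<^sub>R (g * cis (\<omega> * t))) =
    (2 * sine_kernel \<omega> r) *\<^sub>R (g * cis (\<omega> * a))"
  unfolding LINT_indicator_eq_integral(1)[OF integrable_indicator_cis_shift]
  by (subst integral_unique[OF has_integral_mult_right[OF has_integral_cis_sine_kernel[OF assms]]]) simp

text \<open>Twice the sine kernel of x - y times cis (omega y) is the integral of the exponential
  over all t within x - y of y, that is 2 y - x <= t <= x. For fixed t this says y <= (x + t) / 2,
  and integrating q over these y gives \<open>Q1\<close>; the factor 2 accounts for
  \<open>Q1\<close> / 2.\<close>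

lemma free_term_transform:
  assumes x: "x \<in> {0..b}"
  shows "(LINT y|lborel. indicator {0..x} y *\<^sub>R (sine_kernel \<omega> (x - y) *\<^sub>R (q y * cis (\<omega> * y)))) =
    integral {-x..x} (\<lambda>t. Q1 ((x + t) / 2) / 2 * cis (\<omega> * t))"
proof -
  define A where "A y t = (if 0 \<le> y \<and> 2 * y - x \<le> t \<and> t \<le> x then q y * cis (\<omega> * t) else 0)" for y t
  have A_t: "(LINT t|lborel. A y t) = 2 *\<^sub>R (indicator {0..x} y *\<^sub>R (sine_kernel \<omega> (x - y) *\<^sub>R (q y * cis (\<omega> * y))))" for y
  proof (cases "y \<in> {0..x}")
    case True
    have "A y t = indicator {y - (x - y)..y + (x - y)} t *\<^sub>R (q y * cis (\<omega> * t))" for t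
      using True by (auto simp: A_def indicator_def)
    then have "(LINT t|lborel. A y t) = (2 * sine_kernel \<omega> (x - y)) *\<^sub>R (q y * cis (\<omega> * y))"
      using True by (simp only: atLeastAtMost_iff diff_ge_0_iff_ge LINT_indicator_cis)
    then show ?thesis using True by simp
  next
    case False
    then have "A y t = 0" for t by (auto simp: A_def)
    then show ?thesis using False by simp
  qed
  have A_y: "(LINT y|lborel. A y t) = indicator {-x..x} t *\<^sub>R (Q1 ((x + t) / 2) * cis (\<omega> * t))" for t
  proof (cases "t \<in> {-x..x}")
    case True
    have "A y t = (if y \<le> (x + t) / 2 then q y else 0) * cis (\<omega> * t)" for y
      using True q_supp[of y] by (auto simp: A_def)
    then show ?thesis using True by (simp add: Q1_def)
  next
    case False
    then have "A y t = 0" for y using x by (auto simp: A_def)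
    then show ?thesis using False by simp
  qed
  have "2 *\<^sub>R (LINT y|lborel. indicator {0..x} y *\<^sub>R (sine_kernel \<omega> (x - y) *\<^sub>R (q y * cis (\<omega> * y))))
      = (LINT y|lborel. LINT t|lborel. A y t)"
    by (simp only: A_t Bochner_Integration.integral_scaleR_right)
  also have "\<dots> = (LINT t|lborel. LINT y|lborel. A y t)"
  proof (rule Fubini_bounded_support[where B = M and R = x])
    show "(\<lambda>(y, t). A y t) \<in> borel_measurable borel"
      unfolding A_def borel_prod[symmetric] by measurable
  qed (auto simp: A_def norm_mult q_bound M_nonneg)
  also have "\<dots> = (LINT t|lborel. indicator {-x..x} t *\<^sub>R (Q1 ((x + t) / 2) * cis (\<omega> * t)))"
    by (simp only: A_y)
  also have "\<dots> =
      integral {-x..x} (\<lambda>t. Q1 ((x + t) / 2) * cis (\<omega> * t))"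
  proof (rule LINT_indicator_eq_integral(1))
    have "continuous_on {-x..x} (\<lambda>t. Q1 ((x + t) / 2) * cis (\<omega> * t))"
      by (intro continuous_intros continuous_on_compose2[OF lipschitz_real_continuous_on[OF Q1_lipschitz, of UNIV]]) auto
    from borel_integrable_compact[OF _ this]
    show "integrable lborel (\<lambda>t. indicator {-x..x} t *\<^sub>R (Q1 ((x + t) / 2) * cis (\<omega> * t)))"
      by (simp add: indicator_scaleR_eq_if)
  qed
  finally show ?thesis by (simp add: scaleR_conv_of_real mult_ac)
qed

lemma J_cont: "continuous_on S (\<lambda>t. J ((x + t) / 2) ((x - t) / 2))"
proof (rule lipschitz_real_continuous_on)
  fix t t' :: real
  have "\<bar>(x + t) / 2 - (x + t') / 2\<bar> + \<bar>(x - t) / 2 - (x - t') / 2\<bar> = \<bar>t - t'\<bar>"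
    by (auto simp: abs_if field_simps)
  then show "norm (J ((x + t) / 2) ((x - t) / 2) - J ((x + t') / 2) ((x - t') / 2)) \<le> M * BK * b * \<bar>t - t'\<bar>"
    using J_lipschitz[of "(x + t) / 2" "(x - t) / 2" "(x + t') / 2" "(x - t') / 2"] by simp
qed

text \<open>Here t ranges over the points within x - y of \<tau>. In the coordinates y = \<alpha> +
  \<beta>, \<tau> = \<alpha> - \<beta> this condition separates into \<alpha> <= (x + t) / 2 and
  \<beta> <= (x - t) / 2. So integrating over t last leaves the integral of \<open>G\<close> over a
  rectangle, which is \<open>J\<close>.\<close>

lemma kernel_term_transform:
  assumes x: "x \<in> {0..b}"
  shows "(LINT y|lborel. indicator {0..x} y *\<^sub>R (sine_kernel \<omega> (x - y) *\<^sub>R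
      (q y * (LINT \<tau>|lborel. K0 (y, \<tau>) * cis (\<omega> * \<tau>))))) =
    integral {-x..x} (\<lambda>t. J ((x + t) / 2) ((x - t) / 2) * cis (\<omega> * t))" (is "?lhs = ?rhs")
proof -
  define A where "A y \<tau> = (if 0 \<le> y \<and> y \<le> x then sine_kernel \<omega> (x - y) *\<^sub>R (q y * (K0 (y, \<tau>) * cis (\<omega> * \<tau>))) else 0)" for y \<tau>
  have [measurable]: "(\<lambda>(y, \<tau>). A y \<tau>) \<in> borel_measurable (borel \<Otimes>\<^sub>M borel)"
    unfolding A_def by measurable
  have A_bound: "norm (A y \<tau>) \<le> x * (M * BK)" for y \<tau>
    using abs_sine_kernel_le[of \<omega> "x - y"] x q_bound[of y] K0_bound[of "(y, \<tau>)"] M_nonneg BK_nonneg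
    by (auto simp: A_def norm_mult intro!: mult_mono mult_nonneg_nonneg)
  define B where "B \<alpha> \<beta> t = (if \<alpha> \<le> (x + t) / 2 \<and> \<beta> \<le> (x - t) / 2 then G \<alpha> \<beta> * cis (\<omega> * t) else 0)" for \<alpha> \<beta> t
  have B_bound: "norm (B \<alpha> \<beta> t) \<le> M * BK" for \<alpha> \<beta> t
    using G_bound[of \<alpha> \<beta>] order_trans[OF norm_ge_zero G_bound] by (auto simp: B_def norm_mult)
  have B_supp: "B \<alpha> \<beta> t = 0" if "\<alpha> \<notin> {0..b} \<or> \<beta> \<notin> {0..b} \<or> t \<notin> {-x..x}" for \<alpha> \<beta> t
  proof (cases "\<alpha> \<le> (x + t) / 2 \<and> \<beta> \<le> (x - t) / 2")
    case True
    then have "G \<alpha> \<beta> = 0" using that by (intro G_supp) auto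
    then show ?thesis by (simp add: B_def)
  qed (auto simp: B_def)
  have B_t: "2 *\<^sub>R A (\<alpha> + \<beta>) (\<alpha> - \<beta>) = (LINT t|lborel. B \<alpha> \<beta> t)" for \<alpha> \<beta>
  proof (cases "0 \<le> \<alpha> \<and> 0 \<le> \<beta> \<and> \<alpha> + \<beta> \<le> x")
    case True
    then have r: "0 \<le> x - (\<alpha> + \<beta>)" by simp
    from True have "B \<alpha> \<beta> t = indicator {(\<alpha> - \<beta>) - (x - (\<alpha> + \<beta>))..(\<alpha> - \<beta>) + (x - (\<alpha> + \<beta>))} t *\<^sub>R (G \<alpha> \<beta> * cis (\<omega> * t))" for t
      by (auto simp: B_def indicator_def field_simps)
    then have "(LINT t|lborel. B \<alpha> \<beta> t) = (2 * sine_kernel \<omega> (x - (\<alpha> + \<beta>))) *\<^sub>R (G \<alpha> \<beta> * cis (\<omega> * (\<alpha> - \<beta>)))"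
      by (simp only: LINT_indicator_cis[OF r])
    then show ?thesis using True by (simp add: A_def G_def mult_ac)
  next
    case False
    then have "B \<alpha> \<beta> t = 0" for t
    proof (cases "0 \<le> \<alpha> \<and> 0 \<le> \<beta>")
      case True
      then have "\<not> (\<alpha> \<le> (x + t) / 2 \<and> \<beta> \<le> (x - t) / 2)" using False by (auto simp: field_simps)
      then show ?thesis by (auto simp: B_def)
    qed (auto simp: B_def intro!: G_supp)
    moreover have "A (\<alpha> + \<beta>) (\<alpha> - \<beta>) = 0"
      using False by (auto simp: A_def K0_def indicator_def)
    ultimately show ?thesis by simp
  qed
  have B_ab: "(LINT \<alpha>|lborel. LINT \<beta>|lborel. B \<alpha> \<beta> t) =
      indicator {-x..x} t *\<^sub>R (J ((x + t) / 2) ((x - t) / 2) * cis (\<omega> * t))" for t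
  proof (cases "t \<in> {-x..x}")
    case True
    have "(LINT \<beta>|lborel. B \<alpha> \<beta> t) = (if \<alpha> \<le> (x + t) / 2 then J1 ((x - t) / 2) \<alpha> else 0) * cis (\<omega> * t)" for \<alpha>
    proof (cases "\<alpha> \<le> (x + t) / 2")
      case True
      then have "B \<alpha> \<beta> t = (if \<beta> \<le> (x - t) / 2 then G \<alpha> \<beta> else 0) * cis (\<omega> * t)" for \<beta> by (simp add: B_def)
      then show ?thesis using True by (simp add: J1_def)
    qed (simp add: B_def)
    then show ?thesis using True by (simp add: J_def)
  next
    case False
    then have "B \<alpha> \<beta> t = 0" for \<alpha> \<beta> by (intro B_supp) auto
    then show ?thesis using False by simp
  qed
  have "?lhs = (LINT y|lborel. LINT \<tau>|lborel. A y \<tau>)"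
  proof (rule Bochner_Integration.integral_cong[OF refl])
    show "indicator {0..x} y *\<^sub>R (sine_kernel \<omega> (x - y) *\<^sub>R
        (q y * (LINT \<tau>|lborel. K0 (y, \<tau>) * cis (\<omega> * \<tau>)))) = (LINT \<tau>|lborel. A y \<tau>)" for y
      by (cases "y \<in> {0..x}") (auto simp: A_def)
  qed
  \<comment> \<open>Characteristic coordinates are introduced one variable at a time: first \<tau> =
    2 \<alpha> - y, then y = \<alpha> + \<beta>. The Jacobian 2 is the factor 2 that accompanies the
    sine kernel in \<open>LINT_indicator_cis\<close>.\<close>
  also have "\<dots> = (LINT y|lborel. LINT \<alpha>|lborel. 2 *\<^sub>R A y (2 * \<alpha> - y))"
  proof (rule Bochner_Integration.integral_cong[OF refl])
    show "(LINT \<tau>|lborel. A y \<tau>) = (LINT \<alpha>|lborel. 2 *\<^sub>R A y (2 * \<alpha> - y))" for y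
      using lborel_integral_real_affine[of 2 "A y" "- y"] by simp
  qed
  also have "\<dots> = (LINT \<alpha>|lborel. LINT y|lborel. 2 *\<^sub>R A y (2 * \<alpha> - y))"
  proof (rule Fubini_bounded_support[where B = "2 * (x * (M * BK))" and R = "b"])
    show "(\<lambda>(y, \<alpha>). 2 *\<^sub>R A y (2 * \<alpha> - y)) \<in> borel_measurable borel"
      unfolding borel_prod[symmetric] by measurable
    show "norm (2 *\<^sub>R A y (2 * \<alpha> - y)) \<le> 2 * (x * (M * BK))" for y \<alpha>
      using A_bound by simp
    show "2 *\<^sub>R A y (2 * \<alpha> - y) = 0" if "b < \<bar>y\<bar> \<or> b < \<bar>\<alpha>\<bar>" for y \<alpha>
    proof (cases "0 \<le> y \<and> y \<le> x")
      case True
      then have "(y, 2 * \<alpha> - y) \<notin> Tri" using that x by auto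
      then show ?thesis by (simp add: A_def K0_def)
    qed (auto simp: A_def)
  qed
  also have "\<dots> = (LINT \<alpha>|lborel. LINT \<beta>|lborel. 2 *\<^sub>R A (\<alpha> + \<beta>) (\<alpha> - \<beta>))"
  proof (rule Bochner_Integration.integral_cong[OF refl])
    show "(LINT y|lborel. 2 *\<^sub>R A y (2 * \<alpha> - y)) = (LINT \<beta>|lborel. 2 *\<^sub>R A (\<alpha> + \<beta>) (\<alpha> - \<beta>))" for \<alpha>
      using lborel_integral_real_affine[of 1 "\<lambda>y. 2 *\<^sub>R A y (2 * \<alpha> - y)" \<alpha>]
      by (simp add: algebra_simps)
  qed
  also have "\<dots> = (LINT \<alpha>|lborel. LINT \<beta>|lborel. LINT t|lborel. B \<alpha> \<beta> t)"
    by (simp only: B_t)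
  \<comment> \<open>The variable t is moved outwards past \<beta> and then past \<alpha>, each time
    by Fubini's theorem in two variables.\<close>
  also have "\<dots> =
      (LINT \<alpha>|lborel. LINT t|lborel. LINT \<beta>|lborel. B \<alpha> \<beta> t)"
  proof (rule Bochner_Integration.integral_cong[OF refl])
    show "(LINT \<beta>|lborel. LINT t|lborel. B \<alpha> \<beta> t) = (LINT t|lborel. LINT \<beta>|lborel. B \<alpha> \<beta> t)" for \<alpha>
    proof (rule Fubini_bounded_support[where B = "M * BK" and R = b])
      show "(\<lambda>(\<beta>, t). B \<alpha> \<beta> t) \<in> borel_measurable borel"
        unfolding B_def G_def borel_prod[symmetric] by measurable
    qed (use x in \<open>auto intro!: B_supp simp: B_bound\<close>)
  qed
  also have "\<dots> = (LINT t|lborel. LINT \<alpha>|lborel. LINT \<beta>|lborel. B \<alpha> \<beta> t)"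
  proof (rule Fubini_bounded_support[where B = "M * BK * (b - 0)" and R = b])
    show "(\<lambda>(\<alpha>, t). LINT \<beta>|lborel. B \<alpha> \<beta> t) \<in> borel_measurable borel"
      unfolding B_def G_def borel_prod[symmetric] by measurable
    show "norm (LINT \<beta>|lborel. B \<alpha> \<beta> t) \<le> M * BK * (b - 0)" for \<alpha> t
    proof (rule norm_LINT_le_interval)
      show "(\<lambda>\<beta>. B \<alpha> \<beta> t) \<in> borel_measurable borel" unfolding B_def G_def by measurable
    qed (use b_pos in \<open>auto intro!: B_supp simp: B_bound\<close>)
    show "(LINT \<beta>|lborel. B \<alpha> \<beta> t) = 0" if "b < \<bar>\<alpha>\<bar> \<or> b < \<bar>t\<bar>" for \<alpha> t
      using that x by (intro integral_eq_zero_AE AE_I2 B_supp) auto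
  qed
  also have "\<dots> = (LINT t|lborel. indicator {-x..x} t *\<^sub>R (J ((x + t) / 2) ((x - t) / 2) * cis (\<omega> * t)))"
    by (simp only: B_ab)
  also have "\<dots> = ?rhs"
  proof (rule LINT_indicator_eq_integral(1))
    have "continuous_on {-x..x} (\<lambda>t. J ((x + t) / 2) ((x - t) / 2) * cis (\<omega> * t))"
      by (intro continuous_intros J_cont)
    from borel_integrable_compact[OF _ this]
    show "integrable lborel (\<lambda>t. indicator {-x..x} t *\<^sub>R (J ((x + t) / 2) ((x - t) / 2) * cis (\<omega> * t)))"
      by (simp add: indicator_scaleR_eq_if)
  qed
  finally show ?thesis .
qed

lemma H_cont_t: "continuous_on S (\<lambda>t. H ((x + t) / 2) ((x - t) / 2))"
proof (rule lipschitz_real_continuous_on)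
  fix t t' :: real
  have "\<bar>(x + t) / 2 - (x + t') / 2\<bar> + \<bar>(x - t) / 2 - (x - t') / 2\<bar> = \<bar>t - t'\<bar>"
    by (auto simp: abs_if field_simps)
  then show "norm (H ((x + t) / 2) ((x - t) / 2) - H ((x + t') / 2) ((x - t') / 2)) \<le> (M / 2 + M * BK * b) * \<bar>t - t'\<bar>"
    using H_lipschitz[of "(x + t) / 2" "(x - t) / 2" "(x + t') / 2" "(x - t') / 2"] by simp
qed

lemma LINT_K0_cis:
  assumes y: "y \<in> {0..b}"
  shows "(LINT \<tau>|lborel. K0 (y, \<tau>) * cis (\<omega> * \<tau>)) = integral {-y..y} (\<lambda>t. K y t * cis (\<omega> * t))"
proof -
  have eq: "K0 (y, \<tau>) * cis (\<omega> * \<tau>) = indicator {-y..y} \<tau> *\<^sub>R (K y \<tau> * cis (\<omega> * \<tau>))" for \<tau>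
    using y by (auto simp: K0_def indicator_def abs_le_iff)
  have "continuous_on {-y..y} (\<lambda>t. K y t * cis (\<omega> * t))"
    by (intro continuous_intros K_cont_t y)
  from borel_integrable_compact[OF _ this]
  have "integrable lborel (\<lambda>t. indicator {-y..y} t *\<^sub>R (K y t * cis (\<omega> * t)))"
    by (simp add: indicator_scaleR_eq_if)
  then show ?thesis unfolding eq by (rule LINT_indicator_eq_integral(1))
qed

lemma K_transform_eq_H_transform:
  assumes x: "x \<in> {0..b}"
  shows "integral {-x..x} (\<lambda>t. K x t * cis (\<omega> * t)) =
    integral {-x..x} (\<lambda>t. H ((x + t) / 2) ((x - t) / 2) * cis (\<omega> * t))"
proof -
  define \<kappa> where "\<kappa> y = (LINT \<tau>|lborel. K0 (y, \<tau>) * cis (\<omega> * \<tau>))" for y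
  let ?S = "\<lambda>y. sine_kernel \<omega> (x - y)"
  have \<kappa>_meas [measurable]: "\<kappa> \<in> borel_measurable borel"
    unfolding \<kappa>_def by measurable
  have \<kappa>_bound: "norm (\<kappa> y) \<le> BK * (b - (- b))" for y
    unfolding \<kappa>_def
  proof (rule norm_LINT_le_interval)
    show "norm (K0 (y, \<tau>) * cis (\<omega> * \<tau>)) \<le> BK" for \<tau> using K0_bound by (simp add: norm_mult)
    show "K0 (y, \<tau>) * cis (\<omega> * \<tau>) = 0" if "\<tau> \<notin> {-b..b}" for \<tau>
      using that by (auto simp: K0_def indicator_def)
  qed (use b_pos in auto)
  have int: "integrable lborel (\<lambda>y. indicator {0..x} y *\<^sub>R (?S y *\<^sub>R (q y * g y)))"
    if [measurable]: "g \<in> borel_measurable borel" and g: "\<And>y. norm (g y) \<le> B" for g B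
  proof (rule integrable_bounded_support)
    show "norm (indicator {0..x} y *\<^sub>R (?S y *\<^sub>R (q y * g y))) \<le> x * (M * B)" for y
      using abs_sine_kernel_le[of \<omega> "x - y"] q_bound[of y] g[of y] order_trans[OF norm_ge_zero g] x M_nonneg
      by (cases "y \<in> {0..x}") (auto simp: norm_mult intro!: mult_mono)
    show "bounded {0..x}" by simp
  qed auto
  have cis_bound: "norm (cis (\<omega> * y)) \<le> 1" for y by simp
  note i1 = LINT_indicator_eq_integral[OF int[OF cis_meas cis_bound]]
  note i2 = LINT_indicator_eq_integral[OF int[OF \<kappa>_meas \<kappa>_bound]]
  have intK: "(\<lambda>t. F t * cis (\<omega> * t)) integrable_on {-x..x}" if "continuous_on {-x..x} F" for F
    by (intro integrable_continuous_real continuous_intros that)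
  \<comment> \<open>This is the origin of the constant h / 2 in \<open>H\<close>: it is the density
    on {-x..x} whose transform is h times the sine kernel.\<close>
  have hs: "((\<lambda>t. h / 2 * cis (\<omega> * t)) has_integral h * sine_kernel \<omega> x) {-x..x}"
    using has_integral_mult_right[OF has_integral_cis_sine_kernel[of x \<omega> 0], of "h / 2"] x
    by (simp add: scaleR_conv_of_real)
  have Qc: "continuous_on {-x..x} (\<lambda>t. Q1 ((x + t) / 2) / 2)"
    by (intro continuous_intros continuous_on_compose2[OF lipschitz_real_continuous_on[OF Q1_lipschitz, of UNIV]]) auto
  have "integral {-x..x} (\<lambda>t. K x t * cis (\<omega> * t)) = h * sine_kernel \<omega> x +
      integral {0..x} (\<lambda>y. ?S y *\<^sub>R (q y * cis (\<omega> * y)) + ?S y *\<^sub>R (q y * \<kappa> y))"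
    unfolding sine_transform_identity[OF x] using x
    by (intro arg_cong2[where f = "(+)"] Henstock_Kurzweil_Integration.integral_cong refl)
       (simp add: \<kappa>_def LINT_K0_cis distrib_left scaleR_right_distrib)
  also have "\<dots> = h * sine_kernel \<omega> x + (integral {-x..x} (\<lambda>t. Q1 ((x + t) / 2) / 2 * cis (\<omega> * t)) +
      integral {-x..x} (\<lambda>t. J ((x + t) / 2) ((x - t) / 2) * cis (\<omega> * t)))"
    using free_term_transform[OF x, of \<omega>] kernel_term_transform[OF x, of \<omega>]
    unfolding Henstock_Kurzweil_Integration.integral_add[OF i1(2) i2(2)] i1(1) i2(1) \<kappa>_def[symmetric]
    by simp
  also have "h * sine_kernel \<omega> x = integral {-x..x} (\<lambda>t. h / 2 * cis (\<omega> * t))"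
    by (rule integral_unique[OF hs, symmetric])
  also have "\<dots> + (integral {-x..x} (\<lambda>t. Q1 ((x + t) / 2) / 2 * cis (\<omega> * t)) +
      integral {-x..x} (\<lambda>t. J ((x + t) / 2) ((x - t) / 2) * cis (\<omega> * t))) =
      integral {-x..x} (\<lambda>t. h / 2 * cis (\<omega> * t) + (Q1 ((x + t) / 2) / 2 * cis (\<omega> * t) +
        J ((x + t) / 2) ((x - t) / 2) * cis (\<omega> * t)))"
    by (simp only: Henstock_Kurzweil_Integration.integral_add Henstock_Kurzweil_Integration.integrable_add
        intK[OF Qc] intK[OF J_cont] has_integral_integrable[OF hs])
  also have "\<dots> = integral {-x..x} (\<lambda>t. H ((x + t) / 2) ((x - t) / 2) * cis (\<omega> * t))"
    by (simp add: H_def distrib_right add.assoc)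
  finally show ?thesis .
qed

section \<open>The Goursat equation by Fourier uniqueness\<close>

lemma K_eq_H_pos:
  assumes x: "0 < x" "x \<le> b" and t: "\<bar>t\<bar> \<le> x"
  shows "K x t = H ((x + t) / 2) ((x - t) / 2)"
proof -
  have "K x t - H ((x + t) / 2) ((x - t) / 2) = 0"
  proof (rule trig_moments_determine[where a = "-x" and b = x and t = t
        and f = "\<lambda>t. K x t - H ((x + t) / 2) ((x - t) / 2)"])
    show "continuous_on {-x..x} (\<lambda>t. K x t - H ((x + t) / 2) ((x - t) / 2))"
      using x by (intro continuous_intros K_cont_t H_cont_t) auto
    fix \<omega>
    have "(\<lambda>t. K x t * cis (\<omega> * t)) integrable_on {-x..x}"
      "(\<lambda>t. H ((x + t) / 2) ((x - t) / 2) * cis (\<omega> * t)) integrable_on {-x..x}"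
      using x by (auto intro!: integrable_continuous_real continuous_intros K_cont_t H_cont_t)
    then show "integral {-x..x} (\<lambda>t. (K x t - H ((x + t) / 2) ((x - t) / 2)) * cis (\<omega> * t)) = 0"
      using K_transform_eq_H_transform[of x \<omega>] x
      by (simp add: left_diff_distrib Henstock_Kurzweil_Integration.integral_diff)
  qed (use x t in auto)
  then show ?thesis by simp
qed

text \<open>At the vertex x = 0 the representations integrate over a single point and say nothing
  about \<open>K\<close>. There the equation is obtained as a limit along t = 0, from the continuity
  of \<open>K\<close> on the closed triangle.\<close>

lemma K_eq_H:
  assumes x: "0 \<le> x" "x \<le> b" and t: "\<bar>t\<bar> \<le> x"
  shows "K x t = H ((x + t) / 2) ((x - t) / 2)"
proof (cases "x = 0")
  case True
  have Kc: "continuous_on {0..b} (\<lambda>y. K y 0)"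
  proof -
    have "continuous_on {0..b} (\<lambda>y. case (y, 0) of (x, t) \<Rightarrow> K x t)"
      by (rule continuous_on_compose2[OF K_cont]) (auto intro!: continuous_intros)
    then show ?thesis by simp
  qed
  have Hc: "continuous_on {0..b} (\<lambda>y. H (y / 2) (y / 2))"
  proof (rule lipschitz_real_continuous_on)
    show "norm (H (y / 2) (y / 2) - H (z / 2) (z / 2)) \<le> (M / 2 + M * BK * b) * \<bar>y - z\<bar>" for y z
      using H_lipschitz[of "y / 2" "y / 2" "z / 2" "z / 2"] by (simp flip: diff_divide_distrib)
  qed
  have lim: "((\<lambda>y. K y 0) \<longlongrightarrow> K 0 0) (at_right 0)"
    "((\<lambda>y. H (y / 2) (y / 2)) \<longlongrightarrow> H (0 / 2) (0 / 2)) (at_right 0)"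
    using Kc Hc b_pos by (auto simp: continuous_on_def at_within_Icc_at_right dest!: bspec[of _ _ 0])
  have "\<forall>\<^sub>F y in at_right 0. H (y / 2) (y / 2) = K y 0"
    using K_eq_H_pos[of _ 0] b_pos by (auto simp: eventually_at_right_field intro!: exI[of _ b])
  with lim(2) have "((\<lambda>y. K y 0) \<longlongrightarrow> H (0 / 2) (0 / 2)) (at_right 0)"
    by (rule Lim_transform_eventually)
  then show ?thesis using tendsto_unique[OF trivial_limit_at_right_real lim(1)] True t by simp
qed (use K_eq_H_pos assms in auto)

text \<open>Now that \<open>K\<close> is known to be \<open>H\<close>, the double integral can be
  written with q and \<open>H\<close> alone. This closes the equation for \<open>H\<close>, as the
  bootstrap in \<open>H_smooth\<close> requires.\<close>

lemma J_eq_integral: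
  assumes "0 \<le> u" "0 \<le> v" "u + v \<le> b"
  shows "J u v = integral {0..u} (\<lambda>\<alpha>. integral {0..v} (\<lambda>\<beta>. q (\<alpha> + \<beta>) * H \<alpha> \<beta>))"
proof -
  have J1: "J1 v \<alpha> = integral {0..v} (\<lambda>\<beta>. q (\<alpha> + \<beta>) * H \<alpha> \<beta>)" if \<alpha>: "\<alpha> \<in> {0..u}" for \<alpha>
  proof -
    have eq: "(if \<beta> \<le> v then G \<alpha> \<beta> else 0) = indicator {0..v} \<beta> *\<^sub>R G \<alpha> \<beta>" for \<beta>
      by (cases "0 \<le> \<beta>") (auto simp: indicator_def intro!: G_supp)
    have "integrable lborel (\<lambda>\<beta>. indicator {0..v} \<beta> *\<^sub>R G \<alpha> \<beta>)"
    proof (rule integrable_bounded_support)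
      show "norm (indicator {0..v} \<beta> *\<^sub>R G \<alpha> \<beta>) \<le> M * BK" for \<beta>
        using G_bound[of \<alpha> \<beta>] order_trans[OF norm_ge_zero G_bound] by (auto simp: indicator_def)
      show "bounded {0..v}" by simp
    qed auto
    then have "J1 v \<alpha> = integral {0..v} (G \<alpha>)"
      unfolding J1_def eq by (rule LINT_indicator_eq_integral(1))
    also have "\<dots> = integral {0..v} (\<lambda>\<beta>. q (\<alpha> + \<beta>) * H \<alpha> \<beta>)"
    proof (rule Henstock_Kurzweil_Integration.integral_cong)
      fix \<beta> assume \<beta>: "\<beta> \<in> {0..v}"
      have "K (\<alpha> + \<beta>) (\<alpha> - \<beta>) = H ((\<alpha> + \<beta> + (\<alpha> - \<beta>)) / 2) ((\<alpha> + \<beta> - (\<alpha> - \<beta>)) / 2)"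
        using \<alpha> \<beta> assms by (intro K_eq_H) auto
      then show "G \<alpha> \<beta> = q (\<alpha> + \<beta>) * H \<alpha> \<beta>"
        using \<alpha> \<beta> assms by (simp add: G_eq)
    qed
    finally show ?thesis .
  qed
  have eq: "(if \<alpha> \<le> u then J1 v \<alpha> else 0) = indicator {0..u} \<alpha> *\<^sub>R J1 v \<alpha>" for \<alpha>
    using J1_supp[of \<alpha> v] by (cases "0 \<le> \<alpha>") (auto simp: indicator_def)
  have "integrable lborel (\<lambda>\<alpha>. indicator {0..u} \<alpha> *\<^sub>R J1 v \<alpha>)"
  proof (rule integrable_bounded_support)
    show "norm (indicator {0..u} \<alpha> *\<^sub>R J1 v \<alpha>) \<le> M * BK * b" for \<alpha>
      using J1_bound[of v \<alpha>] order_trans[OF norm_ge_zero J1_bound] by (auto simp: indicator_def)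
    show "bounded {0..u}" by simp
  qed auto
  then have "J u v = integral {0..u} (J1 v)"
    unfolding J_def eq by (rule LINT_indicator_eq_integral(1))
  also have "\<dots> = integral {0..u} (\<lambda>\<alpha>. integral {0..v} (\<lambda>\<beta>. q (\<alpha> + \<beta>) * H \<alpha> \<beta>))"
    by (intro Henstock_Kurzweil_Integration.integral_cong J1)
  finally show ?thesis .
qed

lemma Q1_eq_integral:
  assumes "u \<in> {0..b}"
  shows "Q1 u = integral {0..u} q"
proof -
  have eq: "(if y \<le> u then q y else 0) = indicator {0..u} y *\<^sub>R q y" for y
    using q_supp[of y] by (cases "0 \<le> y") (auto simp: indicator_def)
  have "integrable lborel (\<lambda>y. indicator {0..u} y *\<^sub>R q y)"
  proof (rule integrable_bounded_support)
    show "norm (indicator {0..u} y *\<^sub>R q y) \<le> M" for y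
      using q_bound[of y] M_nonneg by (auto simp: indicator_def)
    show "bounded {0..u}" by simp
  qed auto
  then show ?thesis unfolding Q1_def eq by (rule LINT_indicator_eq_integral(1))
qed

end

subsection \<open>Functions with Lipschitz partial derivatives on the characteristic triangle\<close>

text \<open>The domain of the kernel in characteristic coordinates. \<open>smooth_triangle k\<close> is the class of functions
  whose partial derivatives of order \<open>k\<close> exist and are Lipschitz continuous.\<close>

definition char_triangle :: "real \<Rightarrow> (real \<times> real) set" where
  "char_triangle b = {(u, v). 0 \<le> u \<and> 0 \<le> v \<and> u + v \<le> b}"

lemma mem_char_triangle [simp]: "(u, v) \<in> char_triangle b \<longleftrightarrow> 0 \<le> u \<and> 0 \<le> v \<and> u + v \<le> b"
  by (simp add: char_triangle_def)

definition lipschitz_triangle :: "real \<Rightarrow> (real \<Rightarrow> real \<Rightarrow> 'a::real_normed_vector) \<Rightarrow> bool" where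
  "lipschitz_triangle b F \<longleftrightarrow> (\<exists>L. \<forall>u v u' v'. (u, v) \<in> char_triangle b \<longrightarrow> (u', v') \<in> char_triangle b \<longrightarrow>
     norm (F u v - F u' v') \<le> L * (\<bar>u - u'\<bar> + \<bar>v - v'\<bar>))"

text \<open>Each derivative is taken along the full segment of the triangle in that direction, hence
  one-sided on the boundary. At (0, b) and (b, 0) one of the segments is a point and imposes no
  condition; in \<open>smooth_triangle\<close> the value there is tied down by the Lipschitz
  continuity of \<open>Fu\<close> and \<open>Fv\<close>.\<close>

definition partials :: "real \<Rightarrow> (real \<Rightarrow> real \<Rightarrow> 'a::real_normed_vector) \<Rightarrow>
    (real \<Rightarrow> real \<Rightarrow> 'a) \<Rightarrow> (real \<Rightarrow> real \<Rightarrow> 'a) \<Rightarrow> bool" where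
  "partials b F Fu Fv \<longleftrightarrow> (\<forall>u v. (u, v) \<in> char_triangle b \<longrightarrow>
     ((\<lambda>a. F a v) has_vector_derivative Fu u v) (at u within {0..b - v}) \<and>
     ((\<lambda>w. F u w) has_vector_derivative Fv u v) (at v within {0..b - u}))"

primrec smooth_triangle :: "nat \<Rightarrow> real \<Rightarrow> (real \<Rightarrow> real \<Rightarrow> 'a::real_normed_vector) \<Rightarrow> bool" where
  "smooth_triangle 0 b F \<longleftrightarrow> lipschitz_triangle b F"
| "smooth_triangle (Suc k) b F \<longleftrightarrow>
     (\<exists>Fu Fv. smooth_triangle k b Fu \<and> smooth_triangle k b Fv \<and> partials b F Fu Fv)"

lemma smooth_triangle_SucI:
  "partials b F Fu Fv \<Longrightarrow> smooth_triangle k b Fu \<Longrightarrow> smooth_triangle k b Fv \<Longrightarrow> smooth_triangle (Suc k) b F"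
  by auto

text \<open>Two points are compared through the corner (u, v'), which lies in the triangle if u <=
  u'. Otherwise the two points exchange roles.\<close>

lemma lipschitz_triangleI:
  assumes u: "\<And>u u' v. (u, v) \<in> char_triangle b \<Longrightarrow> (u', v) \<in> char_triangle b \<Longrightarrow>
      norm (F u v - F u' v) \<le> L * \<bar>u - u'\<bar>"
    and v: "\<And>u v v'. (u, v) \<in> char_triangle b \<Longrightarrow> (u, v') \<in> char_triangle b \<Longrightarrow>
      norm (F u v - F u v') \<le> L' * \<bar>v - v'\<bar>"
  shows "lipschitz_triangle b F"
  unfolding lipschitz_triangle_def
proof (intro exI allI impI)
  fix u v u' v' assume uv: "(u, v) \<in> char_triangle b" and uv': "(u', v') \<in> char_triangle b"
  have *: "norm (F u v - F u' v') \<le> L * \<bar>u - u'\<bar> + L' * \<bar>v - v'\<bar>"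
    if uv: "(u, v) \<in> char_triangle b" and uv': "(u', v') \<in> char_triangle b" and "u \<le> u'" for u v u' v'
  proof -
    have "(u, v') \<in> char_triangle b" using that by auto
    then have "norm (F u v - F u v') + norm (F u v' - F u' v') \<le> L * \<bar>u - u'\<bar> + L' * \<bar>v - v'\<bar>"
      using u[of u v' u'] v[of u v v'] uv uv' by auto
    then show ?thesis using norm_triangle_ineq[of "F u v - F u v'" "F u v' - F u' v'"] by simp
  qed
  have "norm (F u v - F u' v') \<le> L * \<bar>u - u'\<bar> + L' * \<bar>v - v'\<bar>"
    using *[OF uv uv'] *[OF uv' uv] by (cases "u \<le> u'") (auto simp: norm_minus_commute abs_minus_commute)
  also have "\<dots> \<le> max L L' * \<bar>u - u'\<bar> + max L L' * \<bar>v - v'\<bar>"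
    by (intro add_mono mult_right_mono) auto
  finally show "norm (F u v - F u' v') \<le> max L L' * (\<bar>u - u'\<bar> + \<bar>v - v'\<bar>)"
    by (simp add: distrib_left)
qed

lemma lipschitz_triangleE:
  assumes "lipschitz_triangle b F"
  obtains L where "L \<ge> 0" "\<And>u v u' v'. (u, v) \<in> char_triangle b \<Longrightarrow> (u', v') \<in> char_triangle b \<Longrightarrow>
     norm (F u v - F u' v') \<le> L * (\<bar>u - u'\<bar> + \<bar>v - v'\<bar>)"
proof -
  obtain L where L: "(u, v) \<in> char_triangle b \<Longrightarrow> (u', v') \<in> char_triangle b \<Longrightarrow>
     norm (F u v - F u' v') \<le> L * (\<bar>u - u'\<bar> + \<bar>v - v'\<bar>)" for u v u' v'
    using assms unfolding lipschitz_triangle_def by blast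
  show thesis
  proof (rule that[of "max L 0"])
    fix u v u' v' assume "(u, v) \<in> char_triangle b" "(u', v') \<in> char_triangle b"
    then have "norm (F u v - F u' v') \<le> L * (\<bar>u - u'\<bar> + \<bar>v - v'\<bar>)" by (rule L)
    also have "\<dots> \<le> max L 0 * (\<bar>u - u'\<bar> + \<bar>v - v'\<bar>)" by (intro mult_right_mono) auto
    finally show "norm (F u v - F u' v') \<le> max L 0 * (\<bar>u - u'\<bar> + \<bar>v - v'\<bar>)" .
  qed simp
qed

lemma lipschitz_triangle_bounded:
  assumes "lipschitz_triangle b F"
  obtains B where "B \<ge> 0" "\<And>u v. (u, v) \<in> char_triangle b \<Longrightarrow> norm (F u v) \<le> B"
proof -
  obtain L where L: "L \<ge> 0" "\<And>u v u' v'. (u, v) \<in> char_triangle b \<Longrightarrow> (u', v') \<in> char_triangle b \<Longrightarrow>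
     norm (F u v - F u' v') \<le> L * (\<bar>u - u'\<bar> + \<bar>v - v'\<bar>)"
    using lipschitz_triangleE[OF assms] by metis
  show thesis
  proof (rule that[of "norm (F 0 0) + L * \<bar>b\<bar>"])
    fix u v assume uv: "(u, v) \<in> char_triangle b"
    then have "norm (F u v - F 0 0) \<le> L * (\<bar>u - 0\<bar> + \<bar>v - 0\<bar>)" by (intro L) auto
    also have "\<dots> \<le> L * \<bar>b\<bar>" using uv L(1) by (intro mult_left_mono) auto
    finally show "norm (F u v) \<le> norm (F 0 0) + L * \<bar>b\<bar>"
      using norm_triangle_ineq[of "F u v - F 0 0" "F 0 0"] by simp
  qed (use L in simp)
qed

lemma lipschitz_triangle_continuous_on:
  assumes "lipschitz_triangle b F"
  shows "continuous_on (char_triangle b) (\<lambda>(u, v). F u v)"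
proof -
  obtain L where L: "L \<ge> 0" "\<And>u v u' v'. (u, v) \<in> char_triangle b \<Longrightarrow> (u', v') \<in> char_triangle b \<Longrightarrow>
     norm (F u v - F u' v') \<le> L * (\<bar>u - u'\<bar> + \<bar>v - v'\<bar>)"
    using lipschitz_triangleE[OF assms] by metis
  have "(2 * L)-lipschitz_on (char_triangle b) (\<lambda>(u, v). F u v)"
  proof (rule lipschitz_onI)
    fix z z' :: "real \<times> real" assume z: "z \<in> char_triangle b" "z' \<in> char_triangle b"
    obtain u v u' v' where eq: "z = (u, v)" "z' = (u', v')" by (cases z, cases z')
    have "norm (F u v - F u' v') \<le> L * (\<bar>u - u'\<bar> + \<bar>v - v'\<bar>)" using z unfolding eq by (rule L)
    also have "\<dots> \<le> L * (dist z z' + dist z z')"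
      using dist_fst_le[of z z'] dist_snd_le[of z z'] L(1)
      by (intro mult_left_mono add_mono) (auto simp: eq dist_real_def)
    finally show "dist (case z of (u, v) \<Rightarrow> F u v) (case z' of (u, v) \<Rightarrow> F u v) \<le> 2 * L * dist z z'"
      by (simp add: eq dist_norm)
  qed (use L in simp)
  then show ?thesis by (rule lipschitz_on_continuous_on)
qed

lemma norm_diff_le_vector_derivative:
  fixes f :: "real \<Rightarrow> 'a::real_normed_vector"
  assumes "convex S" "\<And>s. s \<in> S \<Longrightarrow> (f has_vector_derivative f' s) (at s within S)"
    "\<And>s. s \<in> S \<Longrightarrow> norm (f' s) \<le> B" "x \<in> S" "y \<in> S"
  shows "norm (f x - f y) \<le> B * \<bar>x - y\<bar>"
proof -
  have "norm (f x - f y) \<le> B * norm (x - y)"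
  proof (rule differentiable_bound[OF assms(1) _ _ assms(4,5)])
    show "(f has_derivative (\<lambda>h. h *\<^sub>R f' s)) (at s within S)" if "s \<in> S" for s
      using assms(2)[OF that] by (simp add: has_vector_derivative_def)
    show "onorm (\<lambda>h. h *\<^sub>R f' s) \<le> B" if "s \<in> S" for s
      using assms(3)[OF that] by (intro onorm_bound) (auto simp: mult.commute[of B] intro: mult_left_mono order_trans[OF norm_ge_zero])
  qed
  then show ?thesis by simp
qed

text \<open>The content is at the bottom level: Lipschitz partial derivatives are bounded on the
  triangle, so the mean value inequality makes the function Lipschitz.\<close>

lemma smooth_triangle_SucD: "smooth_triangle (Suc k) b F \<Longrightarrow> smooth_triangle k b F"
proof (induction k arbitrary: F)
  case 0
  then obtain Fu Fv where F: "lipschitz_triangle b Fu" "lipschitz_triangle b Fv" "partials b F Fu Fv"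
    by auto
  obtain B B' where B: "\<And>u v. (u, v) \<in> char_triangle b \<Longrightarrow> norm (Fu u v) \<le> B"
    and B': "\<And>u v. (u, v) \<in> char_triangle b \<Longrightarrow> norm (Fv u v) \<le> B'"
    using lipschitz_triangle_bounded[OF F(1)] lipschitz_triangle_bounded[OF F(2)] by metis
  have "lipschitz_triangle b F"
  proof (rule lipschitz_triangleI)
    show "norm (F u v - F u' v) \<le> B * \<bar>u - u'\<bar>" if "(u, v) \<in> char_triangle b" "(u', v) \<in> char_triangle b" for u u' v
      by (rule norm_diff_le_vector_derivative[where S = "{0..b - v}" and f' = "\<lambda>s. Fu s v"])
         (use that F(3) B in \<open>auto simp: partials_def\<close>)
    show "norm (F u v - F u v') \<le> B' * \<bar>v - v'\<bar>" if "(u, v) \<in> char_triangle b" "(u, v') \<in> char_triangle b" for u v v'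
      by (rule norm_diff_le_vector_derivative[where S = "{0..b - u}" and f' = "\<lambda>s. Fv u s"])
         (use that F(3) B' in \<open>auto simp: partials_def\<close>)
  qed
  then show ?case by simp
next
  case (Suc k)
  then obtain Fu Fv where
    "smooth_triangle (Suc k) b Fu" "smooth_triangle (Suc k) b Fv" "partials b F Fu Fv"
    unfolding smooth_triangle.simps(2)[of "Suc k"] by blast
  then show ?case using Suc.IH unfolding smooth_triangle.simps(2)[of k] by blast
qed

lemma smooth_triangle_mono: "smooth_triangle k b F \<Longrightarrow> j \<le> k \<Longrightarrow> smooth_triangle j b F"
  by (induction k) (auto simp: le_Suc_eq dest: smooth_triangle_SucD simp del: smooth_triangle.simps(2))

lemma smooth_triangle_lipschitz: "smooth_triangle k b F \<Longrightarrow> lipschitz_triangle b F"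
  using smooth_triangle_mono[of k b F 0] by simp

lemma smooth_triangle_continuous_on: "smooth_triangle k b F \<Longrightarrow> continuous_on (char_triangle b) (\<lambda>(u, v). F u v)"
  by (intro lipschitz_triangle_continuous_on smooth_triangle_lipschitz)

lemma partials_cong:
  assumes "\<And>u v. (u, v) \<in> char_triangle b \<Longrightarrow> F u v = G u v" "partials b F Fu Fv"
  shows "partials b G Fu Fv"
  unfolding partials_def
proof (intro allI impI conjI)
  fix u v assume uv: "(u, v) \<in> char_triangle b"
  show "((\<lambda>a. G a v) has_vector_derivative Fu u v) (at u within {0..b - v})"
    by (rule has_vector_derivative_transform[where f = "\<lambda>a. F a v"])
       (use assms uv in \<open>auto simp: partials_def\<close>)
  show "((\<lambda>w. G u w) has_vector_derivative Fv u v) (at v within {0..b - u})"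
    by (rule has_vector_derivative_transform[where f = "\<lambda>w. F u w"])
       (use assms uv in \<open>auto simp: partials_def\<close>)
qed

lemma smooth_triangle_cong:
  assumes "\<And>u v. (u, v) \<in> char_triangle b \<Longrightarrow> F u v = G u v" "smooth_triangle k b F"
  shows "smooth_triangle k b G"
proof (cases k)
  case 0
  then show ?thesis using assms by (simp add: lipschitz_triangle_def)
next
  case (Suc j)
  then obtain Fu Fv where "smooth_triangle j b Fu" "smooth_triangle j b Fv" "partials b F Fu Fv"
    using assms(2) by auto
  moreover from this(3) have "partials b G Fu Fv" by (rule partials_cong[of b F G, rotated]) (rule assms(1))
  ultimately show ?thesis unfolding Suc smooth_triangle.simps by blast
qed

lemma smooth_triangle_const: "smooth_triangle k b (\<lambda>u v. c)"
proof (induction k arbitrary: c)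
  case 0
  then show ?case by (auto simp: lipschitz_triangle_def intro!: exI[of _ 0])
next
  case (Suc k)
  have "partials b (\<lambda>u v. c) (\<lambda>u v. 0) (\<lambda>u v. 0)" by (simp add: partials_def)
  then show ?case using Suc.IH[of 0] by auto
qed

lemma smooth_triangle_add:
  "smooth_triangle k b F \<Longrightarrow> smooth_triangle k b G \<Longrightarrow> smooth_triangle k b (\<lambda>u v. F u v + G u v)"
proof (induction k arbitrary: F G)
  case 0
  obtain L L' where "\<And>u v u' v'. (u, v) \<in> char_triangle b \<Longrightarrow> (u', v') \<in> char_triangle b \<Longrightarrow>
     norm (F u v - F u' v') \<le> L * (\<bar>u - u'\<bar> + \<bar>v - v'\<bar>)"
    "\<And>u v u' v'. (u, v) \<in> char_triangle b \<Longrightarrow> (u', v') \<in> char_triangle b \<Longrightarrow>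
     norm (G u v - G u' v') \<le> L' * (\<bar>u - u'\<bar> + \<bar>v - v'\<bar>)"
    using 0 unfolding smooth_triangle.simps lipschitz_triangle_def by metis
  then have "norm (F u v + G u v - (F u' v' + G u' v')) \<le> (L + L') * (\<bar>u - u'\<bar> + \<bar>v - v'\<bar>)"
    if "(u, v) \<in> char_triangle b" "(u', v') \<in> char_triangle b" for u v u' v'
    using that norm_triangle_ineq[of "F u v - F u' v'" "G u v - G u' v'"]
    unfolding add_diff_add distrib_right by (meson add_mono order_trans)
  then show ?case unfolding smooth_triangle.simps lipschitz_triangle_def by blast
next
  case (Suc k)
  then obtain Fu Fv Gu Gv where
    *: "smooth_triangle k b Fu" "smooth_triangle k b Fv" "partials b F Fu Fv"
       "smooth_triangle k b Gu" "smooth_triangle k b Gv" "partials b G Gu Gv"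
    unfolding smooth_triangle.simps by blast
  have "partials b (\<lambda>u v. F u v + G u v) (\<lambda>u v. Fu u v + Gu u v) (\<lambda>u v. Fv u v + Gv u v)"
    using *(3,6) unfolding partials_def by (auto intro!: has_vector_derivative_add simp del: mem_char_triangle)
  then show ?case
    by (rule smooth_triangle_SucI) (intro Suc.IH *)+
qed

lemma smooth_triangle_scaleR: "smooth_triangle k b F \<Longrightarrow> smooth_triangle k b (\<lambda>u v. r *\<^sub>R F u v)"
proof (induction k arbitrary: F)
  case 0
  then obtain L where "\<And>u v u' v'. (u, v) \<in> char_triangle b \<Longrightarrow> (u', v') \<in> char_triangle b \<Longrightarrow>
     norm (F u v - F u' v') \<le> L * (\<bar>u - u'\<bar> + \<bar>v - v'\<bar>)"
    unfolding smooth_triangle.simps lipschitz_triangle_def by blast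
  then have "norm (r *\<^sub>R F u v - r *\<^sub>R F u' v') \<le> (\<bar>r\<bar> * L) * (\<bar>u - u'\<bar> + \<bar>v - v'\<bar>)"
    if "(u, v) \<in> char_triangle b" "(u', v') \<in> char_triangle b" for u v u' v'
    using that unfolding scaleR_right_diff_distrib[symmetric] norm_scaleR mult.assoc
    by (blast intro: mult_left_mono abs_ge_zero)
  then show ?case unfolding smooth_triangle.simps lipschitz_triangle_def by blast
next
  case (Suc k)
  then obtain Fu Fv where *: "smooth_triangle k b Fu" "smooth_triangle k b Fv" "partials b F Fu Fv"
    unfolding smooth_triangle.simps by blast
  have "partials b (\<lambda>u v. r *\<^sub>R F u v) (\<lambda>u v. r *\<^sub>R Fu u v) (\<lambda>u v. r *\<^sub>R Fv u v)"
    using *(3) unfolding partials_def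
    by (auto intro!: bounded_linear.has_vector_derivative[OF bounded_linear_scaleR_right] simp del: mem_char_triangle)
  then show ?case
    by (rule smooth_triangle_SucI) (intro Suc.IH *)+
qed

lemma smooth_triangle_mult:
  fixes F G :: "real \<Rightarrow> real \<Rightarrow> 'a::real_normed_algebra"
  shows "smooth_triangle k b F \<Longrightarrow> smooth_triangle k b G \<Longrightarrow> smooth_triangle k b (\<lambda>u v. F u v * G u v)"
proof (induction k arbitrary: F G)
  case 0
  then have lip: "lipschitz_triangle b F" "lipschitz_triangle b G" by simp_all
  obtain L where L: "\<And>u v u' v'. (u, v) \<in> char_triangle b \<Longrightarrow> (u', v') \<in> char_triangle b \<Longrightarrow>
     norm (F u v - F u' v') \<le> L * (\<bar>u - u'\<bar> + \<bar>v - v'\<bar>)" "0 \<le> L"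
    using lipschitz_triangleE[OF lip(1)] by metis
  obtain L' where L': "\<And>u v u' v'. (u, v) \<in> char_triangle b \<Longrightarrow> (u', v') \<in> char_triangle b \<Longrightarrow>
     norm (G u v - G u' v') \<le> L' * (\<bar>u - u'\<bar> + \<bar>v - v'\<bar>)" "0 \<le> L'"
    using lipschitz_triangleE[OF lip(2)] by metis
  obtain B where B: "\<And>u v. (u, v) \<in> char_triangle b \<Longrightarrow> norm (F u v) \<le> B" "0 \<le> B"
    using lipschitz_triangle_bounded[OF lip(1)] by metis
  obtain B' where B': "\<And>u v. (u, v) \<in> char_triangle b \<Longrightarrow> norm (G u v) \<le> B'" "0 \<le> B'"
    using lipschitz_triangle_bounded[OF lip(2)] by metis
  have "norm (F u v * G u v - F u' v' * G u' v') \<le> (L * B' + B * L') * (\<bar>u - u'\<bar> + \<bar>v - v'\<bar>)"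
    if uv: "(u, v) \<in> char_triangle b" "(u', v') \<in> char_triangle b" for u v u' v'
  proof -
    let ?d = "\<bar>u - u'\<bar> + \<bar>v - v'\<bar>"
    have "F u v * G u v - F u' v' * G u' v' = (F u v - F u' v') * G u v + F u' v' * (G u v - G u' v')"
      by (simp add: algebra_simps)
    also have "norm \<dots> \<le> norm (F u v - F u' v') * norm (G u v) + norm (F u' v') * norm (G u v - G u' v')"
      by (intro order_trans[OF norm_triangle_ineq] add_mono norm_mult_ineq)
    also have "\<dots> \<le> (L * ?d) * B' + B * (L' * ?d)"
      using L L' B B' uv by (intro add_mono mult_mono) auto
    finally show ?thesis by (simp add: algebra_simps)
  qed
  then show ?case unfolding smooth_triangle.simps lipschitz_triangle_def by blast
next
  case (Suc k)
  then obtain Fu Fv Gu Gv where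
    *: "smooth_triangle k b Fu" "smooth_triangle k b Fv" "partials b F Fu Fv"
       "smooth_triangle k b Gu" "smooth_triangle k b Gv" "partials b G Gu Gv"
    unfolding smooth_triangle.simps by blast
  have FG: "smooth_triangle k b F" "smooth_triangle k b G"
    using Suc.prems by (blast dest: smooth_triangle_SucD)+
  have "partials b (\<lambda>u v. F u v * G u v) (\<lambda>u v. F u v * Gu u v + Fu u v * G u v)
      (\<lambda>u v. F u v * Gv u v + Fv u v * G u v)"
    using *(3,6) unfolding partials_def by (auto intro!: has_vector_derivative_mult simp del: mem_char_triangle)
  then show ?case
    by (rule smooth_triangle_SucI) (intro smooth_triangle_add Suc.IH * FG)+
qed

lemma partials_swap: "partials b F Fu Fv \<Longrightarrow> partials b (\<lambda>u v. F v u) (\<lambda>u v. Fv v u) (\<lambda>u v. Fu v u)"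
  by (simp add: partials_def add.commute)

lemma smooth_triangle_swap: "smooth_triangle k b F \<Longrightarrow> smooth_triangle k b (\<lambda>u v. F v u)"
proof (induction k arbitrary: F)
  case 0
  then show ?case
    by (simp add: lipschitz_triangle_def add.commute) (metis add.commute)
next
  case (Suc k)
  then obtain Fu Fv where *: "smooth_triangle k b Fu" "smooth_triangle k b Fv" "partials b F Fu Fv"
    unfolding smooth_triangle.simps by blast
  show ?case
    by (rule smooth_triangle_SucI[OF partials_swap[OF *(3)] Suc.IH[OF *(2)] Suc.IH[OF *(1)]])
qed

section \<open>Integral operators on the triangle\<close>

definition integral_snd :: "(real \<Rightarrow> real \<Rightarrow> 'a::banach) \<Rightarrow> real \<Rightarrow> real \<Rightarrow> 'a" where
  "integral_snd F u v = integral {0..v} (F u)"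

definition integral_fst :: "(real \<Rightarrow> real \<Rightarrow> 'a::banach) \<Rightarrow> real \<Rightarrow> real \<Rightarrow> 'a" where
  "integral_fst F u v = integral {0..u} (\<lambda>a. F a v)"

text \<open>Reflection in the diagonal maps the triangle to itself, so facts about one operator
  carry over to the other.\<close>

lemma integral_fst_conv_snd: "integral_fst F = (\<lambda>u v. integral_snd (\<lambda>u v. F v u) v u)"
  by (simp add: integral_fst_def integral_snd_def fun_eq_iff)

lemma continuous_on_triangle_snd:
  assumes "continuous_on (char_triangle b) (\<lambda>(u, v). F u v)" "0 \<le> u" "u + r \<le> b"
  shows "continuous_on {0..r} (F u)"
proof -
  have "continuous_on {0..r} (\<lambda>v. case (u, v) of (u, v) \<Rightarrow> F u v)"
    by (rule continuous_on_compose2[OF assms(1)]) (use assms(2,3) in \<open>auto intro!: continuous_intros\<close>)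
  then show ?thesis by simp
qed

lemma integral_snd_has_derivative_snd:
  assumes "continuous_on (char_triangle b) (\<lambda>(u, v). F u v)" "(u, v) \<in> char_triangle b"
  shows "((\<lambda>w. integral_snd F u w) has_vector_derivative F u v) (at v within {0..b - u})"
  unfolding integral_snd_def using assms(2)
  by (intro integral_has_vector_derivative continuous_on_triangle_snd[OF assms(1)]) auto

text \<open>Differentiation under the integral takes place on a rectangle, and for fixed v the
  rectangle {0..b - v} x {0..v} fits into the triangle.\<close>

lemma integral_snd_has_derivative_fst:
  assumes F: "continuous_on (char_triangle b) (\<lambda>(u, v). F u v)"
    and Fu: "continuous_on (char_triangle b) (\<lambda>(u, v). Fu u v)"
    and d: "\<And>u v. (u, v) \<in> char_triangle b \<Longrightarrow> ((\<lambda>a. F a v) has_vector_derivative Fu u v) (at u within {0..b - v})"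
    and uv: "(u, v) \<in> char_triangle b"
  shows "((\<lambda>a. integral_snd F a v) has_vector_derivative integral_snd Fu u v) (at u within {0..b - v})"
  unfolding integral_snd_def cbox_interval[symmetric]
proof (rule leibniz_rule_vector_derivative)
  show "((\<lambda>a. F a t) has_vector_derivative Fu a t) (at a within cbox 0 (b - v))"
    if "a \<in> cbox 0 (b - v)" "t \<in> cbox 0 v" for a t
    using that uv by (intro has_vector_derivative_within_subset[OF d]) auto
  show "F a integrable_on cbox 0 v" if "a \<in> cbox 0 (b - v)" for a
    using that uv unfolding cbox_interval
    by (intro integrable_continuous_real continuous_on_triangle_snd[OF F]) auto
  show "continuous_on (cbox 0 (b - v) \<times> cbox 0 v) (\<lambda>(a, t). Fu a t)"
    using uv by (intro continuous_on_subset[OF Fu]) auto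
qed (use uv in auto)

text \<open>The partial derivatives of the integral are the integral of \<open>Fu\<close> and
  \<open>F\<close> itself, so the order does not drop. In general it does not rise either, because
  nothing is smoothed in the first variable.\<close>

lemma smooth_triangle_integral_snd:
  "smooth_triangle k b F \<Longrightarrow> smooth_triangle k b (integral_snd F)"
proof (induction k arbitrary: F)
  case 0
  then have lip: "lipschitz_triangle b F" by simp
  note cont = continuous_on_triangle_snd[OF lipschitz_triangle_continuous_on[OF lip]]
  obtain L where L: "\<And>u v u' v'. (u, v) \<in> char_triangle b \<Longrightarrow> (u', v') \<in> char_triangle b \<Longrightarrow>
     norm (F u v - F u' v') \<le> L * (\<bar>u - u'\<bar> + \<bar>v - v'\<bar>)" "0 \<le> L"
    using lipschitz_triangleE[OF lip] by metis
  obtain B where B: "\<And>u v. (u, v) \<in> char_triangle b \<Longrightarrow> norm (F u v) \<le> B" "0 \<le> B"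
    using lipschitz_triangle_bounded[OF lip] by metis
  have "lipschitz_triangle b (integral_snd F)"
  proof (rule lipschitz_triangleI)
    show "norm (integral_snd F u v - integral_snd F u v') \<le> B * \<bar>v - v'\<bar>"
      if "(u, v) \<in> char_triangle b" "(u, v') \<in> char_triangle b" for u v v'
      by (rule norm_diff_le_vector_derivative[where S = "{0..b - u}" and f' = "\<lambda>s. F u s"])
         (use that B in \<open>auto intro!: integral_snd_has_derivative_snd lipschitz_triangle_continuous_on[OF lip]\<close>)
    show "norm (integral_snd F u v - integral_snd F u' v) \<le> (L * \<bar>b\<bar>) * \<bar>u - u'\<bar>"
      if uv: "(u, v) \<in> char_triangle b" "(u', v) \<in> char_triangle b" for u u' v
    proof -
      have int: "F u integrable_on {0..v}" "F u' integrable_on {0..v}"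
        using uv by (auto intro!: integrable_continuous_real cont)
      have "norm (integral {0..v} (\<lambda>s. F u s - F u' s)) \<le> (L * \<bar>u - u'\<bar>) * (v - 0)"
        using uv
      proof (intro integral_bound continuous_intros cont)
        fix s assume "s \<in> {0..v}"
        then show "norm (F u s - F u' s) \<le> L * \<bar>u - u'\<bar>" using L(1)[of u s u' s] uv by auto
      qed auto
      also have "\<dots> \<le> (L * \<bar>u - u'\<bar>) * \<bar>b\<bar>"
        using uv L(2) by (intro mult_left_mono) auto
      finally show ?thesis
        by (simp add: integral_snd_def Henstock_Kurzweil_Integration.integral_diff[OF int] mult_ac)
    qed
  qed
  then show ?case by simp
next
  case (Suc k)
  then obtain Fu Fv where *: "smooth_triangle k b Fu" "smooth_triangle k b Fv" "partials b F Fu Fv"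
    unfolding smooth_triangle.simps by blast
  have F: "smooth_triangle k b F" using Suc.prems by (blast dest: smooth_triangle_SucD)
  have "partials b (integral_snd F) (integral_snd Fu) F"
    unfolding partials_def using *(3)
    by (auto simp: partials_def simp del: mem_char_triangle intro!: integral_snd_has_derivative_snd integral_snd_has_derivative_fst
        smooth_triangle_continuous_on[OF F] smooth_triangle_continuous_on[OF *(1)])
  then show ?case by (rule smooth_triangle_SucI) (intro Suc.IH * F)+
qed

lemma smooth_triangle_integral_fst:
  "smooth_triangle k b F \<Longrightarrow> smooth_triangle k b (integral_fst F)"
  unfolding integral_fst_conv_snd by (rule smooth_triangle_swap[OF smooth_triangle_integral_snd[OF smooth_triangle_swap]])

lemma continuous_on_triangle_swap:
  assumes "continuous_on (char_triangle b) (\<lambda>(u, v). F u v)"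
  shows "continuous_on (char_triangle b) (\<lambda>(u, v). F v u)"
proof -
  have "continuous_on (char_triangle b) (\<lambda>z. case prod.swap z of (u, v) \<Rightarrow> F u v)"
    by (rule continuous_on_compose2[OF assms]) (auto intro!: continuous_intros simp: prod.swap_def)
  then show ?thesis by (simp add: case_prod_unfold)
qed

text \<open>The gain of one order happens here: both partial derivatives of the double integral are
  single integrals of \<open>W\<close>, and no derivative of \<open>W\<close> occurs in
  them.\<close>

lemma partials_integral_fst_snd:
  assumes W: "smooth_triangle k b W"
  shows "partials b (integral_fst (integral_snd W)) (integral_snd W) (integral_fst W)"
proof -
  let ?G = "\<lambda>u v. integral_snd W v u"
  have G: "smooth_triangle k b ?G" by (rule smooth_triangle_swap[OF smooth_triangle_integral_snd[OF W]])
  note Gc = smooth_triangle_continuous_on[OF G]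
  note Wc = smooth_triangle_continuous_on[OF W]
  have "partials b (integral_snd ?G) (integral_snd (\<lambda>u v. W v u)) ?G"
    unfolding partials_def
  proof (intro allI impI conjI)
    fix u v assume uv: "(u, v) \<in> char_triangle b"
    show "((\<lambda>w. integral_snd ?G u w) has_vector_derivative ?G u v) (at v within {0..b - u})"
      by (rule integral_snd_has_derivative_snd[OF Gc uv])
    show "((\<lambda>a. integral_snd ?G a v) has_vector_derivative integral_snd (\<lambda>u v. W v u) u v) (at u within {0..b - v})"
      by (rule integral_snd_has_derivative_fst[OF Gc continuous_on_triangle_swap[OF Wc] _ uv])
         (auto intro!: integral_snd_has_derivative_snd[OF Wc])
  qed
  then show ?thesis unfolding integral_fst_conv_snd by (rule partials_swap)
qed

text \<open>The increment is split at the corner of a path parallel to the axes, and the partial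
  derivatives are frozen at (u0, v0) on both legs. Near the hypotenuse one of the two possible
  corners may lie outside the triangle, so (u, v0) is taken if u <= u0 and (u0, v)
  otherwise.\<close>

lemma partials_has_derivative:
  assumes F: "partials b F Fu Fv"
    and Fu: "continuous_on (char_triangle b) (\<lambda>(u, v). Fu u v)"
    and Fv: "continuous_on (char_triangle b) (\<lambda>(u, v). Fv u v)"
    and uv0: "(u0, v0) \<in> char_triangle b"
  shows "((\<lambda>(u, v). F u v) has_derivative (\<lambda>(x, y). x *\<^sub>R Fu u0 v0 + y *\<^sub>R Fv u0 v0))
    (at (u0, v0) within char_triangle b)"
  unfolding has_derivative_within_alt
proof (intro conjI allI impI)
  show "bounded_linear (\<lambda>(x, y). x *\<^sub>R Fu u0 v0 + y *\<^sub>R Fv u0 v0)"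
    unfolding case_prod_unfold
    by (intro bounded_linear_add bounded_linear_compose[OF bounded_linear_scaleR_left bounded_linear_fst]
        bounded_linear_compose[OF bounded_linear_scaleR_left bounded_linear_snd])
  fix e :: real assume "0 < e"
  obtain d1 where d1: "d1 > 0" "\<forall>z\<in>char_triangle b. dist z (u0, v0) < d1 \<longrightarrow>
      dist (case z of (u, v) \<Rightarrow> Fu u v) (case (u0, v0) of (u, v) \<Rightarrow> Fu u v) < e / 2"
    using Fu[unfolded continuous_on_iff] uv0 half_gt_zero[OF \<open>0 < e\<close>] by blast
  obtain d2 where d2: "d2 > 0" "\<forall>z\<in>char_triangle b. dist z (u0, v0) < d2 \<longrightarrow>
      dist (case z of (u, v) \<Rightarrow> Fv u v) (case (u0, v0) of (u, v) \<Rightarrow> Fv u v) < e / 2"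
    using Fv[unfolded continuous_on_iff] uv0 half_gt_zero[OF \<open>0 < e\<close>] by blast
  \<comment> \<open>The mean value inequality for f minus the linear function of slope D.\<close>
  have seg: "norm (f y - f x - (y - x) *\<^sub>R D) \<le> e / 2 * \<bar>y - x\<bar>"
    if f: "\<And>s. s \<in> closed_segment x y \<Longrightarrow> (f has_vector_derivative f' s) (at s within closed_segment x y)"
      and f': "\<And>s. s \<in> closed_segment x y \<Longrightarrow> norm (f' s - D) \<le> e / 2" for f f' :: "real \<Rightarrow> 'a" and x y :: real and D
  proof -
    have "norm ((f y - y *\<^sub>R D) - (f x - x *\<^sub>R D)) \<le> e / 2 * \<bar>y - x\<bar>"
    proof (rule norm_diff_le_vector_derivative[where S = "closed_segment x y" and f' = "\<lambda>s. f' s - D"])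
      show "((\<lambda>s. f s - s *\<^sub>R D) has_vector_derivative f' s - D) (at s within closed_segment x y)"
        if "s \<in> closed_segment x y" for s
      proof (rule has_vector_derivative_diff[OF f[OF that]])
        show "((\<lambda>s. s *\<^sub>R D) has_vector_derivative D) (at s within closed_segment x y)"
          by (simp add: has_vector_derivative_def bounded_linear_imp_has_derivative bounded_linear_scaleR_left)
      qed
    qed (use f' in auto)
    then show ?thesis by (simp add: algebra_simps)
  qed
  have seg_dist: "dist (u, v) (u0, v0) \<le> norm ((u1, v1) - (u0, v0))"
    if "u \<in> closed_segment u0 u1" "v \<in> closed_segment v0 v1" for u v u1 v1
  proof -
    have "\<bar>u - u0\<bar> \<le> \<bar>u1 - u0\<bar>" "\<bar>v - v0\<bar> \<le> \<bar>v1 - v0\<bar>"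
      using that by (auto simp: closed_segment_eq_real_ivl split: if_splits)
    then show ?thesis
      by (auto simp: dist_Pair_Pair dist_real_def norm_Pair abs_le_square_iff intro!: real_sqrt_le_mono add_mono)
  qed
  have horiz: "norm (F u1 v - F u0 v - (u1 - u0) *\<^sub>R Fu u0 v0) \<le> e / 2 * \<bar>u1 - u0\<bar>"
    if "(u1, v) \<in> char_triangle b" "(u0, v) \<in> char_triangle b" "v \<in> closed_segment v0 v1" "norm ((u1, v1) - (u0, v0)) < d1" for u1 v1 v
  proof (rule seg)
    fix s assume s: "s \<in> closed_segment u0 u1"
    then have sT: "(s, v) \<in> char_triangle b"
      using that by (auto simp: closed_segment_eq_real_ivl split: if_splits)
    have sub: "closed_segment u0 u1 \<subseteq> {0..b - v}"
      using that by (auto simp: closed_segment_eq_real_ivl split: if_splits)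
    show "((\<lambda>a. F a v) has_vector_derivative Fu s v) (at s within closed_segment u0 u1)"
      using F sT sub unfolding partials_def by (blast intro: has_vector_derivative_within_subset)
    show "norm (Fu s v - Fu u0 v0) \<le> e / 2"
      using d1(2)[rule_format, OF sT] seg_dist[OF s that(3)] that(4) by (simp add: dist_norm)
  qed
  have vert: "norm (F u v1 - F u v0 - (v1 - v0) *\<^sub>R Fv u0 v0) \<le> e / 2 * \<bar>v1 - v0\<bar>"
    if "(u, v1) \<in> char_triangle b" "(u, v0) \<in> char_triangle b" "u \<in> closed_segment u0 u1" "norm ((u1, v1) - (u0, v0)) < d2" for u u1 v1
  proof (rule seg)
    fix s assume s: "s \<in> closed_segment v0 v1"
    then have sT: "(u, s) \<in> char_triangle b"
      using that by (auto simp: closed_segment_eq_real_ivl split: if_splits)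
    have sub: "closed_segment v0 v1 \<subseteq> {0..b - u}"
      using that by (auto simp: closed_segment_eq_real_ivl split: if_splits)
    show "((\<lambda>a. F u a) has_vector_derivative Fv u s) (at s within closed_segment v0 v1)"
      using F sT sub unfolding partials_def by (blast intro: has_vector_derivative_within_subset)
    show "norm (Fv u s - Fv u0 v0) \<le> e / 2"
      using d2(2)[rule_format, OF sT] seg_dist[OF that(3) s] that(4) by (simp add: dist_norm)
  qed
  show "\<exists>d>0. \<forall>z\<in>char_triangle b. norm (z - (u0, v0)) < d \<longrightarrow>
      norm ((case z of (u, v) \<Rightarrow> F u v) - (case (u0, v0) of (u, v) \<Rightarrow> F u v) -
        (case z - (u0, v0) of (x, y) \<Rightarrow> x *\<^sub>R Fu u0 v0 + y *\<^sub>R Fv u0 v0)) \<le> e * norm (z - (u0, v0))"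
  proof (intro exI[of _ "min d1 d2"] conjI ballI impI)
    fix z assume zT: "z \<in> char_triangle b" and zd: "norm (z - (u0, v0)) < min d1 d2"
    obtain u v where z: "z = (u, v)" by (cases z)
    have uvT: "(u, v) \<in> char_triangle b" using zT z by simp
    have nd: "norm ((u, v) - (u0, v0)) < d1" "norm ((u, v) - (u0, v0)) < d2" using zd z by auto
    let ?R = "F u v - F u0 v0 - ((u - u0) *\<^sub>R Fu u0 v0 + (v - v0) *\<^sub>R Fv u0 v0)"
    have "norm ?R \<le> e / 2 * \<bar>u - u0\<bar> + e / 2 * \<bar>v - v0\<bar>"
    proof (cases "u \<le> u0")
      case True
      then have T: "(u, v0) \<in> char_triangle b" using uv0 uvT by auto
      have "norm (F u v0 - F u0 v0 - (u - u0) *\<^sub>R Fu u0 v0) \<le> e / 2 * \<bar>u - u0\<bar>"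
        by (rule horiz[OF T uv0 _ nd(1)]) simp
      moreover have "norm (F u v - F u v0 - (v - v0) *\<^sub>R Fv u0 v0) \<le> e / 2 * \<bar>v - v0\<bar>"
        by (rule vert[OF uvT T _ nd(2)]) simp
      ultimately show ?thesis
        using norm_triangle_ineq[of "F u v0 - F u0 v0 - (u - u0) *\<^sub>R Fu u0 v0" "F u v - F u v0 - (v - v0) *\<^sub>R Fv u0 v0"]
        by (simp add: algebra_simps)
    next
      case False
      then have T: "(u0, v) \<in> char_triangle b" using uv0 uvT by auto
      have "norm (F u v - F u0 v - (u - u0) *\<^sub>R Fu u0 v0) \<le> e / 2 * \<bar>u - u0\<bar>"
        by (rule horiz[OF uvT T _ nd(1)]) simp
      moreover have "norm (F u0 v - F u0 v0 - (v - v0) *\<^sub>R Fv u0 v0) \<le> e / 2 * \<bar>v - v0\<bar>"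
        by (rule vert[OF T uv0 _ nd(2)]) simp
      ultimately show ?thesis
        using norm_triangle_ineq[of "F u v - F u0 v - (u - u0) *\<^sub>R Fu u0 v0" "F u0 v - F u0 v0 - (v - v0) *\<^sub>R Fv u0 v0"]
        by (simp add: algebra_simps)
    qed
    also have "\<dots> \<le> e / 2 * norm (z - (u0, v0)) + e / 2 * norm (z - (u0, v0))"
      using norm_fst_le[of "u - u0" "v - v0"] norm_snd_le[of "v - v0" "u - u0"] \<open>0 < e\<close> z
      by (intro add_mono mult_left_mono) auto
    finally show "norm ((case z of (u, v) \<Rightarrow> F u v) - (case (u0, v0) of (u, v) \<Rightarrow> F u v) -
        (case z - (u0, v0) of (x, y) \<Rightarrow> x *\<^sub>R Fu u0 v0 + y *\<^sub>R Fv u0 v0)) \<le> e * norm (z - (u0, v0))"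
      by (simp add: z)
  qed (use d1 d2 in auto)
qed

subsection \<open>Decay of Legendre moments\<close>

text \<open>Applied to two families of lines: for fixed x the derivative in t is (Fu - Fv) / 2, for
  fixed t the derivative in x is (Fu + Fv) / 2.\<close>

lemma partials_has_vector_derivative_curve:
  assumes F: "partials b F Fu Fv"
    and Fu: "continuous_on (char_triangle b) (\<lambda>(u, v). Fu u v)"
    and Fv: "continuous_on (char_triangle b) (\<lambda>(u, v). Fv u v)"
    and t: "t \<in> S" and S: "\<And>t. t \<in> S \<Longrightarrow> (g1 t, g2 t) \<in> char_triangle b"
    and g: "(g1 has_real_derivative a1) (at t within S)" "(g2 has_real_derivative a2) (at t within S)"
  shows "((\<lambda>t. F (g1 t) (g2 t)) has_vector_derivative a1 *\<^sub>R Fu (g1 t) (g2 t) + a2 *\<^sub>R Fv (g1 t) (g2 t)) (at t within S)"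
proof -
  have "((\<lambda>t. case (g1 t, g2 t) of (u, v) \<Rightarrow> F u v) has_derivative
      (\<lambda>h. case (a1 * h, a2 * h) of (x, y) \<Rightarrow> x *\<^sub>R Fu (g1 t) (g2 t) + y *\<^sub>R Fv (g1 t) (g2 t))) (at t within S)"
  proof (rule has_derivative_in_compose[where g = "\<lambda>(u, v). F u v"])
    show "((\<lambda>t. (g1 t, g2 t)) has_derivative (\<lambda>h. (a1 * h, a2 * h))) (at t within S)"
      using g by (intro has_derivative_Pair) (auto simp: has_field_derivative_def)
    show "((\<lambda>(u, v). F u v) has_derivative (\<lambda>(x, y). x *\<^sub>R Fu (g1 t) (g2 t) + y *\<^sub>R Fv (g1 t) (g2 t)))
        (at (g1 t, g2 t) within (\<lambda>t. (g1 t, g2 t)) ` S)"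
      using S t by (intro has_derivative_subset[OF partials_has_derivative[OF F Fu Fv]]) auto
  qed
  then show ?thesis
    by (simp add: has_vector_derivative_def algebra_simps)
qed

definition on_cross_section :: "(real \<Rightarrow> real \<Rightarrow> 'a) \<Rightarrow> real \<Rightarrow> real \<Rightarrow> 'a" where
  "on_cross_section F x t = F ((x + t) / 2) ((x - t) / 2)"

lemma cross_section_in_triangle: "x \<le> b \<Longrightarrow> \<bar>t\<bar> \<le> x \<Longrightarrow> ((x + t) / 2, (x - t) / 2) \<in> char_triangle b"
  by (auto simp flip: add_divide_distrib)

text \<open>For N = n + 1 the recursion involves the moment of index n, whose bound has n + 1 in
  place of N + 1 = n + 2. As n + 2 <= 2 (n + 1), the exchange costs a factor depending on k alone;
  the square root is charged sqrt 4 so that the factor is a power of 2.\<close>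

lemma decay_step:
  "(real n + 2) ^ Suc k * sqrt (real n + 2) \<le> 2 ^ (k + 2) * ((real n + 1) ^ Suc k * sqrt (real n + 1))"
proof -
  have "(real n + 2) ^ Suc k * sqrt (real n + 2) \<le> (2 * (real n + 1)) ^ Suc k * sqrt (4 * (real n + 1))"
    by (intro mult_mono power_mono real_sqrt_le_mono) auto
  also have "\<dots> = 2 ^ (k + 2) * ((real n + 1) ^ Suc k * sqrt (real n + 1))"
    by (simp only: real_sqrt_mult power_mult_distrib) (simp add: algebra_simps)
  finally show ?thesis .
qed

text \<open>The primitive of P_(n+1) supplies x / (2 n + 3) and the difference of P_(n+2) and P_n.
  Each of these two has mean size at most 4 x / sqrt (n + 2), whence 8 = 4 + 4.\<close>

lemma legendre_moment_lipschitz: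
  fixes f :: "real \<Rightarrow> 'a::euclidean_space"
  assumes "x > 0" "L \<ge> 0"
    and lip: "\<And>s t. s \<in> {-x..x} \<Longrightarrow> t \<in> {-x..x} \<Longrightarrow> norm (f s - f t) \<le> L * \<bar>s - t\<bar>"
  shows "norm (legendre_moment x (n + 1) f) \<le> 8 * L * x\<^sup>2 / ((real n + 2) * sqrt (real n + 2))"
proof -
  let ?P = "\<lambda>m t. poly (legendre_poly m) (t / x)"
  have bound: "integral {-x..x} (\<lambda>t. \<bar>?P m t\<bar>) \<le> 4 * x / sqrt (real n + 2)" if "n \<le> m" for m
  proof -
    have "integral {-x..x} (\<lambda>t. \<bar>?P m t\<bar>) \<le> 2 * x / sqrt (2 * real m + 1)"
      by (rule integral_abs_legendre_poly_le[OF \<open>x > 0\<close>])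
    also have "\<dots> \<le> 2 * x / (sqrt (real n + 2) / 2)"
    proof (rule divide_left_mono)
      have "sqrt (real n + 2) \<le> sqrt (4 * (2 * real m + 1))"
        using that by (intro real_sqrt_le_mono) auto
      then show "sqrt (real n + 2) / 2 \<le> sqrt (2 * real m + 1)" unfolding real_sqrt_mult by simp
    qed (use \<open>x > 0\<close> in auto)
    finally show ?thesis by simp
  qed
  have "norm (legendre_moment x (n + 1) f) \<le> L * integral {-x..x} (\<lambda>t. \<bar>legendre_primitive n x t\<bar>)"
    unfolding legendre_moment_def
    using assms legendre_primitive_ends[OF \<open>x > 0\<close>]
    by (intro norm_integral_derivative_scaleR_lipschitz legendre_primitive_has_derivative)
       (auto intro!: continuous_intros)
  moreover have "integral {-x..x} (\<lambda>t. \<bar>legendre_primitive n x t\<bar>) \<le> 8 * x\<^sup>2 / ((real n + 2) * sqrt (real n + 2))"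
  proof -
    have "integral {-x..x} (\<lambda>t. \<bar>legendre_primitive n x t\<bar>)
        \<le> integral {-x..x} (\<lambda>t. x / (2 * real n + 3) * (\<bar>?P (n + 2) t\<bar> + \<bar>?P n t\<bar>))"
    proof (rule integral_le)
      show "\<bar>legendre_primitive n x t\<bar> \<le> x / (2 * real n + 3) * (\<bar>?P (n + 2) t\<bar> + \<bar>?P n t\<bar>)" for t
        using \<open>x > 0\<close> abs_triangle_ineq4
        by (auto simp: legendre_primitive_def abs_mult intro!: mult_left_mono divide_right_mono)
    qed (auto intro!: integrable_continuous_real continuous_intros simp: legendre_primitive_def)
    also have "\<dots> = x / (2 * real n + 3) * (integral {-x..x} (\<lambda>t. \<bar>?P (n + 2) t\<bar>) + integral {-x..x} (\<lambda>t. \<bar>?P n t\<bar>))"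
    proof -
      have "(\<lambda>t. \<bar>?P m t\<bar>) integrable_on {-x..x}" for m
        by (intro integrable_continuous_real continuous_intros)
      then show ?thesis by (simp only: integral_mult_right integral_add)
    qed
    also have "\<dots> \<le> x / (real n + 2) * (4 * x / sqrt (real n + 2) + 4 * x / sqrt (real n + 2))"
      using \<open>x > 0\<close> bound
      by (intro mult_mono add_mono divide_left_mono add_nonneg_nonneg integral_nonneg)
         (auto intro!: integrable_continuous_real continuous_intros)
    finally show ?thesis by (simp add: power2_eq_square field_simps)
  qed
  ultimately have "norm (legendre_moment x (n + 1) f) \<le> L * (8 * x\<^sup>2 / ((real n + 2) * sqrt (real n + 2)))"
    using \<open>L \<ge> 0\<close> by (meson mult_left_mono order_trans)
  then show ?thesis by (simp add: mult_ac)
qed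

text \<open>The condition N >= k + 1 keeps the index at least 1 through k integrations by parts,
  each of which may lower it by one; the final Lipschitz estimate is for indices from 1 on.\<close>

lemma legendre_moment_smooth_triangle:
  fixes F :: "real \<Rightarrow> real \<Rightarrow> 'a::euclidean_space"
  assumes "smooth_triangle k b F"
  shows "\<exists>C\<ge>0. \<forall>x\<in>{0<..b}. \<forall>N\<ge>k + 1. norm (legendre_moment x N (on_cross_section F x))
    \<le> C * x ^ (k + 2) / ((real N + 1) ^ Suc k * sqrt (real N + 1))"
  using assms
proof (induction k arbitrary: F)
  case 0
  then obtain L where L: "L \<ge> 0" "\<And>u v u' v'. (u, v) \<in> char_triangle b \<Longrightarrow> (u', v') \<in> char_triangle b \<Longrightarrow>
     norm (F u v - F u' v') \<le> L * (\<bar>u - u'\<bar> + \<bar>v - v'\<bar>)"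
    using lipschitz_triangleE[of b F] by auto
  have "norm (legendre_moment x N (on_cross_section F x))
      \<le> 8 * L * x ^ (0 + 2) / ((real N + 1) ^ Suc 0 * sqrt (real N + 1))"
    if x: "x \<in> {0<..b}" and N: "0 + 1 \<le> N" for x N
  proof -
    obtain n where n: "N = n + 1" using N by (cases N) auto
    have "norm (legendre_moment x (n + 1) (on_cross_section F x)) \<le> 8 * L * x\<^sup>2 / ((real n + 2) * sqrt (real n + 2))"
    proof (rule legendre_moment_lipschitz)
      fix s t assume st: "s \<in> {-x..x}" "t \<in> {-x..x}"
      have "norm (on_cross_section F x s - on_cross_section F x t)
          \<le> L * (\<bar>(x + s) / 2 - (x + t) / 2\<bar> + \<bar>(x - s) / 2 - (x - t) / 2\<bar>)"
        unfolding on_cross_section_def using st x by (intro L cross_section_in_triangle) auto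
      also have "\<bar>(x + s) / 2 - (x + t) / 2\<bar> + \<bar>(x - s) / 2 - (x - t) / 2\<bar> = \<bar>s - t\<bar>"
        by (auto simp: abs_if field_simps)
      finally show "norm (on_cross_section F x s - on_cross_section F x t) \<le> L * \<bar>s - t\<bar>" .
    qed (use x L in auto)
    then show ?thesis by (simp add: n add.commute power2_eq_square)
  qed
  then show ?case using L(1) by (intro exI[of _ "8 * L"]) auto
next
  case (Suc k)
  then obtain Fu Fv where F: "smooth_triangle k b Fu" "smooth_triangle k b Fv" "partials b F Fu Fv"
    unfolding smooth_triangle.simps by blast
  \<comment> \<open>The derivative of \<open>F\<close> along the line of fixed x, on which u
    increases and v decreases at rate 1/2.\<close>
  define F' where "F' u v = (1 / 2) *\<^sub>R Fu u v + (- 1 / 2) *\<^sub>R Fv u v" for u v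
  have F': "smooth_triangle k b F'"
    unfolding F'_def by (intro smooth_triangle_add smooth_triangle_scaleR F)
  obtain C where C: "C \<ge> 0" "\<And>x N. x \<in> {0<..b} \<Longrightarrow> k + 1 \<le> N \<Longrightarrow> norm (legendre_moment x N (on_cross_section F' x))
      \<le> C * x ^ (k + 2) / ((real N + 1) ^ Suc k * sqrt (real N + 1))"
    using Suc.IH[OF F'] by blast
  \<comment> \<open>A factor 2 comes from the two moments in the recursion, the factor 2^(k+2) from
    \<open>decay_step\<close>.\<close>
  have "norm (legendre_moment x N (on_cross_section F x))
      \<le> 2 ^ (k + 3) * C * x ^ (Suc k + 2) / ((real N + 1) ^ Suc (Suc k) * sqrt (real N + 1))"
    if x: "x \<in> {0<..b}" and N: "Suc k + 1 \<le> N" for x N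
  proof -
    obtain n where n: "N = n + 1" "k + 1 \<le> n" using N by (cases N) auto
    have "legendre_moment x (n + 1) (on_cross_section F x) = (x / (2 * real n + 3)) *\<^sub>R
        (legendre_moment x n (on_cross_section F' x) - legendre_moment x (n + 2) (on_cross_section F' x))"
    proof (rule legendre_moment_Suc)
      fix t assume "t \<in> {-x..x}"
      then have "((\<lambda>t. F ((x + t) / 2) ((x - t) / 2)) has_vector_derivative
          (1 / 2) *\<^sub>R Fu ((x + t) / 2) ((x - t) / 2) + (- 1 / 2) *\<^sub>R Fv ((x + t) / 2) ((x - t) / 2)) (at t within {-x..x})"
        using x
        by (intro partials_has_vector_derivative_curve[OF F(3) smooth_triangle_continuous_on[OF F(1)]
              smooth_triangle_continuous_on[OF F(2)]] cross_section_in_triangle)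
           (auto intro!: derivative_eq_intros)
      then show "(on_cross_section F x has_vector_derivative on_cross_section F' x t) (at t within {-x..x})"
        by (simp add: on_cross_section_def[abs_def] F'_def)
    next
      have "continuous_on {-x..x} (\<lambda>t. case ((x + t) / 2, (x - t) / 2) of (u, v) \<Rightarrow> F' u v)"
        by (rule continuous_on_compose2[OF smooth_triangle_continuous_on[OF F']])
           (use x in \<open>auto intro!: continuous_intros simp flip: add_divide_distrib\<close>)
      then show "continuous_on {-x..x} (on_cross_section F' x)"
        by (simp add: on_cross_section_def[abs_def])
    qed (use x in auto)
    also have "norm \<dots> \<le> x / (2 * real n + 3) *
        (norm (legendre_moment x n (on_cross_section F' x)) + norm (legendre_moment x (n + 2) (on_cross_section F' x)))"
      using x by (simp add: mult_left_mono norm_triangle_ineq4 divide_right_mono)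
    also have "\<dots> \<le> x / (real n + 2) *
        (2 * (C * x ^ (k + 2) / ((real n + 1) ^ Suc k * sqrt (real n + 1))))"
    proof (rule mult_mono)
      have "norm (legendre_moment x (n + 2) (on_cross_section F' x))
          \<le> C * x ^ (k + 2) / ((real (n + 2) + 1) ^ Suc k * sqrt (real (n + 2) + 1))"
        using n by (intro C x) auto
      also have "\<dots> \<le> C * x ^ (k + 2) / ((real n + 1) ^ Suc k * sqrt (real n + 1))"
        using C(1) x by (intro divide_left_mono mult_mono power_mono real_sqrt_le_mono) auto
      finally show "norm (legendre_moment x n (on_cross_section F' x)) + norm (legendre_moment x (n + 2) (on_cross_section F' x))
          \<le> 2 * (C * x ^ (k + 2) / ((real n + 1) ^ Suc k * sqrt (real n + 1)))"
        using C(2)[OF x n(2)] by linarith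
    qed (use x in \<open>auto intro!: divide_left_mono\<close>)
    also have "\<dots> \<le> x / (real n + 2) *
        (2 * (C * x ^ (k + 2) * (2 ^ (k + 2) / ((real n + 2) ^ Suc k * sqrt (real n + 2)))))"
    proof -
      have "1 / ((real n + 1) ^ Suc k * sqrt (real n + 1)) \<le> 2 ^ (k + 2) / ((real n + 2) ^ Suc k * sqrt (real n + 2))"
        using decay_step[of n k] by (simp add: field_simps del: power_Suc)
      from mult_left_mono[OF this, of "C * x ^ (k + 2)"] C(1) x show ?thesis
        by (intro mult_left_mono) (auto simp del: power_Suc)
    qed
    also have "\<dots> = 2 ^ (k + 3) * C * x ^ (Suc k + 2) / ((real N + 1) ^ Suc (Suc k) * sqrt (real N + 1))"
    proof -
      define r where "r = real n + 2"
      have "real N + 1 = r" "r > 0" by (simp_all add: n r_def)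
      then show ?thesis by (simp add: power_add flip: r_def) (simp add: field_simps power_add numeral_eq_Suc)
    qed
    finally show ?thesis by (simp add: n)
  qed
  then show ?case using C(1) by (intro exI[of _ "2 ^ (k + 3) * C"]) auto
qed

subsection \<open>Regularity of the kernel\<close>

lemma lipschitz_of_bounded_ae_derivative:
  fixes f g :: "real \<Rightarrow> complex"
  assumes f: "\<And>x. x \<in> {0..b} \<Longrightarrow> (g has_integral (f x - f 0)) {0..x}"
    and N: "negligible N" and g: "\<And>x. x \<in> {0..b} - N \<Longrightarrow> norm (g x) \<le> M" and "M \<ge> 0"
    and x: "x \<in> {0..b}" and y: "y \<in> {0..b}"
  shows "norm (f x - f y) \<le> M * \<bar>x - y\<bar>"
proof -
  have *: "norm (f y - f x) \<le> M * (y - x)" if "x \<in> {0..b}" "y \<in> {0..b}" "x \<le> y" for x y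
  proof -
    have gi: "g integrable_on {0..y}" using f[of y] that by (auto intro: has_integral_integrable)
    have "(g has_integral integral {x..y} g) {x..y}"
      using integrable_subinterval_real[OF gi, of x y] that by (auto intro: integrable_integral)
    moreover have "integral {x..y} g = f y - f x"
    proof -
      have "integral {0..x} g + integral {x..y} g = integral {0..y} g"
        using gi that by (intro Henstock_Kurzweil_Integration.integral_combine) auto
      then have "f x - f 0 + integral {x..y} g = f y - f 0"
        unfolding integral_unique[OF f[OF that(1)]] integral_unique[OF f[OF that(2)]] .
      then show ?thesis by (simp add: algebra_simps)
    qed
    ultimately have "(g has_integral (f y - f x)) {x..y}" by simp
    then have "((\<lambda>t. if t \<in> N then 0 else g t) has_integral (f y - f x)) {x..y}"
      by (rule has_integral_spike[OF N, rotated]) auto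
    from has_integral_bound_real[OF \<open>M \<ge> 0\<close> _ this, of "{}"]
    show ?thesis using g \<open>M \<ge> 0\<close> that by auto
  qed
  show ?thesis
    using *[OF x y] *[OF y x] by (cases "x \<le> y") (auto simp: norm_minus_commute abs_minus_commute)
qed

lemma L_infty_borel_representative:
  assumes "L_infty b Q"
  obtains q N M where "q \<in> borel_measurable borel" "\<And>y. norm (q y) \<le> M" "\<And>y. y \<notin> {0..b} \<Longrightarrow> q y = 0"
    "negligible N" "\<And>y. y \<in> {0..b} - N \<Longrightarrow> q y = Q y"
proof -
  define Q' where "Q' x = (if x \<in> {0..b} then Q x else 0)" for x
  have Q'_meas: "Q' \<in> borel_measurable (completion lborel)"
    using assms unfolding L_infty_def Q'_def[abs_def] by (intro borel_measurable_if_I) auto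
  have "(\<lambda>x. Re (Q' x)) \<in> borel_measurable (completion lborel)" "(\<lambda>x. Im (Q' x)) \<in> borel_measurable (completion lborel)"
    by (intro measurable_compose[OF Q'_meas]; simp)+
  from this[THEN completion_ex_borel_measurable_real] obtain r i where
    r [measurable]: "r \<in> borel_measurable borel" and i [measurable]: "i \<in> borel_measurable borel"
    and ri: "AE x in lborel. Re (Q' x) = r x" "AE x in lborel. Im (Q' x) = i x"
    by auto
  obtain M0 where "AE x in lebesgue_on {0..b}. norm (Q x) \<le> M0"
    using assms unfolding L_infty_def by blast
  then have M0: "AE x in lebesgue. x \<in> {0..b} \<longrightarrow> norm (Q x) \<le> M0"
    by (subst (asm) AE_restrict_space_iff) auto
  define q0 where "q0 x = Complex (r x) (i x)" for x
  have q0_eq: "q0 x = of_real (r x) + \<i> * of_real (i x)" for x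
    by (simp add: q0_def complex_eq_iff)
  have [measurable]: "q0 \<in> borel_measurable borel"
    unfolding q0_eq[abs_def] by measurable
  \<comment> \<open>Cutting off at the essential bound makes the bound valid at every point and
    alters \<open>q0\<close> within {0..b} on a null set at most.\<close>
  define q where "q x = (if x \<in> {0..b} \<and> norm (q0 x) \<le> M0 then q0 x else 0)" for x
  have [measurable]: "q \<in> borel_measurable borel"
    unfolding q_def[abs_def] by measurable
  have "AE x in lborel. q0 x = Q' x"
    using ri by eventually_elim (simp add: q0_def complex_eq_iff)
  then have "AE x in lebesgue. q0 x = Q' x" by (rule AE_completion)
  with M0 have "AE x in lebesgue. x \<in> {0..b} \<longrightarrow> q x = Q x"
    by eventually_elim (auto simp: q_def Q'_def)
  then obtain N where "N \<in> null_sets lebesgue" "\<And>x. x \<notin> N \<Longrightarrow> x \<in> {0..b} \<longrightarrow> q x = Q x"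
    by (auto elim!: AE_E3)
  then show thesis
    using \<open>q \<in> borel_measurable borel\<close>
    by (intro that[of q "max M0 0" N]) (auto simp: q_def negligible_iff_null_sets)
qed

text \<open>These are the two ways in which the potential enters the derivatives of
  \<open>H\<close>: as the factor q (u + v) of \<open>H\<close>, and as q u, which comes from
  \<open>Q1\<close>. The index drops by one because a bounded last derivative is recorded as
  Lipschitz continuity of the one before it.\<close>

lemma W_infty_Suc_smooth:
  "W_infty (Suc k) b f \<Longrightarrow>
     smooth_triangle k b (\<lambda>u v. f (u + v)) \<and> smooth_triangle k b (\<lambda>u v. f u)"
proof (induction k arbitrary: f)
  case 0
  then obtain g where g: "L_infty b g" "\<And>x. x \<in> {0..b} \<Longrightarrow> (g has_integral (f x - f 0)) {0..x}"
    by auto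
  obtain q N M where q: "q \<in> borel_measurable borel" "\<And>y. norm (q y) \<le> M" "\<And>y. y \<notin> {0..b} \<Longrightarrow> q y = 0"
      "negligible N" "\<And>y. y \<in> {0..b} - N \<Longrightarrow> q y = g y"
    using L_infty_borel_representative[OF g(1)] by metis
  have M: "M \<ge> 0" by (rule order_trans[OF norm_ge_zero q(2)])
  have gM: "norm (g x) \<le> M" if "x \<in> {0..b} - N" for x
    using q(2)[of x] q(5)[OF that] by simp
  have lip: "norm (f x - f y) \<le> M * \<bar>x - y\<bar>" if "x \<in> {0..b}" "y \<in> {0..b}" for x y
    by (rule lipschitz_of_bounded_ae_derivative[OF _ q(4) gM M that]) (rule g(2))
  have "lipschitz_triangle b (\<lambda>u v. f (u + v))"
  proof (rule lipschitz_triangleI)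
    show "norm (f (u + v) - f (u' + v)) \<le> M * \<bar>u - u'\<bar>"
      if "(u, v) \<in> char_triangle b" "(u', v) \<in> char_triangle b" for u u' v
      using lip[of "u + v" "u' + v"] that by simp
    show "norm (f (u + v) - f (u + v')) \<le> M * \<bar>v - v'\<bar>"
      if "(u, v) \<in> char_triangle b" "(u, v') \<in> char_triangle b" for u v v'
      using lip[of "u + v" "u + v'"] that by simp
  qed
  moreover have "lipschitz_triangle b (\<lambda>u v. f u)"
    using lip M by (intro lipschitz_triangleI[where L = M and L' = 0]) auto
  ultimately show ?case by simp
next
  case (Suc k)
  then obtain g where g: "W_infty (Suc k) b g" "\<And>x. x \<in> {0..b} \<Longrightarrow> (g has_integral (f x - f 0)) {0..x}"
    unfolding W_infty.simps(2)[of "Suc k"] by blast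
  note IH = Suc.IH[OF g(1)]
  have gc: "continuous_on {0..b} g"
  proof -
    have "continuous_on {0..b} (\<lambda>u. case (u, 0 :: real) of (u, v) \<Rightarrow> g u)"
      by (rule continuous_on_compose2[OF smooth_triangle_continuous_on[OF conjunct2[OF IH]]])
         (auto intro!: continuous_intros)
    then show ?thesis by simp
  qed
  have d: "(f has_vector_derivative g x) (at x within {0..b})" if x: "x \<in> {0..b}" for x
  proof -
    have "((\<lambda>x. f 0 + integral {0..x} g) has_vector_derivative 0 + g x) (at x within {0..b})"
      by (intro has_vector_derivative_add has_vector_derivative_const integral_has_vector_derivative gc x)
    then have *: "((\<lambda>x. f 0 + integral {0..x} g) has_vector_derivative g x) (at x within {0..b})"
      by simp
    show ?thesis
    proof (rule has_vector_derivative_transform[OF x _ *])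
      show "f y = f 0 + integral {0..y} g" if "y \<in> {0..b}" for y
        using integral_unique[OF g(2)[OF that]] by simp
    qed
  qed
  have shift: "((\<lambda>a. f (a + c)) has_vector_derivative g (a + c)) (at a within {0..b - c})" if "0 \<le> c" "0 \<le> a" "a + c \<le> b" for a c
  proof -
    have "(f \<circ> (\<lambda>a. a + c) has_vector_derivative 1 *\<^sub>R g (a + c)) (at a within {0..b - c})"
    proof (rule vector_diff_chain_within)
      show "((\<lambda>a. a + c) has_vector_derivative 1) (at a within {0..b - c})"
        by (auto intro!: derivative_eq_intros)
      show "(f has_vector_derivative g (a + c)) (at (a + c) within (\<lambda>a. a + c) ` {0..b - c})"
        using that by (intro has_vector_derivative_within_subset[OF d]) auto
    qed
    then show ?thesis by (simp add: o_def)
  qed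
  have "partials b (\<lambda>u v. f (u + v)) (\<lambda>u v. g (u + v)) (\<lambda>u v. g (u + v))"
    unfolding partials_def
  proof (intro allI impI conjI)
    fix u v assume "(u, v) \<in> char_triangle b"
    then show "((\<lambda>a. f (a + v)) has_vector_derivative g (u + v)) (at u within {0..b - v})"
      "((\<lambda>w. f (u + w)) has_vector_derivative g (u + v)) (at v within {0..b - u})"
      using shift[of v u] shift[of u v] by (simp_all add: add.commute)
  qed
  moreover have "partials b (\<lambda>u v. f u) (\<lambda>u v. g u) (\<lambda>u v. 0)"
    unfolding partials_def by (auto intro!: has_vector_derivative_within_subset[OF d])
  ultimately show ?case
    using IH by (auto intro!: smooth_triangle_SucI smooth_triangle_const simp del: smooth_triangle.simps)
qed

lemma W_infty_Suc_continuous_on: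
  assumes "W_infty (Suc k) b f"
  shows "continuous_on {0..b} f"
proof -
  have "continuous_on {0..b} (\<lambda>u. case (u, 0 :: real) of (u, v) \<Rightarrow> f u)"
    by (rule continuous_on_compose2[OF smooth_triangle_continuous_on[OF conjunct2[OF W_infty_Suc_smooth[OF assms]]]])
       (auto intro!: continuous_intros)
  then show ?thesis by simp
qed

text \<open>For p > 0 no exceptional set is tolerable, since \<open>W_infty (Suc k)\<close>
  prescribes the function at every point of {0..b}. But \<open>Q\<close> is continuous in that case,
  and its extension by zero is already Borel and bounded.\<close>

lemma W_infty_borel_representative:
  assumes "W_infty p b Q"
  obtains q N M where "q \<in> borel_measurable borel" "\<And>y. norm (q y) \<le> M" "\<And>y. y \<notin> {0..b} \<Longrightarrow> q y = 0"
    "negligible N" "\<And>y. y \<in> {0..b} - N \<Longrightarrow> q y = Q y" "p > 0 \<Longrightarrow> N = {}"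
proof (cases p)
  case 0
  then have "L_infty b Q" using assms by simp
  then obtain q N M where "q \<in> borel_measurable borel" "\<And>y. norm (q y) \<le> M" "\<And>y. y \<notin> {0..b} \<Longrightarrow> q y = 0"
    "negligible N" "\<And>y. y \<in> {0..b} - N \<Longrightarrow> q y = Q y"
    using L_infty_borel_representative by metis
  then show thesis using 0 by (intro that[of q M N]) auto
next
  case (Suc k)
  have Qc: "continuous_on {0..b} Q" using W_infty_Suc_continuous_on assms Suc by blast
  obtain M where M: "\<forall>z\<in>Q ` {0..b}. norm z \<le> M"
    using compact_imp_bounded[OF compact_continuous_image[OF Qc compact_Icc]] unfolding bounded_iff ..
  show thesis
  proof (rule that)
    show "(\<lambda>y. indicator {0..b} y *\<^sub>R Q y) \<in> borel_measurable borel"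
      by (rule borel_measurable_indicator_continuous[OF Qc])
    show "norm (indicator {0..b} y *\<^sub>R Q y) \<le> max M 0" for y
      using M by (cases "y \<in> {0..b}") (auto simp: le_max_iff_disj)
  qed auto
qed

lemma schroedinger_ivp_cong_ae:
  assumes "schroedinger_ivp b Q \<omega> u0 u1 u" "negligible N" "\<And>y. y \<in> {0..b} - N \<Longrightarrow> q y = Q y"
  shows "schroedinger_ivp b q \<omega> u0 u1 u"
proof -
  have "((\<lambda>y. (q y - \<omega>\<^sup>2) * u y) has_integral I) {0..x}"
    if "((\<lambda>y. (Q y - \<omega>\<^sup>2) * u y) has_integral I) {0..x}" "x \<in> {0..b}" for I x
    using that(2) assms(3) by (intro has_integral_spike[OF assms(2) _ that(1)]) auto
  then show ?thesis using assms(1) unfolding schroedinger_ivp_def by blast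
qed

context schroedinger_transmutation begin

text \<open>If \<open>H\<close> has order j < p, then so has q (u + v) times \<open>H\<close>,
  because q has order p - 1 >= j in the sense of the triangle. The double integral raises this to j
  + 1, and so does the free term, whose derivative in u is q / 2. The bootstrap starts from
  \<open>H_lipschitz\<close> and stops where the regularity of q is exhausted.\<close>

lemma H_smooth:
  assumes W: "W_infty p b q" and "j \<le> p"
  shows "smooth_triangle j b H"
  using \<open>j \<le> p\<close>
proof (induction j)
  case 0
  show ?case using H_lipschitz unfolding smooth_triangle.simps lipschitz_triangle_def by blast
next
  case (Suc j)
  then obtain k where p: "p = Suc k" "j \<le> k" by (cases p) auto
  define W' where "W' u v = q (u + v) * H u v" for u v
  have q: "smooth_triangle j b (\<lambda>u v. q (u + v))" "smooth_triangle j b (\<lambda>u v. q u)"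
    using W_infty_Suc_smooth[of k b q] W p by (auto intro: smooth_triangle_mono)
  have W': "smooth_triangle j b W'"
    unfolding W'_def using Suc by (intro smooth_triangle_mult q) auto
  have qc: "continuous_on {0..b} q" using W p by (auto intro: W_infty_Suc_continuous_on simp del: W_infty.simps)
  have "partials b (\<lambda>u v. h / 2 + (1 / 2) *\<^sub>R integral {0..u} q + integral_fst (integral_snd W') u v)
      (\<lambda>u v. 0 + (1 / 2) *\<^sub>R q u + integral_snd W' u v) (\<lambda>u v. 0 + (1 / 2) *\<^sub>R 0 + integral_fst W' u v)"
    unfolding partials_def
  proof (intro allI impI conjI)
    fix u v assume uv: "(u, v) \<in> char_triangle b"
    have "((\<lambda>u. integral {0..u} q) has_vector_derivative q u) (at u within {0..b})"
      by (rule integral_has_vector_derivative[OF qc]) (use uv in auto)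
    then have "((\<lambda>u. integral {0..u} q) has_vector_derivative q u) (at u within {0..b - v})"
      by (rule has_vector_derivative_within_subset) (use uv in auto)
    then show "((\<lambda>u. h / 2 + (1 / 2) *\<^sub>R integral {0..u} q + integral_fst (integral_snd W') u v)
        has_vector_derivative 0 + (1 / 2) *\<^sub>R q u + integral_snd W' u v) (at u within {0..b - v})"
      using partials_integral_fst_snd[OF W'] uv unfolding partials_def
      by (intro has_vector_derivative_add has_vector_derivative_const
          bounded_linear.has_vector_derivative[OF bounded_linear_scaleR_right]) auto
    show "((\<lambda>v. h / 2 + (1 / 2) *\<^sub>R integral {0..u} q + integral_fst (integral_snd W') u v)
        has_vector_derivative 0 + (1 / 2) *\<^sub>R 0 + integral_fst W' u v) (at v within {0..b - u})"
      using partials_integral_fst_snd[OF W'] uv unfolding partials_def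
      by (intro has_vector_derivative_add has_vector_derivative_const
          bounded_linear.has_vector_derivative[OF bounded_linear_scaleR_right]) auto
  qed
  then have "smooth_triangle (Suc j) b (\<lambda>u v. h / 2 + (1 / 2) *\<^sub>R integral {0..u} q + integral_fst (integral_snd W') u v)"
    by (rule smooth_triangle_SucI)
       (intro smooth_triangle_add smooth_triangle_const smooth_triangle_scaleR q
          smooth_triangle_integral_snd smooth_triangle_integral_fst W')+
  then show ?case
  proof (rule smooth_triangle_cong[rotated])
    fix u v assume uv: "(u, v) \<in> char_triangle b"
    then show "h / 2 + (1 / 2) *\<^sub>R integral {0..u} q + integral_fst (integral_snd W') u v = H u v"
      by (simp add: H_def[of u v] Q1_eq_integral J_eq_integral integral_fst_def integral_snd_def W'_def[abs_def] scaleR_conv_of_real)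
  qed
qed

end

subsection \<open>Estimates of the coefficients\<close>

lemma norm_vector_derivative_le_lipschitz:
  fixes f :: "real \<Rightarrow> 'a::real_normed_vector"
  assumes d: "(f has_vector_derivative d) (at x within S)"
    and nt: "at x within S \<noteq> bot"
    and lip: "\<And>y. y \<in> S \<Longrightarrow> norm (f y - f x) \<le> L * \<bar>y - x\<bar>"
  shows "norm d \<le> L"
proof -
  let ?r = "\<lambda>y. (1 / norm (y - x)) *\<^sub>R (f y - (f x + (y - x) *\<^sub>R d))"
  have "(?r \<longlongrightarrow> 0) (at x within S)"
    using d by (simp add: has_vector_derivative_def has_derivative_within)
  then have "((\<lambda>y. L + norm (?r y)) \<longlongrightarrow> L + norm (0 :: 'a)) (at x within S)"
    by (intro tendsto_intros)
  moreover have "\<forall>\<^sub>F y in at x within S. norm d \<le> L + norm (?r y)"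
    unfolding eventually_at_filter
  proof (intro always_eventually allI impI)
    fix y assume "y \<noteq> x" "y \<in> S"
    have "\<bar>y - x\<bar> * norm d = norm ((f y - f x) - (f y - (f x + (y - x) *\<^sub>R d)))" by simp
    also have "\<dots> \<le> L * \<bar>y - x\<bar> + norm (f y - (f x + (y - x) *\<^sub>R d))"
      by (rule order_trans[OF norm_triangle_ineq4 add_right_mono[OF lip[OF \<open>y \<in> S\<close>]]])
    finally have "norm d \<le> L + norm (f y - (f x + (y - x) *\<^sub>R d)) / \<bar>y - x\<bar>"
      using \<open>y \<noteq> x\<close> unfolding add_divide_eq_iff[of "\<bar>y - x\<bar>"] by (simp add: field_simps)
    then show "norm d \<le> L + norm (?r y)" by (simp only: norm_scaleR) simp
  qed
  ultimately show ?thesis using nt by (auto intro: tendsto_lowerbound)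
qed

lemma fourier_legendre_coeff_eq_moment:
  "fourier_legendre_coeff F N x = ((2 * real N + 1) / 2) *\<^sub>R legendre_moment x N (F x)"
  by (simp add: fourier_legendre_coeff_def legendre_moment_def scaleR_conv_of_real mult.commute)

text \<open>The end points are left aside because for modulus of t equal to x = b the interval in
  \<open>dx_kernel\<close> shrinks to a point, and the derivative is then not determined.\<close>

lemma legendre_moment_cong_interior:
  assumes "\<And>t. \<bar>t\<bar> < x \<Longrightarrow> f t = g t"
  shows "legendre_moment x N f = legendre_moment x N g"
  unfolding legendre_moment_def
  by (rule integral_spike[where S = "{-x, x}"]) (use assms in \<open>auto simp: abs_less_iff\<close>)

text \<open>The normalization (2 N + 1) / 2 <= N + 1 cancels one power of N + 1, after which N + 1
  is lowered to N - 1. With N = 1 the right-hand side would be 0 by the convention for division,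
  hence N >= 2.\<close>

lemma scaled_decay_bound:
  assumes "m \<le> C * X / ((real N + 1) ^ Suc k * sqrt (real N + 1))" "0 \<le> C" "0 \<le> X" "N \<ge> 2"
  shows "(2 * real N + 1) / 2 * m \<le> C * X / (real N - 1) powr (real k + 1 / 2)"
proof -
  let ?D = "(real N + 1) ^ k * sqrt (real N + 1)"
  have "(2 * real N + 1) / 2 * m \<le> (real N + 1) * (C * X / ((real N + 1) ^ Suc k * sqrt (real N + 1)))"
  proof (rule order_trans[OF mult_left_mono[OF assms(1)] mult_right_mono])
    show "0 \<le> C * X / ((real N + 1) ^ Suc k * sqrt (real N + 1))"
      using assms by (intro divide_nonneg_nonneg mult_nonneg_nonneg) auto
  qed auto
  also have "\<dots> = C * X / ?D"
  proof -
    have "r > 0 \<Longrightarrow> r * (C * X / (r ^ Suc k * sqrt r)) = C * X / (r ^ k * sqrt r)" for r :: real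
      by simp
    then show ?thesis by simp
  qed
  also have "\<dots> \<le> C * X / (real N - 1) powr (real k + 1 / 2)"
  proof (rule divide_left_mono)
    have "(real N - 1) powr (real k + 1 / 2) \<le> (real N + 1) powr (real k + 1 / 2)"
      using \<open>N \<ge> 2\<close> by (intro powr_mono2) auto
    also have "\<dots> = ?D"
      by (simp only: powr_add powr_realpow powr_half_sqrt of_nat_0_le_iff add_nonneg_pos zero_less_one)
    finally show "(real N - 1) powr (real k + 1 / 2) \<le> ?D" .
  qed (use assms in auto)
  finally show ?thesis .
qed

context schroedinger_transmutation begin

lemma beta_coeff_bound:
  assumes "W_infty p b q"
  shows "\<exists>C. \<forall>x\<in>{0<..b}. \<forall>N::nat. N \<ge> p + 1 \<and> N \<ge> 2 \<longrightarrow>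
    norm (beta_coeff K N x) \<le> C * x ^ (p + 2) / (real N - 1) powr (real p + 1 / 2)"
proof -
  obtain C where C: "C \<ge> 0" "\<forall>x\<in>{0<..b}. \<forall>N\<ge>p + 1. norm (legendre_moment x N (on_cross_section H x))
    \<le> C * x ^ (p + 2) / ((real N + 1) ^ Suc p * sqrt (real N + 1))"
    using legendre_moment_smooth_triangle[OF H_smooth[OF assms order_refl]] by blast
  have "norm (beta_coeff K N x) \<le> C * x ^ (p + 2) / (real N - 1) powr (real p + 1 / 2)"
    if x: "x \<in> {0<..b}" and N: "N \<ge> p + 1" "N \<ge> 2" for x and N :: nat
  proof -
    have "legendre_moment x N (K x) = legendre_moment x N (on_cross_section H x)"
      using x by (intro legendre_moment_cong_interior) (simp add: K_eq_H on_cross_section_def)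
    then have "norm (beta_coeff K N x) = (2 * real N + 1) / 2 * norm (legendre_moment x N (on_cross_section H x))"
      by (simp add: beta_coeff_def fourier_legendre_coeff_eq_moment)
    also have "\<dots> \<le> C * x ^ (p + 2) / (real N - 1) powr (real p + 1 / 2)"
      using x N C by (intro scaled_decay_bound) auto
    finally show ?thesis .
  qed
  then show ?thesis by blast
qed

lemma gamma_coeff_bound_Suc:
  assumes "W_infty (Suc k) b q"
  shows "\<exists>D. \<forall>x\<in>{0<..b}. \<forall>N::nat. N \<ge> Suc k \<and> N \<ge> 2 \<longrightarrow>
    norm (gamma_coeff b K N x) \<le> D * x ^ (Suc k + 1) / (real N - 1) powr (real (Suc k) - 1 / 2)"
proof -
  obtain Hu Hv where H: "smooth_triangle k b Hu" "smooth_triangle k b Hv" "partials b H Hu Hv"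
    using H_smooth[OF assms order_refl] by auto
  \<comment> \<open>The derivative of \<open>H\<close> along the line of fixed t, on which u and v
    both increase at rate 1/2.\<close>
  define Hx where "Hx u v = (1 / 2) *\<^sub>R Hu u v + (1 / 2) *\<^sub>R Hv u v" for u v
  have "smooth_triangle k b Hx"
    unfolding Hx_def by (intro smooth_triangle_add smooth_triangle_scaleR H)
  then obtain C where C: "C \<ge> 0" "\<forall>x\<in>{0<..b}. \<forall>N\<ge>k + 1. norm (legendre_moment x N (on_cross_section Hx x))
    \<le> C * x ^ (k + 2) / ((real N + 1) ^ Suc k * sqrt (real N + 1))"
    using legendre_moment_smooth_triangle by blast
  have dx: "dx_kernel b K x t = on_cross_section Hx x t" if x: "0 < x" "x \<le> b" and t: "\<bar>t\<bar> < x" for x t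
  proof -
    have "((\<lambda>y. H ((y + t) / 2) ((y - t) / 2)) has_vector_derivative
        (1 / 2) *\<^sub>R Hu ((x + t) / 2) ((x - t) / 2) + (1 / 2) *\<^sub>R Hv ((x + t) / 2) ((x - t) / 2)) (at x within {\<bar>t\<bar>..b})"
      using x t
      by (intro partials_has_vector_derivative_curve[OF H(3) smooth_triangle_continuous_on[OF H(1)]
            smooth_triangle_continuous_on[OF H(2)]] cross_section_in_triangle)
         (auto intro!: derivative_eq_intros)
    then have "((\<lambda>y. H ((y + t) / 2) ((y - t) / 2)) has_vector_derivative on_cross_section Hx x t) (at x within {\<bar>t\<bar>..b})"
      by (simp add: on_cross_section_def Hx_def)
    then have "((\<lambda>y. K y t) has_vector_derivative on_cross_section Hx x t) (at x within {\<bar>t\<bar>..b})"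
      by (rule has_vector_derivative_transform[rotated 2]) (use x t in \<open>auto intro!: K_eq_H\<close>)
    then show ?thesis
      unfolding dx_kernel_def
      by (rule vector_derivative_within_closed_interval[rotated 2]) (use x t in auto)
  qed
  have "norm (gamma_coeff b K N x) \<le> C * x ^ (Suc k + 1) / (real N - 1) powr (real (Suc k) - 1 / 2)"
    if x: "x \<in> {0<..b}" and N: "N \<ge> Suc k" "N \<ge> 2" for x and N :: nat
  proof -
    have "legendre_moment x N (dx_kernel b K x) = legendre_moment x N (on_cross_section Hx x)"
      using x by (intro legendre_moment_cong_interior dx) auto
    then have "norm (gamma_coeff b K N x) = (2 * real N + 1) / 2 * norm (legendre_moment x N (on_cross_section Hx x))"
      by (simp add: gamma_coeff_def fourier_legendre_coeff_eq_moment)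
    also have "\<dots> \<le> C * x ^ (k + 2) / (real N - 1) powr (real k + 1 / 2)"
      using x N C by (intro scaled_decay_bound) auto
    also have "real k + 1 / 2 = real (Suc k) - 1 / 2" by simp
    finally show ?thesis by simp
  qed
  then show ?thesis by blast
qed

text \<open>Lipschitz continuity of \<open>H\<close> bounds the derivative wherever it exists, and
  elsewhere \<open>dx_kernel\<close> has one fixed value. The bound therefore holds at every
  interior point, although \<open>K\<close> may fail to be differentiable in x there.\<close>

lemma dx_kernel_bounded: "\<exists>B. \<forall>x t. 0 < x \<longrightarrow> x \<le> b \<longrightarrow> \<bar>t\<bar> < x \<longrightarrow> norm (dx_kernel b K x t) \<le> B"
proof -
  let ?L = "M / 2 + M * BK * b"
  \<comment> \<open>The value of \<open>vector_derivative\<close> at points of non-differentiability.\<close>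
  define d0 :: complex where "d0 = (SOME d. False)"
  have "norm (dx_kernel b K x t) \<le> max ?L (norm d0)" if x: "0 < x" "x \<le> b" and t: "\<bar>t\<bar> < x" for x t
  proof (cases "\<exists>d. ((\<lambda>y. K y t) has_vector_derivative d) (at x within {\<bar>t\<bar>..b})")
    case True
    then have d: "((\<lambda>y. K y t) has_vector_derivative dx_kernel b K x t) (at x within {\<bar>t\<bar>..b})"
      unfolding dx_kernel_def vector_derivative_def by (rule someI_ex)
    have "norm (dx_kernel b K x t) \<le> ?L"
    proof (rule norm_vector_derivative_le_lipschitz[OF d])
      show "at x within {\<bar>t\<bar>..b} \<noteq> bot"
        using x t by (simp add: trivial_limit_within islimpt_Icc)
      fix y assume y: "y \<in> {\<bar>t\<bar>..b}"
      have "norm (K y t - K x t) \<le> ?L * (\<bar>(y + t) / 2 - (x + t) / 2\<bar> + \<bar>(y - t) / 2 - (x - t) / 2\<bar>)"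
        using x t y H_lipschitz order_trans[OF abs_ge_zero, of t y] by (simp add: K_eq_H[of y t] K_eq_H[of x t])
      also have "\<bar>(y + t) / 2 - (x + t) / 2\<bar> + \<bar>(y - t) / 2 - (x - t) / 2\<bar> = \<bar>y - x\<bar>"
        by (auto simp: abs_if field_simps)
      finally show "norm (K y t - K x t) \<le> ?L * \<bar>y - x\<bar>" .
    qed
    then show ?thesis by simp
  next
    case False
    then have "dx_kernel b K x t = d0"
      by (simp add: dx_kernel_def vector_derivative_def d0_def)
    then show ?thesis by simp
  qed
  then show ?thesis by blast
qed

lemma gamma_coeff_bound_0:
  "\<exists>D. \<forall>x\<in>{0<..b}. \<forall>N::nat. N \<ge> 2 \<longrightarrow>
    norm (gamma_coeff b K N x) \<le> D * x / (real N - 1) powr (- 1 / 2)"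
proof -
  obtain B where B: "\<And>x t. 0 < x \<Longrightarrow> x \<le> b \<Longrightarrow> \<bar>t\<bar> < x \<Longrightarrow> norm (dx_kernel b K x t) \<le> B"
    using dx_kernel_bounded by blast
  have B0: "0 \<le> B" using order_trans[OF norm_ge_zero B[of b 0]] b_pos by simp
  have "norm (gamma_coeff b K N x) \<le> (3 * B) * x / (real N - 1) powr (- 1 / 2)"
    if x: "x \<in> {0<..b}" and N: "N \<ge> 2" for x and N :: nat
  proof -
    \<comment> \<open>Setting the end values to 0 makes the bound \<open>B\<close> valid for all t
      without changing the moment.\<close>
    define f where "f t = (if \<bar>t\<bar> < x then dx_kernel b K x t else 0)" for t
    have f: "norm (f t) \<le> B" for t using B[of x t] B0 x by (simp add: f_def)
    let ?P = "\<lambda>t. poly (legendre_poly N) (t / x)"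
    \<comment> \<open>Integrability of \<open>dx_kernel\<close> in t has not been established here.
      If it fails, the integral is 0 by convention and the bound is trivial.\<close>
    have mom: "norm (legendre_moment x N f) \<le> B * (2 * x / sqrt (2 * real N + 1))"
    proof (cases "(\<lambda>t. ?P t *\<^sub>R f t) integrable_on {-x..x}")
      case True
      have "norm (legendre_moment x N f) \<le> integral {-x..x} (\<lambda>t. B * \<bar>?P t\<bar>)"
        unfolding legendre_moment_def
      proof (rule integral_norm_bound_integral[OF True])
        show "norm (?P t *\<^sub>R f t) \<le> B * \<bar>?P t\<bar>" for t
          using f[of t] by (simp add: mult.commute[of B] mult_left_mono)
      qed (intro integrable_continuous_real continuous_intros)
      also have "\<dots> = B * integral {-x..x} (\<lambda>t. \<bar>?P t\<bar>)" by simp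
      also have "\<dots> \<le> B * (2 * x / sqrt (2 * real N + 1))"
        using x B0 by (intro mult_left_mono integral_abs_legendre_poly_le) auto
      finally show ?thesis .
    next
      case False
      then show ?thesis
        using x B0 by (simp add: legendre_moment_def not_integrable_integral)
    qed
    have "legendre_moment x N (dx_kernel b K x) = legendre_moment x N f"
      by (rule legendre_moment_cong_interior) (simp add: f_def)
    then have "norm (gamma_coeff b K N x) = (2 * real N + 1) / 2 * norm (legendre_moment x N f)"
      by (simp add: gamma_coeff_def fourier_legendre_coeff_eq_moment)
    also have "\<dots> \<le> (2 * real N + 1) / 2 * (B * (2 * x / sqrt (2 * real N + 1)))"
      by (intro mult_left_mono mom) auto
    also have "\<dots> = B * x * sqrt (2 * real N + 1)"
      using real_div_sqrt[of "2 * real N + 1"] by (simp add: field_simps)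
    \<comment> \<open>The constant 3 comes from 2 N + 1 <= 9 (N - 1), valid for N >= 2.\<close>
    also have "\<dots> \<le> B * x * (3 * sqrt (real N - 1))"
    proof (rule mult_left_mono)
      have "sqrt (2 * real N + 1) \<le> sqrt (3\<^sup>2 * (real N - 1))" using N by (intro real_sqrt_le_mono) simp
      then show "sqrt (2 * real N + 1) \<le> 3 * sqrt (real N - 1)" unfolding real_sqrt_mult by simp
    qed (use x B0 in auto)
    also have "\<dots> = (3 * B) * x / (real N - 1) powr (- 1 / 2)"
      using N powr_minus_divide[of "real N - 1" "1 / 2"] by (simp add: powr_half_sqrt)
    finally show ?thesis .
  qed
  then show ?thesis by blast
qed

end

theorem propositionA3:
  fixes b :: real and p :: nat and Q :: "real \<Rightarrow> complex" and h :: complex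
    and c s :: "complex \<Rightarrow> real \<Rightarrow> complex" and K :: "real \<Rightarrow> real \<Rightarrow> complex"
  assumes "b > 0"
    and "W_infty p b Q"
    and "\<And>\<omega>. schroedinger_ivp b Q \<omega> 1 h (c \<omega>)"
    and "\<And>\<omega>. schroedinger_ivp b Q \<omega> 0 \<omega> (s \<omega>)"
    and "transmutation_kernel b c s K"
  shows "(\<exists>C::real. \<forall>x\<in>{0<..b}. \<forall>N::nat. N \<ge> p + 1 \<and> N \<ge> 2 \<longrightarrow>
            norm (beta_coeff K N x) \<le> C * x ^ (p + 2) / (real N - 1) powr (real p + 1 / 2)) \<and>
         (\<exists>D::real. \<forall>x\<in>{0<..b}. \<forall>N::nat. N \<ge> p \<and> N \<ge> 2 \<longrightarrow>
            norm (gamma_coeff b K N x) \<le> D * x ^ (p + 1) / (real N - 1) powr (real p - 1 / 2))"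
proof -
  obtain q N M where q: "q \<in> borel_measurable borel" "\<And>y. norm (q y) \<le> M" "\<And>y. y \<notin> {0..b} \<Longrightarrow> q y = 0"
      "negligible N" "\<And>y. y \<in> {0..b} - N \<Longrightarrow> q y = Q y"
    and N: "p > 0 \<Longrightarrow> N = {}"
    using W_infty_borel_representative[OF assms(2)] by metis
  \<comment> \<open>Passing from \<open>Q\<close> to \<open>q\<close> keeps the same solutions and
    the same kernel, because the differential equation is imposed through integrals and these ignore
    the null set \<open>N\<close>.\<close>
  interpret schroedinger_transmutation b h q M c s K
    by unfold_locales
       (use assms q in \<open>auto intro: schroedinger_ivp_cong_ae[OF _ q(4,5)]\<close>)
  have W: "W_infty p b q"
  proof (cases p)
    case 0
    have "q \<in> borel_measurable (lebesgue_on {0..b})"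
      using q(1) by (intro measurable_restrict_space1 measurable_completion) simp
    then show ?thesis using q(2) 0 by (auto simp: L_infty_def)
  next
    case (Suc k)
    then have eq: "q y = Q y" if "y \<in> {0..b}" for y using q(5) N that by auto
    obtain g where "W_infty k b g" "\<forall>x\<in>{0..b}. (g has_integral (Q x - Q 0)) {0..x}"
      using assms(2) Suc by auto
    then show ?thesis using Suc eq b_pos by auto
  qed
  show ?thesis
  proof
    show "\<exists>C::real. \<forall>x\<in>{0<..b}. \<forall>N::nat. N \<ge> p + 1 \<and> N \<ge> 2 \<longrightarrow>
        norm (beta_coeff K N x) \<le> C * x ^ (p + 2) / (real N - 1) powr (real p + 1 / 2)"
      by (rule beta_coeff_bound[OF W])
    show "\<exists>D::real. \<forall>x\<in>{0<..b}. \<forall>N::nat. N \<ge> p \<and> N \<ge> 2 \<longrightarrow>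
        norm (gamma_coeff b K N x) \<le> D * x ^ (p + 1) / (real N - 1) powr (real p - 1 / 2)"
    proof (cases p)
      case 0
      then show ?thesis using gamma_coeff_bound_0 by simp
    next
      case (Suc k)
      then show ?thesis using gamma_coeff_bound_Suc[of k] W by simp
    qed
  qed
qed

end
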